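(* Let $p\ge1$ and let $\psi\in C^\infty(\mathbb{R})$. Assume that $\psi^{(p+3)}$ and $\psi^{(p+4)}$ are positive on $\mathbb{R}$. With the pseudo-Riemannian manifolds $\mathcal{N}_{6+4p,\psi}$, $\mathcal{S}_{6+4p}$, $\mathcal{H}_{6+4p,j}$ and the function $\alpha^2_{6+4p,\psi}$ defined in the context: \begin{enumerate} \item $\mathcal{N}_{6+4p,\psi}$ is $0$-modeled on the indecomposable symmetric space $\mathcal{S}_{6+4p}$. \item $\mathcal{N}_{6+4p,\psi}$ is $j$-modeled on the homogeneous space $\mathcal{H}_{6+4p,j}$ for $1\le j\le p+2$. \item $\mathcal{N}_{6+4p,\psi}$ is $(p+2)$-curvature homogeneous. \item The following conditions are equivalent: (a) $\mathcal{N}_{6+4p,\psi}$ is homogeneous. (b) $\mathcal{N}_{6+4p,\psi}$ is affine $(p+3)$-curvature homogeneous. (c) $\alpha_{6+4p,\psi}^2$ is constant. (d) $\psi^{(p+3)}=ae^{bz_0}$ for some $a,b\ne0$. \end{enumerate}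
   Context: Let $(x,z_0,\dots,z_p,\tilde z_0,\dots,\tilde z_p,x^*,z_0^*,\dots,z_p^*,\tilde z_0^*,\dots,\tilde z_p^* )$ be coordinates on $\mathbb{R}^{6+4p}$. For a smooth function $f=f(z_0,\dots,z_p)$ on $\mathbb{R}^{p+1}$, $\mathcal{M}_{6+4p,f}:=(\mathbb{R}^{6+4p},g_{6+4p,f})$, where $g_{6+4p,f}$ is the metric of neutral signature $(3+2p,3+2p)$ whose only non-zero components (up to symmetry) are $$g_{6+4p,f}(\partial_x,\partial_x)=-2\{f(z_0,\dots,z_p)+z_0\tilde z_0+\dots+z_p\tilde z_p\},$$ $$g_{6+4p,f}(\partial_x,\partial_{x^*})=g_{6+4p,f}(\partial_{z_i},\partial_{z_i^*})=g_{6+4p,f}(\partial_{\tilde z_i},\partial_{\tilde z_i^*})=1\quad(0\le i\le p).$$ Set: - $\mathcal{S}_{6+4p}:=\mathcal{M}_{6+4p,0}$ (the case $f=0$); - $\mathcal{H}_{6+4p,k}:=\mathcal{M}_{6+4p,f_k}$ for $1\le k\le p+2$, where $f_k:=z_1z_0^2+\dots+z_kz_0^{k+1}$ if $1\le k\le p$, $f_{p+1}:=z_1z_0^2+\dots+z_pz_0^{p+1}+z_0^{p+3}$, and $f_{p+2}:=z_1z_0^2+\dots+z_pz_0^{p+1}+e^{z_0}$; - $\mathcal{N}_{6+4p,\psi}:=\mathcal{M}_{6+4p,f_\psi}$, where $f_\psi:=z_1z_0^2+\dots+z_pz_0^{p+1}+\psi(z_0)$; - $\alpha_{6+4p,\psi}^2:=\psi^{(p+5)}\,\psi^{(p+3)}\,\{\psi^{(p+4)}\}^{-2}$,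 evaluated at the $z_0$-coordinate of a point, where $\psi^{(j)}$ is the $j$-th derivative. For a pseudo-Riemannian manifold $\mathcal{M}=(M,g)$ with Levi-Civita connection $\nabla$, let $\mathcal{R}(\xi_1,\xi_2)\xi_3=(\nabla_{\xi_1}\nabla_{\xi_2}-\nabla_{\xi_2}\nabla_{\xi_1}-\nabla_{[\xi_1,\xi_2]})\xi_3$ be the curvature operator and $R(\xi_1,\xi_2,\xi_3,\xi_4)=g(\mathcal{R}(\xi_1,\xi_2)\xi_3,\xi_4)$ the curvature tensor. For $P\in M$ set $$\mathfrak{M}^k(\mathcal{M},P):=(T_PM,g_P,R_P,\dots,\nabla^kR_P),\qquad \mathfrak{A}^k(\mathcal{M},P):=(T_PM,\mathcal{R}_P,\dots,\nabla^k\mathcal{R}_P).$$ An isomorphism between two objects of the first (resp. second) kind is a linear isomorphism of the tangent spaces which pulls back the metric and all $\nabla^iR$ (resp. all $\nabla^i\mathcal{R}$), $0\le i\le k$, to one another. - $\mathcal{M}$ is $k$-curvature homogeneous if $\mathfrak{M}^k(\mathcal{M},P)$ and $\mathfrak{M}^k(\mathcal{M},Q)$ are isomorphic for any $P,Q\in M$. - $\mathcal{M}$ is affine $k$-curvature homogeneous if $\mathfrak{A}^k(\mathcal{M},P)$ and $\mathfrak{A}^k(\mathcal{M},Q)$ are isomorphic for any $P,Q\in M$. - $\mathcal{M}$ is $k$-modeled on a homogeneous pseudo-Riemannian manifold $\mathcal{N}$ if $\mathfrak{M}^k(\mathcal{M},P)$ and $\mathfrak{M}^k(\mathcal{N},Q)$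 are isomorphic for any $P\in M$ and $Q\in N$. - Homogeneous means that the group of isometries acts transitively. - $\mathcal{M}$ is indecomposable if there does not exist a non-trivial orthogonal direct sum decomposition of $T_PM$ which is invariant under the holonomy representation. *)

theory Defs
  imports "HOL-Analysis.Analysis"
begin

section \<open>Smooth maps\<close>

text \<open>
  Since the domain is finite-dimensional, a map is of class $C^{k+1}$ iff it is differentiable
  everywhere and all its directional derivatives (as functions of the base point) are of
  class $C^k$.
\<close>

primrec C_class :: "nat \<Rightarrow> ('a::euclidean_space \<Rightarrow> 'b::real_normed_vector) \<Rightarrow> bool" where
  "C_class 0 f \<longleftrightarrow> continuous_on UNIV f"
| "C_class (Suc k) f \<longleftrightarrow>
     (\<forall>x. f differentiable (at x)) \<and>
     (\<forall>v. C_class k (\<lambda>x. frechet_derivative f (at x) v))"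

definition smooth :: "('a::euclidean_space \<Rightarrow> 'b::real_normed_vector) \<Rightarrow> bool" where
  "smooth f \<longleftrightarrow> (\<forall>k. C_class k f)"


section \<open>Pseudo-Riemannian geometry on a Euclidean space\<close>

text \<open>
  All manifolds are given by a metric on a whole Euclidean space \<open>'a\<close>, so every tangent space is
  identified with \<open>'a\<close>: \<open>g P u v\<close> is the inner product of the tangent vectors \<open>u\<close>, \<open>v\<close> at the
  point \<open>P\<close>, and a vector field is a map \<open>'a \<Rightarrow> 'a\<close>.
\<close>

type_synonym 'a metric_field = "'a \<Rightarrow> 'a \<Rightarrow> 'a \<Rightarrow> real"

text \<open>
  An affine connection on \<open>'a\<close> is the flat one plus a smooth field \<open>\<Gamma>\<close> of bilinear maps
  (the Christoffel symbols): $\nabla_X Y = D_X Y + \Gamma(X, Y)$.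
\<close>

type_synonym 'a connection_coeff = "'a \<Rightarrow> 'a \<Rightarrow> 'a \<Rightarrow> 'a"

definition nabla ::
    "'a::euclidean_space connection_coeff \<Rightarrow> ('a \<Rightarrow> 'a) \<Rightarrow> ('a \<Rightarrow> 'a) \<Rightarrow> 'a \<Rightarrow> 'a" where
  "nabla \<Gamma> X Y P = frechet_derivative Y (at P) (X P) + \<Gamma> P (X P) (Y P)"

definition lie_bracket ::
    "('a::euclidean_space \<Rightarrow> 'a) \<Rightarrow> ('a \<Rightarrow> 'a) \<Rightarrow> 'a \<Rightarrow> 'a" where
  "lie_bracket X Y P =
     frechet_derivative Y (at P) (X P) - frechet_derivative X (at P) (Y P)"

definition is_connection :: "'a::euclidean_space connection_coeff \<Rightarrow> bool" where
  "is_connection \<Gamma> \<longleftrightarrow> (\<forall>P. bilinear (\<Gamma> P)) \<and> (\<forall>u v. smooth (\<lambda>P. \<Gamma> P u v))"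

definition torsion_free :: "'a::euclidean_space connection_coeff \<Rightarrow> bool" where
  "torsion_free \<Gamma> \<longleftrightarrow>
     (\<forall>X Y P. smooth X \<longrightarrow> smooth Y \<longrightarrow>
        nabla \<Gamma> X Y P - nabla \<Gamma> Y X P = lie_bracket X Y P)"

definition metric_compatible ::
    "'a::euclidean_space metric_field \<Rightarrow> 'a connection_coeff \<Rightarrow> bool" where
  "metric_compatible g \<Gamma> \<longleftrightarrow>
     (\<forall>X Y Z P. smooth X \<longrightarrow> smooth Y \<longrightarrow> smooth Z \<longrightarrow>
        frechet_derivative (\<lambda>Q. g Q (Y Q) (Z Q)) (at P) (X P) =
          g P (nabla \<Gamma> X Y P) (Z P) + g P (Y P) (nabla \<Gamma> X Z P))"

definition levi_civita :: "'a::euclidean_space metric_field \<Rightarrow> 'a connection_coeff" where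
  "levi_civita g = (THE \<Gamma>. is_connection \<Gamma> \<and> torsion_free \<Gamma> \<and> metric_compatible g \<Gamma>)"


subsection \<open>Curvature and its covariant derivatives\<close>

definition curvature_field ::
    "'a::euclidean_space connection_coeff \<Rightarrow>
       ('a \<Rightarrow> 'a) \<Rightarrow> ('a \<Rightarrow> 'a) \<Rightarrow> ('a \<Rightarrow> 'a) \<Rightarrow> 'a \<Rightarrow> 'a" where
  "curvature_field \<Gamma> X Y Z P =
     nabla \<Gamma> X (nabla \<Gamma> Y Z) P - nabla \<Gamma> Y (nabla \<Gamma> X Z) P - nabla \<Gamma> (lie_bracket X Y) Z P"

text \<open>
  A tensor field of variable rank \<open>r\<close> is a function of a point and of a list of \<open>r\<close> tangent
  vectors; its values on lists of any other length are irrelevant. The tensors at \<open>P\<close> are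
  obtained by extending the tangent vectors at \<open>P\<close> to constant vector fields.
\<close>

definition curv_op :: "'a::euclidean_space metric_field \<Rightarrow> 'a \<Rightarrow> 'a list \<Rightarrow> 'a" where
  "curv_op g P vs =
     curvature_field (levi_civita g) (\<lambda>_. vs ! 0) (\<lambda>_. vs ! 1) (\<lambda>_. vs ! 2) P"

definition curv_tensor :: "'a::euclidean_space metric_field \<Rightarrow> 'a \<Rightarrow> 'a list \<Rightarrow> real" where
  "curv_tensor g P vs = g P (curv_op g P vs) (vs ! 3)"

text \<open>
  Covariant derivatives of scalar-valued and of vector-valued tensor fields. The direction \<open>u\<close> of
  differentiation is put in front of the other arguments.
\<close>

fun cov_deriv_form ::
    "'a::euclidean_space connection_coeff \<Rightarrow> ('a \<Rightarrow> 'a list \<Rightarrow> real) \<Rightarrow> 'a \<Rightarrow> 'a list \<Rightarrow> real" where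
  "cov_deriv_form \<Gamma> T P [] = 0"
| "cov_deriv_form \<Gamma> T P (u # vs) =
     frechet_derivative (\<lambda>Q. T Q vs) (at P) u
     - (\<Sum>i<length vs. T P (vs[i := \<Gamma> P u (vs ! i)]))"

fun cov_deriv_op ::
    "'a::euclidean_space connection_coeff \<Rightarrow> ('a \<Rightarrow> 'a list \<Rightarrow> 'a) \<Rightarrow> 'a \<Rightarrow> 'a list \<Rightarrow> 'a" where
  "cov_deriv_op \<Gamma> T P [] = 0"
| "cov_deriv_op \<Gamma> T P (u # vs) =
     frechet_derivative (\<lambda>Q. T Q vs) (at P) u + \<Gamma> P u (T P vs)
     - (\<Sum>i<length vs. T P (vs[i := \<Gamma> P u (vs ! i)]))"

definition nabla_curv_tensor ::
    "'a::euclidean_space metric_field \<Rightarrow> nat \<Rightarrow> 'a \<Rightarrow> 'a list \<Rightarrow> real" where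
  "nabla_curv_tensor g i = (cov_deriv_form (levi_civita g) ^^ i) (curv_tensor g)"

definition nabla_curv_op ::
    "'a::euclidean_space metric_field \<Rightarrow> nat \<Rightarrow> 'a \<Rightarrow> 'a list \<Rightarrow> 'a" where
  "nabla_curv_op g i = (cov_deriv_op (levi_civita g) ^^ i) (curv_op g)"


subsection \<open>Curvature homogeneity\<close>

definition model_iso ::
    "nat \<Rightarrow> 'a::euclidean_space metric_field \<Rightarrow> 'a \<Rightarrow>
       'b::euclidean_space metric_field \<Rightarrow> 'b \<Rightarrow> bool" where
  "model_iso k g P h Q \<longleftrightarrow>
     (\<exists>\<Phi>. linear \<Phi> \<and> bij \<Phi> \<and>
        (\<forall>u v. h Q (\<Phi> u) (\<Phi> v) = g P u v) \<and>
        (\<forall>i\<le>k. \<forall>vs. length vs = 4 + i \<longrightarrow>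
           nabla_curv_tensor h i Q (map \<Phi> vs) = nabla_curv_tensor g i P vs))"

definition affine_model_iso ::
    "nat \<Rightarrow> 'a::euclidean_space metric_field \<Rightarrow> 'a \<Rightarrow>
       'b::euclidean_space metric_field \<Rightarrow> 'b \<Rightarrow> bool" where
  "affine_model_iso k g P h Q \<longleftrightarrow>
     (\<exists>\<Phi>. linear \<Phi> \<and> bij \<Phi> \<and>
        (\<forall>i\<le>k. \<forall>vs. length vs = 3 + i \<longrightarrow>
           nabla_curv_op h i Q (map \<Phi> vs) = \<Phi> (nabla_curv_op g i P vs)))"

definition curvature_homogeneous :: "nat \<Rightarrow> 'a::euclidean_space metric_field \<Rightarrow> bool" where
  "curvature_homogeneous k g \<longleftrightarrow> (\<forall>P Q. model_iso k g P g Q)"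

definition affine_curvature_homogeneous :: "nat \<Rightarrow> 'a::euclidean_space metric_field \<Rightarrow> bool" where
  "affine_curvature_homogeneous k g \<longleftrightarrow> (\<forall>P Q. affine_model_iso k g P g Q)"

definition isometry :: "'a::euclidean_space metric_field \<Rightarrow> ('a \<Rightarrow> 'a) \<Rightarrow> bool" where
  "isometry g \<phi> \<longleftrightarrow> bij \<phi> \<and> smooth \<phi> \<and> smooth (inv \<phi>) \<and>
     (\<forall>P u v. g (\<phi> P) (frechet_derivative \<phi> (at P) u) (frechet_derivative \<phi> (at P) v) = g P u v)"

definition homogeneous :: "'a::euclidean_space metric_field \<Rightarrow> bool" where
  "homogeneous g \<longleftrightarrow> (\<forall>P Q. \<exists>\<phi>. isometry g \<phi> \<and> \<phi> P = Q)"

definition modeled_on ::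
    "nat \<Rightarrow> 'a::euclidean_space metric_field \<Rightarrow> 'b::euclidean_space metric_field \<Rightarrow> bool" where
  "modeled_on k g h \<longleftrightarrow> homogeneous h \<and> (\<forall>P Q. model_iso k g P h Q)"

text \<open>
  Globally symmetric: the geodesic symmetry at each point is a globally defined isometry. This
  implies that the curvature tensor is parallel.
\<close>

definition symmetric_space :: "'a::euclidean_space metric_field \<Rightarrow> bool" where
  "symmetric_space g \<longleftrightarrow>
     (\<forall>P. \<exists>\<sigma>. isometry g \<sigma> \<and> \<sigma> P = P \<and> (\<forall>v. frechet_derivative \<sigma> (at P) v = - v))"


subsection \<open>Holonomy\<close>

text \<open>
  The library's \<^const>\<open>valid_path\<close> is not used, because it allows the velocity to be unbounded near
  the finitely many exceptional parameters. Here the velocity extends smoothly to the closed pieces.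
\<close>

definition piecewise_smooth_curve :: "(real \<Rightarrow> 'a::euclidean_space) \<Rightarrow> bool" where
  "piecewise_smooth_curve \<gamma> \<longleftrightarrow>
     (\<exists>n t. t 0 = 0 \<and> t n = 1 \<and> (\<forall>i<n. t i < t (Suc i)) \<and>
        (\<forall>i<n. \<exists>c. smooth c \<and> (\<forall>s\<in>{t i..t (Suc i)}. \<gamma> s = c s)))"

definition parallel_along ::
    "'a::euclidean_space metric_field \<Rightarrow> (real \<Rightarrow> 'a) \<Rightarrow> (real \<Rightarrow> 'a) \<Rightarrow> bool" where
  "parallel_along g \<gamma> V \<longleftrightarrow>
     continuous_on {0..1} V \<and>
     (\<exists>S. finite S \<and> (\<forall>t\<in>{0..1} - S.
        (V has_vector_derivative
           - levi_civita g (\<gamma> t) (vector_derivative \<gamma> (at t)) (V t)) (at t)))"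

definition holonomy_group :: "'a::euclidean_space metric_field \<Rightarrow> 'a \<Rightarrow> ('a \<Rightarrow> 'a) set" where
  "holonomy_group g P =
     {A. \<exists>\<gamma>. piecewise_smooth_curve \<gamma> \<and> \<gamma> 0 = P \<and> \<gamma> 1 = P \<and>
           (\<forall>v. \<exists>V. parallel_along g \<gamma> V \<and> V 0 = v \<and> V 1 = A v)}"

definition holonomy_invariant :: "'a::euclidean_space metric_field \<Rightarrow> 'a \<Rightarrow> 'a set \<Rightarrow> bool" where
  "holonomy_invariant g P W \<longleftrightarrow> (\<forall>A\<in>holonomy_group g P. A ` W \<subseteq> W)"

definition indecomposable :: "'a::euclidean_space metric_field \<Rightarrow> bool" where
  "indecomposable g \<longleftrightarrow>
     (\<forall>P. \<not> (\<exists>V W. subspace V \<and> subspace W \<and> V \<noteq> {0} \<and> W \<noteq> {0} \<and>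
        V \<inter> W = {0} \<and> {v + w |v w. v \<in> V \<and> w \<in> W} = UNIV \<and>
        (\<forall>v\<in>V. \<forall>w\<in>W. g P v w = 0) \<and>
        holonomy_invariant g P V \<and> holonomy_invariant g P W))"


section \<open>The manifolds\<close>

text \<open>
  Names of the coordinates $x$, $z_i$, $\tilde z_i$, $x^*$, $z_i^*$, $\tilde z_i^*$. For an index
  type \<open>'i\<close> with \<open>p + 1\<close> elements, \<open>real ^ 'i coord\<close> is the space $\mathbb{R}^{6+4p}$; the indices
  are numbered $0, \dots, p$ by a map \<open>\<iota> :: nat \<Rightarrow> 'i\<close> that is bijective on \<open>{0..p}\<close>.
\<close>

datatype 'i coord = Cx | Cz 'i | Czt 'i | Cxs | Czs 'i | Czts 'i

lemma UNIV_coord: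
  "(UNIV :: 'i coord set) =
     {Cx, Cxs} \<union> (range Cz \<union> range Czt) \<union> (range Czs \<union> range Czts)"
proof -
  have "c \<in> {Cx, Cxs} \<union> (range Cz \<union> range Czt) \<union> (range Czs \<union> range Czts)" for c :: "'i coord"
    by (cases c) auto
  then show ?thesis by blast
qed

instance coord :: (finite) finite
  by standard (simp add: UNIV_coord)

lemma card_coord: "CARD('i::finite coord) = 2 + 4 * CARD('i)"
proof -
  have c: "card (range Cz :: 'i coord set) = CARD('i)"
      "card (range Czt :: 'i coord set) = CARD('i)"
      "card (range Czs :: 'i coord set) = CARD('i)"
      "card (range Czts :: 'i coord set) = CARD('i)"
    by (auto intro!: card_image injI)
  have u1: "card (range Cz \<union> range Czt :: 'i coord set) = 2 * CARD('i)"
    by (subst card_Un_disjoint) (auto simp: c)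
  have u2: "card (range Czs \<union> range Czts :: 'i coord set) = 2 * CARD('i)"
    by (subst card_Un_disjoint) (auto simp: c)
  have u3: "card ({Cx, Cxs} \<union> (range Cz \<union> range Czt) :: 'i coord set) = 2 + 2 * CARD('i)"
    by (subst card_Un_disjoint) (auto simp: u1)
  show ?thesis
    unfolding UNIV_coord by (subst card_Un_disjoint) (auto simp: u2 u3[simplified])
qed

text \<open>The function \<open>f\<close> of $(z_0, \dots, z_p)$ is given as a function of the sequence \<open>z\<close>.\<close>

definition metric_M ::
    "(nat \<Rightarrow> 'i::finite) \<Rightarrow> ((nat \<Rightarrow> real) \<Rightarrow> real) \<Rightarrow> (real ^ 'i coord) metric_field" where
  "metric_M \<iota> f P u v =
     - 2 * (f (\<lambda>i. P $ Cz (\<iota> i)) + (\<Sum>i\<in>UNIV. P $ Cz i * P $ Czt i)) * (u $ Cx * v $ Cx)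
     + (u $ Cx * v $ Cxs + u $ Cxs * v $ Cx)
     + (\<Sum>i\<in>UNIV. u $ Cz i * v $ Czs i + u $ Czs i * v $ Cz i)
     + (\<Sum>i\<in>UNIV. u $ Czt i * v $ Czts i + u $ Czts i * v $ Czt i)"

definition metric_S :: "(nat \<Rightarrow> 'i::finite) \<Rightarrow> (real ^ 'i coord) metric_field" where
  "metric_S \<iota> = metric_M \<iota> (\<lambda>z. 0)"

definition f_H :: "nat \<Rightarrow> nat \<Rightarrow> (nat \<Rightarrow> real) \<Rightarrow> real" where
  "f_H p k z =
     (if k \<le> p then (\<Sum>i=1..k. z i * z 0 ^ (i + 1))
      else if k = p + 1 then (\<Sum>i=1..p. z i * z 0 ^ (i + 1)) + z 0 ^ (p + 3)
      else (\<Sum>i=1..p. z i * z 0 ^ (i + 1)) + exp (z 0))"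

definition metric_H :: "nat \<Rightarrow> (nat \<Rightarrow> 'i::finite) \<Rightarrow> nat \<Rightarrow> (real ^ 'i coord) metric_field" where
  "metric_H p \<iota> k = metric_M \<iota> (f_H p k)"

definition f_N :: "nat \<Rightarrow> (real \<Rightarrow> real) \<Rightarrow> (nat \<Rightarrow> real) \<Rightarrow> real" where
  "f_N p \<psi> z = (\<Sum>i=1..p. z i * z 0 ^ (i + 1)) + \<psi> (z 0)"

definition metric_N ::
    "nat \<Rightarrow> (nat \<Rightarrow> 'i::finite) \<Rightarrow> (real \<Rightarrow> real) \<Rightarrow> (real ^ 'i coord) metric_field" where
  "metric_N p \<iota> \<psi> = metric_M \<iota> (f_N p \<psi>)"

definition alpha_sq ::
    "nat \<Rightarrow> (nat \<Rightarrow> 'i::finite) \<Rightarrow> (real \<Rightarrow> real) \<Rightarrow> real ^ 'i coord \<Rightarrow> real" where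
  "alpha_sq p \<iota> \<psi> P =
     (let t = P $ Cz (\<iota> 0) in
       (deriv ^^ (p + 5)) \<psi> t * (deriv ^^ (p + 3)) \<psi> t / ((deriv ^^ (p + 4)) \<psi> t)\<^sup>2)"

end

theory Submission
  imports Defs
begin

text \<open>
  Write the metric as \<open>\<eta> - 2 F dx\<^sup>2\<close> with \<open>\<eta>\<close> flat and \<open>F = f + \<Sum> z\<^sub>i z~\<^sub>i\<close>. The Christoffel symbols take values in the
  null space spanned by the starred coordinates, which every \<open>\<nabla>\<^sup>i R\<close> annihilates, so \<open>\<nabla>\<^sup>i R\<close> is
  built from \<open>dx\<close> and the plain derivative \<open>D\<^sup>i\<^sup>+\<^sup>2 F\<close>. Hence a model isomorphism amounts to a linear map
  \<open>L\<close> preserving \<open>\<eta>\<close>, with \<open>dx \<circ> L = a dx\<close> and \<open>a\<^sup>2 D\<^sup>j F'(L \<cdot>, \<dots>) = D\<^sup>j F\<close> for \<open>j \<ge> 2\<close>. The Hessian is always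
  matched by adjusting the \<open>z~\<close>-part of \<open>L\<close>; for \<open>3 \<le> j \<le> p + 2\<close> one has \<open>D\<^sup>j f = z\<^sub>0\<^sup>j\<^sup>-\<^sup>1 N\<^sub>j\<close> with linear
  forms \<open>N\<^sub>j\<close> that are triangular in \<open>z\<^sub>1, \<dots>, z\<^sub>p\<close>; and \<open>D\<^sup>p\<^sup>+\<^sup>3 F\<close>, \<open>D\<^sup>p\<^sup>+\<^sup>4 F\<close> are matched by the two free scalings
  \<open>a\<close> and \<open>z\<^sub>0 \<mapsto> r z\<^sub>0\<close>. If derivatives match at one point up to an order from which on they match
  everywhere, then \<open>a\<^sup>2 F \<circ> L\<close> and \<open>F\<close> differ by an affine function, which a shear in the starred coordinates
  absorbs: this gives the isometries. Conversely the ratio \<open>\<alpha>\<^sup>2\<close> of the derivatives of orders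
  \<open>p + 3\<close>, \<open>p + 4\<close>, \<open>p + 5\<close> is invariant under these scalings, and \<open>h h'' / h'\<^sup>2 = c\<close> makes \<open>h / h'\<close> affine with
  slope \<open>1 - c\<close>; being positive on the whole line it is constant.
\<close>

text \<open>The range of orders is a count of parameters: the i-th covariant derivative of R sees
  the derivatives of F of order i + 2, so the two scalings are used up at order p + 4, and the
  covariant derivative of order p + 3 is the first that can tell points apart. Three steps need more
  than jets of F. For (a) to (b), an isometry is an arbitrary diffeomorphism, so its compatibility
  with all covariant derivatives of R has to be derived from the metric alone: its second
  derivatives measure how far it moves the Christoffel symbols, and for R itself they cancel because
  two Christoffel symbols compose to zero. For (b) to (c), an affine isomorphism knows no metric and
  need not respect the null space or rescale dx; it helps that from order p + 3 on F differentiates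
  like a function of one variable, so that evaluation on two coordinate directions gives three
  equations in very few unknowns. For indecomposability, explicit polynomial loops yield enough
  holonomy elements to shift a vector with non-zero dx-component in every direction of the gradient
  of F.\<close>

lemma split_last1:
  assumes "length vs = Suc n"
  obtains us X where "vs = us @ [X]" "length us = n"
  using assms by (cases vs rule: rev_cases) auto

lemma split_last2:
  assumes "length vs = Suc (Suc n)"
  obtains us X Y where "vs = us @ [X, Y]" "length us = n"
proof -
  obtain us Y where 1: "vs = us @ [Y]" "length us = Suc n" using assms by (rule split_last1)
  obtain ws X where "us = ws @ [X]" "length ws = n" using 1(2) by (rule split_last1)
  then show thesis using 1 by (intro that[of ws X Y]) simp_all
qed

lemma split_last3:
  assumes "length vs = n + 3"
  obtains us X Y Z where "vs = us @ [X, Y, Z]" "length us = n"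
proof -
  obtain us Y Z where 1: "vs = us @ [Y, Z]" "length us = Suc n"
    by (rule split_last2[of vs "Suc n"]) (use assms in auto)
  obtain ws X where "us = ws @ [X]" "length ws = n" using 1(2) by (rule split_last1)
  then show thesis using 1 by (intro that[of ws X Y Z]) simp_all
qed

lemma split_last4:
  assumes "length vs = n + 4"
  obtains us X Y Z W where "vs = us @ [X, Y, Z, W]" "length us = n"
proof -
  obtain us Y Z where 1: "vs = us @ [Y, Z]" "length us = Suc (Suc n)"
    by (rule split_last2[of vs "Suc (Suc n)"]) (use assms in auto)
  obtain ws W X where "us = ws @ [W, X]" "length ws = n" using 1(2) by (rule split_last2)
  then show thesis using 1 by (intro that[of ws W X Y Z]) simp_all
qed

section \<open>Smooth maps\<close>

declare C_class.simps(2) [simp del]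

lemma frechet_derivative_eq: "(f has_derivative f') (at x) \<Longrightarrow> frechet_derivative f (at x) v = f' v"
  using frechet_derivative_at by metis

lemma C_class_mono: "C_class (Suc k) f \<Longrightarrow> C_class k f"
proof (induction k arbitrary: f)
  case 0
  then show ?case
    by (simp add: C_class.simps(2) continuous_at_imp_continuous_on differentiable_imp_continuous_within)
next
  case (Suc k)
  then show ?case unfolding C_class.simps(2)[of k] C_class.simps(2)[of "Suc k"] by blast
qed

text \<open>Lets the closure properties below use whatever derivative the derivative rules produce,
  in place of \<open>frechet_derivative\<close>.\<close>

lemma C_class_Suc_intro:
  assumes "\<And>x. (f has_derivative f' x) (at x)" "\<And>v. C_class k (\<lambda>x. f' x v)"
  shows "C_class (Suc k) f"
  unfolding C_class.simps(2)
  using assms(1)[THEN differentiableI] assms(2) by (simp flip: frechet_derivative_at[OF assms(1)])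

lemma C_class_const: "C_class k (\<lambda>x. c)"
  by (induction k arbitrary: c) (auto simp: frechet_derivative_const C_class.simps(2))

lemma C_class_deriv:
  assumes "C_class (Suc k) f"
  shows "(f has_derivative frechet_derivative f (at x)) (at x)"
    and "C_class k (\<lambda>x. frechet_derivative f (at x) v)"
  using assms by (auto simp: C_class.simps(2) frechet_derivative_works)

lemma C_class_linear: "bounded_linear f \<Longrightarrow> C_class k f"
proof (cases k)
  case 0
  then show "bounded_linear f \<Longrightarrow> C_class k f"
    by (simp add: linear_continuous_on)
next
  case (Suc n)
  assume "bounded_linear f"
  then show ?thesis
    unfolding Suc by (intro C_class_Suc_intro) (auto intro: bounded_linear_imp_has_derivative C_class_const)
qed

lemma C_class_add: "C_class k f \<Longrightarrow> C_class k g \<Longrightarrow> C_class k (\<lambda>x. f x + g x)"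
proof (induction k arbitrary: f g)
  case 0
  then show ?case by (simp add: continuous_on_add)
next
  case (Suc k)
  show ?case
    by (rule C_class_Suc_intro[OF has_derivative_add[OF
            C_class_deriv(1)[OF Suc.prems(1)] C_class_deriv(1)[OF Suc.prems(2)]]])
      (intro Suc.IH C_class_deriv(2) Suc.prems)
qed

lemma C_class_bounded_linear_comp:
  "bounded_linear L \<Longrightarrow> C_class k f \<Longrightarrow> C_class k (\<lambda>x. L (f x))"
proof (induction k arbitrary: f)
  case 0
  then show ?case by (simp add: bounded_linear.continuous_on)
next
  case (Suc k)
  show ?case
    by (rule C_class_Suc_intro[OF bounded_linear.has_derivative[OF
            Suc.prems(1) C_class_deriv(1)[OF Suc.prems(2)]]])
      (intro Suc.IH C_class_deriv(2) Suc.prems)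
qed

lemma C_class_scaleR:
  "C_class k f \<Longrightarrow> C_class k g \<Longrightarrow> C_class k (\<lambda>x. f x *\<^sub>R g x)"
proof (induction k arbitrary: f g)
  case 0
  then show ?case by (simp add: continuous_on_scaleR)
next
  case (Suc k)
  show ?case
    by (rule C_class_Suc_intro[OF has_derivative_scaleR[OF
            C_class_deriv(1)[OF Suc.prems(1)] C_class_deriv(1)[OF Suc.prems(2)]]])
      (intro Suc.prems Suc.IH C_class_add C_class_mono[OF Suc.prems(1)] C_class_mono[OF Suc.prems(2)]
        C_class_deriv(2)[OF Suc.prems(1)] C_class_deriv(2)[OF Suc.prems(2)])
qed

lemma C_class_sum: "(\<And>i. i \<in> I \<Longrightarrow> C_class k (f i)) \<Longrightarrow> C_class k (\<lambda>x. \<Sum>i\<in>I. f i x)"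
  by (induction I rule: infinite_finite_induct) (auto intro: C_class_const C_class_add)

text \<open>In the chain rule the direction in which \<open>g\<close> is differentiated moves with
  \<open>x\<close>, while \<open>C_class\<close> only speaks of fixed directions. Expanding it in
  \<open>Basis\<close> leaves products of scalar functions with fixed directional derivatives of
  \<open>g\<close>, to which the induction hypothesis applies.\<close>

lemma C_class_compose:
  fixes f :: "'a::euclidean_space \<Rightarrow> 'b::euclidean_space"
  shows "C_class k f \<Longrightarrow> C_class k g \<Longrightarrow> C_class k (\<lambda>x. g (f x))"
proof (induction k arbitrary: g)
  case 0
  then show ?case by (simp add: continuous_on_compose2)
next
  case (Suc k)
  have D: "((\<lambda>x. g (f x)) has_derivative
      (\<lambda>v. \<Sum>b\<in>Basis. (frechet_derivative f (at x) v \<bullet> b) *\<^sub>R frechet_derivative g (at (f x)) b)) (at x)"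
    for x
  proof -
    have "linear (frechet_derivative g (at (f x)))"
      using C_class_deriv(1)[OF Suc.prems(2)] by (rule has_derivative_linear)
    then have *: "frechet_derivative g (at (f x)) w =
        (\<Sum>b\<in>Basis. (w \<bullet> b) *\<^sub>R frechet_derivative g (at (f x)) b)" for w
      using linear_sum[of "frechet_derivative g (at (f x))" "\<lambda>b. (w \<bullet> b) *\<^sub>R b" Basis]
      by (simp add: euclidean_representation linear_scale)
    show ?thesis
      by (rule has_derivative_eq_rhs[OF has_derivative_compose[OF
              C_class_deriv(1)[OF Suc.prems(1)] C_class_deriv(1)[OF Suc.prems(2)]]])
        (rule ext, rule *)
  qed
  show ?case
  proof (rule C_class_Suc_intro[OF D])
    fix v
    show "C_class k (\<lambda>x. \<Sum>b\<in>Basis. (frechet_derivative f (at x) v \<bullet> b) *\<^sub>R frechet_derivative g (at (f x)) b)"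
      by (intro C_class_sum C_class_scaleR C_class_bounded_linear_comp[OF bounded_linear_inner_left]
          Suc.IH C_class_mono[OF Suc.prems(1)] C_class_deriv(2)[OF Suc.prems(1)] C_class_deriv(2)[OF Suc.prems(2)])
  qed
qed

lemma smooth_const: "smooth (\<lambda>x. c)"
  by (simp add: smooth_def C_class_const)

lemma smooth_linear:
  fixes f :: "'a::euclidean_space \<Rightarrow> 'b::real_normed_vector"
  shows "linear f \<Longrightarrow> smooth f"
  unfolding smooth_def linear_conv_bounded_linear by (blast intro: C_class_linear)

lemma smooth_add: "smooth f \<Longrightarrow> smooth g \<Longrightarrow> smooth (\<lambda>x. f x + g x)"
  by (simp add: smooth_def C_class_add)

lemma smooth_scaleR: "smooth f \<Longrightarrow> smooth g \<Longrightarrow> smooth (\<lambda>x. f x *\<^sub>R g x)"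
  by (simp add: smooth_def C_class_scaleR)

lemma smooth_mult: "smooth f \<Longrightarrow> smooth g \<Longrightarrow> smooth (\<lambda>x. f x * g x :: real)"
  using smooth_scaleR[of f g] by simp

lemma smooth_sum: "(\<And>i. i \<in> I \<Longrightarrow> smooth (f i)) \<Longrightarrow> smooth (\<lambda>x. \<Sum>i\<in>I. f i x)"
  by (simp add: smooth_def C_class_sum)

lemma smooth_minus: "smooth f \<Longrightarrow> smooth (\<lambda>x. - f x)"
  using smooth_scaleR[OF smooth_const, of f "-1"] by simp

lemma smooth_diff: "smooth f \<Longrightarrow> smooth g \<Longrightarrow> smooth (\<lambda>x. f x - g x)"
  using smooth_add[OF _ smooth_minus[of g], of f] by simp

lemma smooth_power: "smooth f \<Longrightarrow> smooth (\<lambda>x. f x ^ n :: real)"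
  by (induction n) (auto intro: smooth_const smooth_mult)

lemma smooth_divide_const: "smooth f \<Longrightarrow> smooth (\<lambda>x. f x / c :: real)"
  unfolding divide_inverse by (intro smooth_mult smooth_const)

lemma smooth_compose:
  fixes f :: "'a::euclidean_space \<Rightarrow> 'b::euclidean_space"
  shows "smooth f \<Longrightarrow> smooth g \<Longrightarrow> smooth (\<lambda>x. g (f x))"
  by (simp add: smooth_def C_class_compose)

lemma smooth_deriv:
  assumes "smooth f"
  shows "(f has_derivative frechet_derivative f (at x)) (at x)"
    and "smooth (\<lambda>x. frechet_derivative f (at x) v)"
  using assms C_class_deriv[of _ f] unfolding smooth_def by blast+

lemma smooth_inner_left: "smooth f \<Longrightarrow> smooth (\<lambda>x. f x \<bullet> c)"
  by (simp add: smooth_def C_class_bounded_linear_comp[OF bounded_linear_inner_left])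

text \<open>For a family closed under directional derivatives, induction on the order runs over all
  indices at once. Meant for the list-indexed derivatives of \<open>F\<close>.\<close>

lemma smooth_coinduct:
  assumes "\<And>i x. (h i has_derivative (\<lambda>v. h (nxt i v) x)) (at x)"
  shows "smooth (h i)"
proof -
  have "C_class k (h i)" for k i
  proof (induction k arbitrary: i)
    case 0
    show ?case
      using has_derivative_continuous[OF assms] by (simp add: continuous_at_imp_continuous_on)
  next
    case (Suc k)
    show ?case by (rule C_class_Suc_intro[OF assms Suc])
  qed
  then show ?thesis by (simp add: smooth_def)
qed

lemma smooth_higher_deriv:
  fixes f :: "real \<Rightarrow> real"
  assumes "smooth f"
  shows "smooth ((deriv ^^ n) f)"
    and "((deriv ^^ n) f has_real_derivative (deriv ^^ Suc n) f t) (at t)"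
proof -
  have D: "deriv f t = frechet_derivative f (at t) 1" "(f has_real_derivative deriv f t) (at t)"
    if "smooth f" for f :: "real \<Rightarrow> real" and t
  proof -
    note d = smooth_deriv(1)[OF that, of t]
    have l: "linear (frechet_derivative f (at t))" using d by (rule has_derivative_linear)
    have "frechet_derivative f (at t) v = frechet_derivative f (at t) 1 * v" for v
      using linear_scale[OF l, of v 1] by (simp add: mult.commute)
    then have "(f has_real_derivative frechet_derivative f (at t) 1) (at t)"
      by (metis has_derivative_imp_has_field_derivative[OF d] mult.commute)
    then show "deriv f t = frechet_derivative f (at t) 1" "(f has_real_derivative deriv f t) (at t)"
      using DERIV_imp_deriv by metis+
  qed
  show s: "smooth ((deriv ^^ n) f)" for n
  proof (induction n)
    case 0
    then show ?case using assms by simp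
  next
    case (Suc n)
    have "deriv ((deriv ^^ n) f) = (\<lambda>t. frechet_derivative ((deriv ^^ n) f) (at t) 1)"
      by (rule ext) (rule D(1)[OF Suc])
    then show ?case
      unfolding funpow.simps o_apply by (simp only: smooth_deriv(2)[OF Suc])
  qed
  show "((deriv ^^ n) f has_real_derivative (deriv ^^ Suc n) f t) (at t)"
    unfolding funpow.simps o_apply by (rule D(2)[OF s])
qed

section \<open>Symmetry of second derivatives\<close>

lemma second_derivative_mvt:
  fixes f :: "'a::real_normed_vector \<Rightarrow> real"
  assumes f: "\<And>Q. (f has_derivative f' Q) (at Q)"
    and g: "\<And>Q. ((\<lambda>R. f' R u) has_derivative g Q) (at Q)"
    and t: "t > 0"
  shows "\<exists>r s. 0 < r \<and> r < t \<and> 0 < s \<and> s < t \<and>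
    f (P + t *\<^sub>R u + t *\<^sub>R v) - f (P + t *\<^sub>R u) - f (P + t *\<^sub>R v) + f P
      = t * t * g (P + r *\<^sub>R u + s *\<^sub>R v) v"
proof -
  have line: "((\<lambda>r. h (Q + r *\<^sub>R w)) has_real_derivative h' (Q + r *\<^sub>R w) w) (at r)"
    if "\<And>Q. (h has_derivative h' Q) (at Q)" for h h' Q w and r :: real
  proof -
    have "((\<lambda>r. h (Q + r *\<^sub>R w)) has_derivative (\<lambda>y. h' (Q + r *\<^sub>R w) (y *\<^sub>R w))) (at r)"
      by (rule has_derivative_compose[OF _ that]) (auto intro!: derivative_eq_intros)
    moreover have "linear (h' (Q + r *\<^sub>R w))"
      using that has_derivative_linear by blast
    ultimately show ?thesis
      by (elim has_derivative_imp_has_field_derivative) (simp add: linear_scale)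
  qed
  \<comment> \<open>Mean value theorem in direction \<open>u\<close> for the difference along two
    parallel segments, then in direction \<open>v\<close> for the slope so obtained.\<close>
  let ?\<phi> = "\<lambda>r. f ((P + t *\<^sub>R v) + r *\<^sub>R u) - f (P + r *\<^sub>R u)"
  have "\<exists>r. 0 < r \<and> r < t \<and> ?\<phi> t - ?\<phi> 0 =
      (t - 0) * (f' ((P + t *\<^sub>R v) + r *\<^sub>R u) u - f' (P + r *\<^sub>R u) u)"
    by (rule MVT2[OF t]) (intro derivative_intros line f)
  then obtain r where r: "0 < r" "r < t"
    "?\<phi> t - ?\<phi> 0 = t * (f' ((P + t *\<^sub>R v) + r *\<^sub>R u) u - f' (P + r *\<^sub>R u) u)" by auto
  let ?\<chi> = "\<lambda>s. f' ((P + r *\<^sub>R u) + s *\<^sub>R v) u"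
  have "\<exists>s. 0 < s \<and> s < t \<and> ?\<chi> t - ?\<chi> 0 = (t - 0) * g ((P + r *\<^sub>R u) + s *\<^sub>R v) v"
    by (rule MVT2[OF t]) (rule line[OF g])
  then obtain s where s: "0 < s" "s < t" "?\<chi> t - ?\<chi> 0 = t * g ((P + r *\<^sub>R u) + s *\<^sub>R v) v" by auto
  show ?thesis
    using r s by (intro exI[of _ r] exI[of _ s]) (simp add: algebra_simps)
qed

text \<open>The second difference does not depend on the order of \<open>u\<close> and
  \<open>v\<close>, and it equals \<open>t * t\<close> times either mixed derivative at some point
  close to \<open>P\<close>. Continuity gives the claim as \<open>t\<close> tends to 0.\<close>

lemma second_derivative_symmetric_real:
  fixes f :: "'a::real_normed_vector \<Rightarrow> real"
  assumes f: "\<And>Q. (f has_derivative f' Q) (at Q)"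
    and g: "\<And>Q. ((\<lambda>R. f' R u) has_derivative g Q) (at Q)"
    and h: "\<And>Q. ((\<lambda>R. f' R v) has_derivative h Q) (at Q)"
    and cg: "isCont (\<lambda>Q. g Q v) P" and ch: "isCont (\<lambda>Q. h Q u) P"
  shows "g P v = h P u"
proof -
  have near: "\<exists>r s r' s'. (\<bar>r\<bar> < t \<and> \<bar>s\<bar> < t \<and> \<bar>r'\<bar> < t \<and> \<bar>s'\<bar> < t) \<and>
      g (P + r *\<^sub>R u + s *\<^sub>R v) v = h (P + r' *\<^sub>R u + s' *\<^sub>R v) u" if t: "t > 0" for t :: real
  proof -
    obtain r s where rs: "0 < r \<and> r < t \<and> 0 < s \<and> s < t \<and>
      f (P + t *\<^sub>R u + t *\<^sub>R v) - f (P + t *\<^sub>R u) - f (P + t *\<^sub>R v) + f P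
        = t * t * g (P + r *\<^sub>R u + s *\<^sub>R v) v"
      using second_derivative_mvt[OF f g t, of P v] by auto
    obtain s' r' where rs': "0 < s' \<and> s' < t \<and> 0 < r' \<and> r' < t \<and>
      f (P + t *\<^sub>R v + t *\<^sub>R u) - f (P + t *\<^sub>R v) - f (P + t *\<^sub>R u) + f P
        = t * t * h (P + s' *\<^sub>R v + r' *\<^sub>R u) u"
      using second_derivative_mvt[OF f h t, of P u] by auto
    have "f (P + t *\<^sub>R u + t *\<^sub>R v) = f (P + t *\<^sub>R v + t *\<^sub>R u)" by (simp add: add_ac)
    then have "t * t * g (P + r *\<^sub>R u + s *\<^sub>R v) v = t * t * h (P + s' *\<^sub>R v + r' *\<^sub>R u) u"
      using rs rs' by linarith
    then have "g (P + r *\<^sub>R u + s *\<^sub>R v) v = h (P + r' *\<^sub>R u + s' *\<^sub>R v) u"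
      using t by (simp add: add_ac)
    then show ?thesis using rs rs'
      by (intro exI[of _ r] exI[of _ s] exI[of _ r'] exI[of _ s']) auto
  qed
  have "\<forall>n. \<exists>r s r' s'. (\<bar>r\<bar> < inverse (real (Suc n)) \<and> \<bar>s\<bar> < inverse (real (Suc n))
      \<and> \<bar>r'\<bar> < inverse (real (Suc n)) \<and> \<bar>s'\<bar> < inverse (real (Suc n))) \<and>
      g (P + r *\<^sub>R u + s *\<^sub>R v) v = h (P + r' *\<^sub>R u + s' *\<^sub>R v) u"
    by (intro allI near) (rule inverse_Suc)
  then obtain r where "\<forall>n. \<exists>s r' s'. (\<bar>r n\<bar> < inverse (real (Suc n)) \<and> \<bar>s\<bar> < inverse (real (Suc n))
      \<and> \<bar>r'\<bar> < inverse (real (Suc n)) \<and> \<bar>s'\<bar> < inverse (real (Suc n))) \<and>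
      g (P + r n *\<^sub>R u + s *\<^sub>R v) v = h (P + r' *\<^sub>R u + s' *\<^sub>R v) u"
    by (rule choice[THEN exE])
  then obtain s where "\<forall>n. \<exists>r' s'. (\<bar>r n\<bar> < inverse (real (Suc n)) \<and> \<bar>s n\<bar> < inverse (real (Suc n))
      \<and> \<bar>r'\<bar> < inverse (real (Suc n)) \<and> \<bar>s'\<bar> < inverse (real (Suc n))) \<and>
      g (P + r n *\<^sub>R u + s n *\<^sub>R v) v = h (P + r' *\<^sub>R u + s' *\<^sub>R v) u"
    by (rule choice[THEN exE])
  then obtain r' where "\<forall>n. \<exists>s'. (\<bar>r n\<bar> < inverse (real (Suc n)) \<and> \<bar>s n\<bar> < inverse (real (Suc n))
      \<and> \<bar>r' n\<bar> < inverse (real (Suc n)) \<and> \<bar>s'\<bar> < inverse (real (Suc n))) \<and>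
      g (P + r n *\<^sub>R u + s n *\<^sub>R v) v = h (P + r' n *\<^sub>R u + s' *\<^sub>R v) u"
    by (rule choice[THEN exE])
  then obtain s' where *: "\<forall>n. (\<bar>r n\<bar> < inverse (real (Suc n)) \<and> \<bar>s n\<bar> < inverse (real (Suc n))
      \<and> \<bar>r' n\<bar> < inverse (real (Suc n)) \<and> \<bar>s' n\<bar> < inverse (real (Suc n))) \<and>
      g (P + r n *\<^sub>R u + s n *\<^sub>R v) v = h (P + r' n *\<^sub>R u + s' n *\<^sub>R v) u"
    by (rule choice[THEN exE])
  have b: "\<And>n. \<bar>r n\<bar> < inverse (real (Suc n))" "\<And>n. \<bar>s n\<bar> < inverse (real (Suc n))"
      "\<And>n. \<bar>r' n\<bar> < inverse (real (Suc n))" "\<And>n. \<bar>s' n\<bar> < inverse (real (Suc n))"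
      and eq: "\<And>n. g (P + r n *\<^sub>R u + s n *\<^sub>R v) v = h (P + r' n *\<^sub>R u + s' n *\<^sub>R v) u"
    using * by blast+
  have z: "a \<longlonglongrightarrow> 0" if "\<And>n. \<bar>a n\<bar> < inverse (real (Suc n))" for a :: "nat \<Rightarrow> real"
    by (rule Lim_null_comparison[OF _ LIMSEQ_inverse_real_of_nat]) (intro always_eventually allI, simp only: real_norm_def less_imp_le[OF that])
  have lim: "(\<lambda>n. P + a n *\<^sub>R u + c n *\<^sub>R v) \<longlonglongrightarrow> P" if "a \<longlonglongrightarrow> 0" "c \<longlonglongrightarrow> 0" for a c
    using tendsto_add[OF tendsto_add[OF tendsto_const tendsto_scaleR[OF that(1) tendsto_const]]
        tendsto_scaleR[OF that(2) tendsto_const], of P u v] by simp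
  have "(\<lambda>n. g (P + r n *\<^sub>R u + s n *\<^sub>R v) v) \<longlonglongrightarrow> g P v"
    by (rule isCont_tendsto_compose[OF cg lim[OF z[OF b(1)] z[OF b(2)]]])
  moreover have "(\<lambda>n. h (P + r' n *\<^sub>R u + s' n *\<^sub>R v) u) \<longlonglongrightarrow> h P u"
    by (rule isCont_tendsto_compose[OF ch lim[OF z[OF b(3)] z[OF b(4)]]])
  ultimately show ?thesis
    unfolding eq using LIMSEQ_unique by blast
qed

lemma smooth_isCont: "smooth f \<Longrightarrow> isCont f x"
  using smooth_deriv(1) has_derivative_continuous by blast

lemma second_derivative_symmetric:
  fixes f :: "'a::euclidean_space \<Rightarrow> 'b::euclidean_space"
  assumes "smooth f"
  shows "frechet_derivative (\<lambda>Q. frechet_derivative f (at Q) u) (at P) v =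
         frechet_derivative (\<lambda>Q. frechet_derivative f (at Q) v) (at P) u"
proof (rule euclidean_eqI)
  fix b :: 'b
  show "frechet_derivative (\<lambda>Q. frechet_derivative f (at Q) u) (at P) v \<bullet> b =
         frechet_derivative (\<lambda>Q. frechet_derivative f (at Q) v) (at P) u \<bullet> b"
    by (rule second_derivative_symmetric_real[where f = "\<lambda>Q. f Q \<bullet> b"
            and f' = "\<lambda>Q v. frechet_derivative f (at Q) v \<bullet> b"])
      (intro has_derivative_inner_left smooth_deriv assms smooth_isCont smooth_inner_left)+
qed

section \<open>The metrics and their curvature\<close>

text \<open>
  \<open>\<sigma>\<close> represents the flat metric \<open>\<eta>\<close> by \<open>\<eta>(u, v) = u \<bullet> \<sigma> v\<close>, \<open>E\<close> is the coordinate field of \<open>x\<^sup>*\<close> (so that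
  \<open>\<eta>(E, \<cdot>) = dx\<close>), and \<open>K\<close> is the Lagrangian subspace spanned by all starred coordinates.
\<close>

locale null_frame =
  fixes \<sigma> :: "'a::euclidean_space \<Rightarrow> 'a" and E :: 'a and K :: "'a set"
  assumes linear_sigma: "linear \<sigma>"
    and sigma_sigma [simp]: "\<sigma> (\<sigma> u) = u"
    and sigma_adjoint: "\<sigma> u \<bullet> v = u \<bullet> \<sigma> v"
    and E_in_K [simp]: "E \<in> K"
    and K_perp: "u \<in> K \<longleftrightarrow> (\<forall>v\<in>K. u \<bullet> \<sigma> v = 0)"
begin

definition eta :: "'a \<Rightarrow> 'a \<Rightarrow> real" where "eta u v = u \<bullet> \<sigma> v"

definition xf :: "'a \<Rightarrow> real" where "xf u = eta E u"

text \<open>The \<open>eta\<close>-dual vector of a linear form. The explicit sum over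
  \<open>Basis\<close>, instead of a choice of representing vector, lets derivatives and smoothness
  pass through termwise.\<close>

definition sharp :: "('a \<Rightarrow> real) \<Rightarrow> 'a" where "sharp \<phi> = (\<Sum>b\<in>Basis. \<phi> b *\<^sub>R \<sigma> b)"

lemma eta_commute: "eta u v = eta v u"
  by (metis eta_def inner_commute sigma_adjoint)

lemma eta_simps [simp]:
  "eta (u + v) w = eta u w + eta v w" "eta w (u + v) = eta w u + eta w v"
  "eta (u - v) w = eta u w - eta v w" "eta w (u - v) = eta w u - eta w v"
  "eta (c *\<^sub>R u) w = c * eta u w" "eta w (c *\<^sub>R u) = c * eta w u"
  "eta 0 w = 0" "eta w 0 = 0" "eta (- u) w = - eta u w" "eta w (- u) = - eta w u"
  by (simp_all add: eta_def inner_simps linear_add[OF linear_sigma] linear_diff[OF linear_sigma]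
      linear_scale[OF linear_sigma] linear_0[OF linear_sigma] linear_neg[OF linear_sigma])

lemma xf_simps [simp]:
  "xf (u + v) = xf u + xf v" "xf (u - v) = xf u - xf v" "xf (c *\<^sub>R u) = c * xf u" "xf 0 = 0"
  "xf (- u) = - xf u"
  by (simp_all add: xf_def)

lemma eta_sum: "eta (\<Sum>i\<in>I. f i) w = (\<Sum>i\<in>I. eta (f i) w)"
  by (simp add: eta_def inner_sum_left)

lemma linear_xf: "linear xf"
  by (rule linearI) simp_all

lemma linear_eta: "linear (eta u)" "linear (\<lambda>u. eta u v)"
  by (rule linearI; simp)+

lemma eta_E [simp]: "eta E u = xf u" "eta u E = xf u"
  by (simp_all add: xf_def eta_commute)

lemma eta_nondegenerate: "(\<And>w. eta u w = eta v w) \<Longrightarrow> u = v"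
  unfolding eta_def using sigma_sigma by (metis inner_commute vector_eq_rdot)

lemma eta_sharp:
  assumes "linear \<phi>"
  shows "eta (sharp \<phi>) w = \<phi> w"
proof -
  have "eta (sharp \<phi>) w = (\<Sum>b\<in>Basis. \<phi> b * (w \<bullet> b))"
    unfolding sharp_def eta_sum by (simp add: eta_def sigma_adjoint) (simp add: inner_commute)
  also have "\<dots> = \<phi> (\<Sum>b\<in>Basis. (w \<bullet> b) *\<^sub>R b)"
    by (simp add: linear_sum[OF assms] linear_scale[OF assms] mult.commute)
  finally show ?thesis by (simp add: euclidean_representation)
qed

lemma eta_K: "u \<in> K \<Longrightarrow> v \<in> K \<Longrightarrow> eta u v = 0"
  unfolding eta_def using K_perp by blast

lemma K_iff: "u \<in> K \<longleftrightarrow> (\<forall>v\<in>K. eta u v = 0)"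
  unfolding eta_def by (rule K_perp)

lemma xf_K [simp]: "u \<in> K \<Longrightarrow> xf u = 0"
  using eta_K[OF E_in_K] by simp

lemma K_closed [simp]:
  "0 \<in> K" "u \<in> K \<Longrightarrow> v \<in> K \<Longrightarrow> u + v \<in> K" "u \<in> K \<Longrightarrow> v \<in> K \<Longrightarrow> u - v \<in> K"
  "u \<in> K \<Longrightarrow> c *\<^sub>R u \<in> K" "u \<in> K \<Longrightarrow> - u \<in> K"
  by (subst K_iff; simp add: eta_K)+

lemma sharp_in_K: "linear \<phi> \<Longrightarrow> (\<And>v. v \<in> K \<Longrightarrow> \<phi> v = 0) \<Longrightarrow> sharp \<phi> \<in> K"
  by (subst K_iff) (simp add: eta_sharp)

definition met :: "('a list \<Rightarrow> 'a \<Rightarrow> real) \<Rightarrow> 'a metric_field" where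
  "met FD P u v = eta u v - 2 * FD [] P * (xf u * xf v)"

text \<open>Koszul's formula for \<open>met\<close> gives a covector, which is raised here with the
  flat \<open>eta\<close>. This is legitimate because the result lies in \<open>K\<close>, where
  \<open>xf\<close> vanishes and \<open>met\<close> pairs like \<open>eta\<close>.\<close>

definition chr :: "('a list \<Rightarrow> 'a \<Rightarrow> real) \<Rightarrow> 'a connection_coeff" where
  "chr FD P u v = (xf u * xf v) *\<^sub>R sharp (\<lambda>w. FD [w] P) - (FD [u] P * xf v + FD [v] P * xf u) *\<^sub>R E"

text \<open>The expected value of the covariant derivative of order \<open>length us\<close> of the
  curvature operator on \<open>us @ [X, Y, Z]\<close>; \<open>Rform\<close> is the version with
  lowered index.\<close>

definition Rop :: "('a list \<Rightarrow> 'a \<Rightarrow> real) \<Rightarrow> 'a list \<Rightarrow> 'a \<Rightarrow> 'a \<Rightarrow> 'a \<Rightarrow> 'a \<Rightarrow> 'a" where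
  "Rop FD us P X Y Z =
     (xf Y * xf Z) *\<^sub>R sharp (\<lambda>w. FD (us @ [X, w]) P) - (xf X * xf Z) *\<^sub>R sharp (\<lambda>w. FD (us @ [Y, w]) P)
     - (xf Y * FD (us @ [X, Z]) P - xf X * FD (us @ [Y, Z]) P) *\<^sub>R E"

definition Rform :: "('a list \<Rightarrow> 'a \<Rightarrow> real) \<Rightarrow> 'a list \<Rightarrow> 'a \<Rightarrow> 'a \<Rightarrow> 'a \<Rightarrow> 'a \<Rightarrow> 'a \<Rightarrow> real" where
  "Rform FD us P X Y Z W =
     xf Y * xf Z * FD (us @ [X, W]) P - xf X * xf Z * FD (us @ [Y, W]) P
     - (xf Y * FD (us @ [X, Z]) P - xf X * FD (us @ [Y, Z]) P) * xf W"

end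

text \<open>
  \<open>FD us P\<close> is the iterated directional derivative of \<open>F = FD []\<close> at \<open>P\<close> in the directions \<open>us\<close>, the
  head of the list being the direction that is differentiated last.
\<close>

locale walker = null_frame +
  fixes FD :: "'a list \<Rightarrow> 'a \<Rightarrow> real"
  assumes FD_deriv: "(FD us has_derivative (\<lambda>u. FD (u # us) P)) (at P)"
    and FD_sym: "FD [u, v] P = FD [v, u] P"
    and FD_K: "u \<in> set us \<Longrightarrow> u \<in> K \<Longrightarrow> FD us P = 0"
begin

text \<open>In the head slot this is linearity of a derivative. In a deeper slot the identity holds
  for the functions being differentiated, and uniqueness of derivatives carries it past each further
  direction.\<close>

lemma FD_linear: "linear (\<lambda>u. FD (us @ u # vs) P)"
proof (induction us arbitrary: P)
  case Nil
  show ?case using has_derivative_linear[OF FD_deriv] by simp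
next
  case (Cons w us)
  show ?case
  proof (rule linearI)
    fix u v
    have "FD (us @ (u + v) # vs) = (\<lambda>Q. FD (us @ u # vs) Q + FD (us @ v # vs) Q)"
      using linear_add[OF Cons] by blast
    then have "((\<lambda>Q. FD (us @ u # vs) Q + FD (us @ v # vs) Q) has_derivative
        (\<lambda>w. FD (w # us @ (u + v) # vs) P)) (at P)"
      using FD_deriv[of "us @ (u + v) # vs" P] by simp
    from has_derivative_unique[OF this has_derivative_add[OF FD_deriv FD_deriv]]
    show "FD ((w # us) @ (u + v) # vs) P = FD ((w # us) @ u # vs) P + FD ((w # us) @ v # vs) P"
      by (metis append_Cons)
  next
    fix c u
    have "FD (us @ (c *\<^sub>R u) # vs) = (\<lambda>Q. c *\<^sub>R FD (us @ u # vs) Q)"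
      using linear_scale[OF Cons] by blast
    then have "((\<lambda>Q. c *\<^sub>R FD (us @ u # vs) Q) has_derivative (\<lambda>w. FD (w # us @ (c *\<^sub>R u) # vs) P)) (at P)"
      using FD_deriv[of "us @ (c *\<^sub>R u) # vs" P] by simp
    from has_derivative_unique[OF this has_derivative_scaleR_right[OF FD_deriv]]
    show "FD ((w # us) @ (c *\<^sub>R u) # vs) P = c *\<^sub>R FD ((w # us) @ u # vs) P"
      by (metis append_Cons)
  qed
qed

lemma FD1_linear: "linear (\<lambda>u. FD (u # vs) P)"
  using FD_linear[of "[]"] by simp

lemma FD_last_linear: "linear (\<lambda>w. FD (us @ [X, w]) P)"
  using FD_linear[of "us @ [X]" "[]"] by simp

lemma FD1_simps [simp]:
  "FD ((u + v) # vs) P = FD (u # vs) P + FD (v # vs) P"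
  "FD ((u - v) # vs) P = FD (u # vs) P - FD (v # vs) P"
  "FD ((c *\<^sub>R u) # vs) P = c * FD (u # vs) P"
  using linear_add[OF FD1_linear] linear_diff[OF FD1_linear] linear_scale[OF FD1_linear] by auto

lemma smooth_FD: "smooth (FD us)"
  by (rule smooth_coinduct[where h = FD and nxt = "\<lambda>us u. u # us"]) (rule FD_deriv)

lemma grad_in_K: "sharp (\<lambda>w. FD [w] P) \<in> K"
  by (rule sharp_in_K[OF FD1_linear]) (simp add: FD_K)

lemma chr_in_K [simp]: "chr FD P u v \<in> K"
  unfolding chr_def by (intro K_closed grad_in_K E_in_K)

text \<open>With \<open>chr_in_K\<close> this makes every composition of two connection coefficients
  vanish, so that the curvature has no quadratic terms.\<close>

lemma chr_K [simp]: "v \<in> K \<Longrightarrow> chr FD P u v = 0" "v \<in> K \<Longrightarrow> chr FD P v u = 0"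
  by (simp_all add: chr_def FD_K)

lemma chr_commute: "chr FD P u v = chr FD P v u"
  by (simp add: chr_def mult.commute add.commute)

lemma linear_chr: "linear (chr FD P u)"
  by (rule linearI) (simp_all add: chr_def algebra_simps)

lemma bilinear_chr: "bilinear (chr FD P)"
  unfolding bilinear_def using linear_chr by (simp add: chr_commute[of P _ v for v])

lemma met_simps [simp]:
  "met FD P (u + v) w = met FD P u w + met FD P v w" "met FD P w (u + v) = met FD P w u + met FD P w v"
  "met FD P (u - v) w = met FD P u w - met FD P v w" "met FD P w (u - v) = met FD P w u - met FD P w v"
  "met FD P (c *\<^sub>R u) w = c * met FD P u w" "met FD P w (c *\<^sub>R u) = c * met FD P w u"
  "met FD P 0 w = 0" "met FD P w 0 = 0"
  by (simp_all add: met_def algebra_simps)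

lemma met_commute: "met FD P u v = met FD P v u"
  by (simp add: met_def eta_commute mult.commute)

lemma met_nondegenerate:
  assumes "\<And>w. met FD P u w = met FD P v w"
  shows "u = v"
proof (rule eta_nondegenerate)
  fix w
  have "xf u = xf v" using assms[of E] by (simp add: met_def)
  then show "eta u w = eta v w" using assms[of w] by (simp add: met_def)
qed

section \<open>The Levi-Civita connection\<close>

lemma met_chr:
  "met FD P (chr FD P u v) w = - (FD [u] P * xf v * xf w + FD [v] P * xf u * xf w - FD [w] P * xf u * xf v)"
proof -
  have "eta (chr FD P u v) w = - (FD [u] P * xf v * xf w + FD [v] P * xf u * xf w - FD [w] P * xf u * xf v)"
    by (simp add: chr_def eta_sharp[OF FD1_linear] algebra_simps)
  then show ?thesis by (simp add: met_def)
qed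

lemma has_derivative_xf: "(Y has_derivative Y') F \<Longrightarrow> ((\<lambda>Q. xf (Y Q)) has_derivative (\<lambda>u. xf (Y' u))) F"
  using bounded_linear.has_derivative linear_xf linear_conv_bounded_linear by blast

text \<open>The base point \<open>\<phi>\<close> may move because the same formula serves for the
  metric pulled back by an isometry.\<close>

lemma has_derivative_met:
  assumes "(\<phi> has_derivative \<phi>') (at P)" "(Y has_derivative Y') (at P)" "(Z has_derivative Z') (at P)"
  shows "((\<lambda>Q. met FD (\<phi> Q) (Y Q) (Z Q)) has_derivative
    (\<lambda>u. - 2 * FD [\<phi>' u] (\<phi> P) * (xf (Y P) * xf (Z P)) + met FD (\<phi> P) (Y' u) (Z P) + met FD (\<phi> P) (Y P) (Z' u)))
    (at P)"
proof -
  have s: "((\<lambda>Q. \<sigma> (Z Q)) has_derivative (\<lambda>u. \<sigma> (Z' u))) (at P)"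
    using bounded_linear.has_derivative[OF _ assms(3)] linear_sigma linear_conv_bounded_linear by blast
  have f: "((\<lambda>Q. FD [] (\<phi> Q)) has_derivative (\<lambda>u. FD [\<phi>' u] (\<phi> P))) (at P)"
    by (rule has_derivative_compose[OF assms(1) FD_deriv])
  show ?thesis
    unfolding met_def eta_def
    by (rule has_derivative_eq_rhs[OF has_derivative_diff[OF has_derivative_inner[OF assms(2) s]
            has_derivative_mult[OF has_derivative_mult_right[OF f] has_derivative_mult[OF
                has_derivative_xf[OF assms(2)] has_derivative_xf[OF assms(3)]]]]])
      (simp add: fun_eq_iff algebra_simps)
qed

lemma has_derivative_chr:
  "((\<lambda>Q. chr FD Q Y Z) has_derivative
     (\<lambda>u. (xf Y * xf Z) *\<^sub>R sharp (\<lambda>w. FD [u, w] P) - (FD [u, Y] P * xf Z + FD [u, Z] P * xf Y) *\<^sub>R E)) (at P)"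
  unfolding chr_def sharp_def
  by (intro has_derivative_diff has_derivative_scaleR_right has_derivative_sum has_derivative_scaleR_left
      has_derivative_add has_derivative_mult_left FD_deriv)

lemma smooth_chr: "smooth (\<lambda>P. chr FD P u v)"
  unfolding chr_def sharp_def
  by (intro smooth_diff smooth_scaleR smooth_const smooth_sum smooth_add smooth_mult smooth_FD)

lemma nabla_chr_compatible:
  assumes "smooth X" "smooth Y" "smooth Z"
  shows "frechet_derivative (\<lambda>Q. met FD Q (Y Q) (Z Q)) (at P) (X P) =
          met FD P (nabla (chr FD) X Y P) (Z P) + met FD P (Y P) (nabla (chr FD) X Z P)"
proof -
  have "frechet_derivative (\<lambda>Q. met FD Q (Y Q) (Z Q)) (at P) (X P) =
      - 2 * FD [X P] P * (xf (Y P) * xf (Z P)) + met FD P (frechet_derivative Y (at P) (X P)) (Z P)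
      + met FD P (Y P) (frechet_derivative Z (at P) (X P))"
    by (rule frechet_derivative_eq[OF has_derivative_met[OF has_derivative_ident
          smooth_deriv(1)[OF assms(2)] smooth_deriv(1)[OF assms(3)]]])
  then show ?thesis
    by (simp add: nabla_def met_chr met_commute[of P "Y P" "chr FD P u v" for u v] algebra_simps)
qed

lemma chr_levi_civita: "is_connection (chr FD) \<and> torsion_free (chr FD) \<and> metric_compatible (met FD) (chr FD)"
  unfolding is_connection_def torsion_free_def metric_compatible_def
proof (intro conjI allI impI)
  fix X Y :: "'a \<Rightarrow> 'a" and P
  show "nabla (chr FD) X Y P - nabla (chr FD) Y X P = lie_bracket X Y P"
    by (simp add: nabla_def lie_bracket_def chr_commute[of P "Y P"])
qed (auto intro: bilinear_chr smooth_chr nabla_chr_compatible)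

text \<open>Koszul's argument on constant fields, whose brackets vanish: compatibility for three
  arrangements of \<open>u\<close>, \<open>v\<close>, \<open>w\<close>, together with the symmetry
  of \<open>\<Gamma>\<close>, determines the inner products of \<open>\<Gamma> P u v\<close> with
  all \<open>w\<close>.\<close>

lemma levi_civita_unique:
  assumes "torsion_free \<Gamma>" "metric_compatible (met FD) \<Gamma>"
  shows "\<Gamma> = chr FD"
proof (intro ext, rule met_nondegenerate)
  fix P u v w
  have t: "\<Gamma> P a b = \<Gamma> P b a" for a b
    using assms(1)[unfolded torsion_free_def, rule_format, OF smooth_const smooth_const, of a b P]
    by (simp add: nabla_def lie_bracket_def frechet_derivative_const)
  have m: "- 2 * FD [a] P * (xf b * xf c) = met FD P (\<Gamma> P a b) c + met FD P (\<Gamma> P a c) b" for a b c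
  proof -
    have "frechet_derivative (\<lambda>Q. met FD Q b c) (at P) a = - 2 * FD [a] P * (xf b * xf c)"
      using frechet_derivative_eq[OF has_derivative_met[OF has_derivative_ident has_derivative_const has_derivative_const]]
      by simp
    then show ?thesis
      using assms(2)[unfolded metric_compatible_def, rule_format, OF smooth_const smooth_const smooth_const, of b c P a]
      by (simp add: nabla_def frechet_derivative_const met_commute[of P b])
  qed
  show "met FD P (\<Gamma> P u v) w = met FD P (chr FD P u v) w"
    using m[of u v w] m[of v u w] m[of w u v] t[of u v] t[of u w] t[of v w]
    unfolding met_chr by (simp add: algebra_simps)
qed

lemma levi_civita_met: "levi_civita (met FD) = chr FD"
  unfolding levi_civita_def
  by (rule the_equality) (use chr_levi_civita levi_civita_unique in auto)

section \<open>Curvature and its covariant derivatives\<close>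

lemma nabla_const: "nabla (chr FD) (\<lambda>_. Y) (\<lambda>_. Z) P = chr FD P Y Z"
  by (simp add: nabla_def frechet_derivative_const)

lemma curv_op_met: "curv_op (met FD) P vs = Rop FD [] P (vs ! 0) (vs ! 1) (vs ! 2)"
proof -
  \<comment> \<open>The value of the inner derivative lies in \<open>K\<close> and is killed by the
    outer \<open>chr\<close>; only its plain derivative in direction \<open>X\<close> is
    left.\<close>
  have 1: "nabla (chr FD) (\<lambda>_. X) (nabla (chr FD) (\<lambda>_. Y) (\<lambda>_. Z)) P =
      (xf Y * xf Z) *\<^sub>R sharp (\<lambda>w. FD [X, w] P) - (FD [X, Y] P * xf Z + FD [X, Z] P * xf Y) *\<^sub>R E" for X Y Z
    unfolding nabla_def[of _ "\<lambda>_. X"] nabla_const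
    by (simp add: frechet_derivative_eq[OF has_derivative_chr])
  have 2: "lie_bracket (\<lambda>_. X) (\<lambda>_. Y) = (\<lambda>_. 0)" for X Y :: 'a
    by (auto simp: lie_bracket_def frechet_derivative_const)
  show ?thesis
    unfolding curv_op_def levi_civita_met curvature_field_def 1 2 nabla_const
    by (simp add: Rop_def FD_sym[of "vs ! Suc 0" "vs ! 0"] algebra_simps)
qed

lemma Rop_K:
  assumes "\<exists>v\<in>set us \<union> {X, Y, Z}. v \<in> K"
  shows "Rop FD us P X Y Z = 0"
proof -
  have s: "sharp (\<lambda>w. 0) = 0" by (simp add: sharp_def)
  consider v where "v \<in> set us" "v \<in> K" | "X \<in> K" | "Y \<in> K" | "Z \<in> K" using assms by auto
  then show ?thesis
  proof cases
    case 1
    then have "FD (us @ ws) P = 0" for ws by (auto intro: FD_K)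
    then show ?thesis by (simp add: Rop_def s)
  next
    case 2
    then have "FD (us @ [X, w]) P = 0" for w by (auto intro: FD_K)
    then show ?thesis using 2 by (simp add: Rop_def s)
  next
    case 3
    then have "FD (us @ [Y, w]) P = 0" for w by (auto intro: FD_K)
    then show ?thesis using 3 by (simp add: Rop_def s)
  next
    case 4
    then have "FD (us @ [w, Z]) P = 0" for w by (auto intro: FD_K)
    then show ?thesis using 4 by (simp add: Rop_def s)
  qed
qed

lemma Rop_in_K: "Rop FD us P X Y Z \<in> K"
  unfolding Rop_def
  by (intro K_closed sharp_in_K FD_last_linear E_in_K) (auto intro: FD_K)

lemma eta_Rop: "eta (Rop FD us P X Y Z) W = Rform FD us P X Y Z W"
  by (simp add: Rop_def Rform_def eta_sharp[OF FD_last_linear])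

lemma has_derivative_Rop:
  "((\<lambda>Q. Rop FD us Q X Y Z) has_derivative (\<lambda>u. Rop FD (u # us) P X Y Z)) (at P)"
  unfolding Rop_def sharp_def append_Cons
  by (intro has_derivative_diff has_derivative_scaleR_right has_derivative_sum has_derivative_scaleR_left
      has_derivative_mult_right FD_deriv)

lemma has_derivative_Rform:
  "((\<lambda>Q. Rform FD us Q X Y Z W) has_derivative (\<lambda>u. Rform FD (u # us) P X Y Z W)) (at P)"
  unfolding Rform_def append_Cons
  by (intro has_derivative_diff has_derivative_mult_left has_derivative_mult_right FD_deriv)

text \<open>All Christoffel corrections drop out: those in the arguments insert a vector of
  \<open>K\<close>, on which \<open>Rop\<close> vanishes, and the one acting on the value meets a
  vector of \<open>K\<close>. Only the plain derivative remains, which adds a direction in front of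
  \<open>us\<close>.\<close>

lemma cov_deriv_op_met:
  assumes T: "\<And>Q us X Y Z. length us = n \<Longrightarrow> T Q (us @ [X, Y, Z]) = Rop FD us Q X Y Z"
    and us: "length us = n"
  shows "cov_deriv_op (chr FD) T P (u # us @ [X, Y, Z]) = Rop FD (u # us) P X Y Z"
proof -
  have T0: "T P vs = 0" if v: "length vs = n + 3" "i < length vs" "vs ! i \<in> K" for vs i
  proof -
    obtain ws X Y Z where vs: "vs = ws @ [X, Y, Z]" "length ws = n"
      using split_last3[OF v(1)] by blast
    have "vs ! i \<in> set vs" using v by simp
    then have "\<exists>v\<in>set ws \<union> {X, Y, Z}. v \<in> K" using v(3) unfolding vs(1) by force
    then show ?thesis using T[OF vs(2)] Rop_K vs(1) by simp
  qed
  have 1: "T P ((us @ [X, Y, Z])[i := chr FD P u ((us @ [X, Y, Z]) ! i)]) = 0"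
    if "i < length (us @ [X, Y, Z])" for i
    by (rule T0[of _ i]) (use that us in auto)
  have 2: "frechet_derivative (\<lambda>Q. T Q (us @ [X, Y, Z])) (at P) u = Rop FD (u # us) P X Y Z"
    unfolding T[OF us] by (rule frechet_derivative_eq[OF has_derivative_Rop])
  show ?thesis
    unfolding cov_deriv_op.simps 2 using 1 by (simp add: T[OF us] Rop_in_K)
qed

lemma nabla_curv_op_met:
  "length us = i \<Longrightarrow> nabla_curv_op (met FD) i P (us @ [X, Y, Z]) = Rop FD us P X Y Z"
proof (induction i arbitrary: us P X Y Z)
  case 0
  then show ?case by (simp add: nabla_curv_op_def curv_op_met)
next
  case (Suc i)
  then obtain u vs where us: "us = u # vs" "length vs = i" by (cases us) auto
  have "nabla_curv_op (met FD) (Suc i) = cov_deriv_op (chr FD) (nabla_curv_op (met FD) i)"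
    by (simp add: nabla_curv_op_def levi_civita_met)
  then show ?case
    using cov_deriv_op_met[of i "nabla_curv_op (met FD) i", OF Suc.IH us(2)] by (simp add: us(1))
qed

lemma cov_deriv_form_met:
  assumes T: "\<And>Q us X Y Z W. length us = n \<Longrightarrow> T Q (us @ [X, Y, Z, W]) = Rform FD us Q X Y Z W"
    and us: "length us = n"
  shows "cov_deriv_form (chr FD) T P (u # us @ [X, Y, Z, W]) = Rform FD (u # us) P X Y Z W"
proof -
  have T0: "T P vs = 0" if v: "length vs = n + 4" "i < length vs" "vs ! i \<in> K" for vs i
  proof -
    obtain ws X Y Z W where vs: "vs = ws @ [X, Y, Z, W]" "length ws = n"
      using split_last4[OF v(1)] by blast
    have "vs ! i \<in> set vs" using v by simp
    then have "(\<exists>v\<in>set ws \<union> {X, Y, Z}. v \<in> K) \<or> W \<in> K" using v(3) unfolding vs(1) by force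
    then show ?thesis
    proof
      assume "\<exists>v\<in>set ws \<union> {X, Y, Z}. v \<in> K"
      then show ?thesis using T[OF vs(2)] Rop_K vs(1) eta_Rop by (metis eta_simps(7))
    next
      \<comment> \<open>\<open>Rform\<close> pairs the value of \<open>Rop\<close>, which lies in
        \<open>K\<close>, with \<open>W\<close>; and \<open>K\<close> is isotropic.\<close>
      assume "W \<in> K"
      then show ?thesis using T[OF vs(2)] vs(1) eta_K[OF Rop_in_K] eta_Rop by metis
    qed
  qed
  have 1: "T P ((us @ [X, Y, Z, W])[i := chr FD P u ((us @ [X, Y, Z, W]) ! i)]) = 0"
    if "i < length (us @ [X, Y, Z, W])" for i
    by (rule T0[of _ i]) (use that us in auto)
  have 2: "frechet_derivative (\<lambda>Q. T Q (us @ [X, Y, Z, W])) (at P) u = Rform FD (u # us) P X Y Z W"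
    unfolding T[OF us] by (rule frechet_derivative_eq[OF has_derivative_Rform])
  show ?thesis
    unfolding cov_deriv_form.simps 2 using 1 by simp
qed

lemma nabla_curv_tensor_met:
  "length us = i \<Longrightarrow> nabla_curv_tensor (met FD) i P (us @ [X, Y, Z, W]) = Rform FD us P X Y Z W"
proof (induction i arbitrary: us P X Y Z W)
  case 0
  \<comment> \<open>The value of \<open>Rop\<close> lies in \<open>K\<close>, so lowering the index
    with \<open>met\<close> and with \<open>eta\<close> agree.\<close>
  have "met FD P (Rop FD [] P X Y Z) W = Rform FD [] P X Y Z W"
    using Rop_in_K[of "[]" P X Y Z] by (simp add: met_def eta_Rop)
  then show ?case using 0 by (simp add: nabla_curv_tensor_def curv_tensor_def curv_op_met)
next
  case (Suc i)
  then obtain u vs where us: "us = u # vs" "length vs = i" by (cases us) auto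
  have "nabla_curv_tensor (met FD) (Suc i) = cov_deriv_form (chr FD) (nabla_curv_tensor (met FD) i)"
    by (simp add: nabla_curv_tensor_def levi_civita_met)
  then show ?case
    using cov_deriv_form_met[of i "nabla_curv_tensor (met FD) i", OF Suc.IH us(2)] by (simp add: us(1))
qed

end


section \<open>Isometries and multilinear tensor fields\<close>

lemma isometry_bij: "isometry g \<phi> \<Longrightarrow> bij \<phi>"
  and isometry_smooth: "isometry g \<phi> \<Longrightarrow> smooth \<phi>"
  and isometry_smooth_inv: "isometry g \<phi> \<Longrightarrow> smooth (inv \<phi>)"
  and isometry_metric: "isometry g \<phi> \<Longrightarrow>
    g (\<phi> P) (frechet_derivative \<phi> (at P) u) (frechet_derivative \<phi> (at P) v) = g P u v"
  by (simp_all add: isometry_def)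

lemma frechet_derivative_comp:
  assumes "smooth \<phi>" "smooth \<psi>"
  shows "frechet_derivative (\<lambda>x. \<psi> (\<phi> x)) (at P) u =
    frechet_derivative \<psi> (at (\<phi> P)) (frechet_derivative \<phi> (at P) u)"
  by (rule frechet_derivative_eq[OF has_derivative_compose[OF smooth_deriv(1)[OF assms(1)] smooth_deriv(1)[OF assms(2)]]])

lemma isometry_comp:
  assumes "isometry g \<phi>" "isometry g \<psi>"
  shows "isometry g (\<psi> \<circ> \<phi>)"
  unfolding isometry_def
proof (intro conjI allI)
  note b = isometry_bij[OF assms(1)] isometry_bij[OF assms(2)]
  show "bij (\<psi> \<circ> \<phi>)" by (rule bij_comp[OF b])
  show "smooth (\<psi> \<circ> \<phi>)"
    unfolding o_def by (rule smooth_compose[OF isometry_smooth[OF assms(1)] isometry_smooth[OF assms(2)]])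
  show "smooth (inv (\<psi> \<circ> \<phi>))"
    unfolding o_inv_distrib[OF b(2,1)] unfolding o_def
    by (rule smooth_compose[OF isometry_smooth_inv[OF assms(2)] isometry_smooth_inv[OF assms(1)]])
  fix P u v
  show "g ((\<psi> \<circ> \<phi>) P) (frechet_derivative (\<psi> \<circ> \<phi>) (at P) u) (frechet_derivative (\<psi> \<circ> \<phi>) (at P) v) = g P u v"
    unfolding o_def frechet_derivative_comp[OF isometry_smooth[OF assms(1)] isometry_smooth[OF assms(2)]]
      isometry_metric[OF assms(2)] isometry_metric[OF assms(1)] ..
qed

lemma frechet_derivative_inv:
  assumes "isometry g \<phi>"
  shows "frechet_derivative \<phi> (at P) (frechet_derivative (inv \<phi>) (at (\<phi> P)) u) = u"
proof -
  note b = bij_is_surj[OF isometry_bij[OF assms]] bij_is_inj[OF isometry_bij[OF assms]]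
  have "frechet_derivative (\<lambda>x. \<phi> (inv \<phi> x)) (at (\<phi> P)) u = u"
    by (simp add: surj_f_inv_f[OF b(1)] frechet_derivative_eq[OF has_derivative_ident])
  then show ?thesis
    using frechet_derivative_comp[OF isometry_smooth_inv[OF assms] isometry_smooth[OF assms], of "\<phi> P" u]
    by (simp add: inv_f_f[OF b(2)])
qed

lemma isometry_surj_deriv: "isometry g \<phi> \<Longrightarrow> surj (frechet_derivative \<phi> (at P))"
  using frechet_derivative_inv by (metis surjI)

lemma isometry_inv:
  assumes "isometry g \<phi>"
  shows "isometry g (inv \<phi>)"
  unfolding isometry_def
proof (intro conjI allI)
  note b = isometry_bij[OF assms]
  show "bij (inv \<phi>)" by (rule bij_imp_bij_inv[OF b])
  show "smooth (inv \<phi>)" by (rule isometry_smooth_inv[OF assms])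
  show "smooth (inv (inv \<phi>))" unfolding inv_inv_eq[OF b] by (rule isometry_smooth[OF assms])
  fix P u v
  obtain Q where P: "P = \<phi> Q" using bij_is_surj[OF b] by (metis surjD)
  show "g (inv \<phi> P) (frechet_derivative (inv \<phi>) (at P) u) (frechet_derivative (inv \<phi>) (at P) v) = g P u v"
    using isometry_metric[OF assms, of Q "frechet_derivative (inv \<phi>) (at P) u" "frechet_derivative (inv \<phi>) (at P) v"]
    unfolding P frechet_derivative_inv[OF assms] inv_f_f[OF bij_is_inj[OF b]] by simp
qed

lemma homogeneousI:
  assumes "\<And>Q. \<exists>\<phi>. isometry g \<phi> \<and> \<phi> P0 = Q"
  shows "homogeneous g"
  unfolding homogeneous_def
proof (intro allI)
  fix P Q
  obtain \<phi> \<psi> where *: "isometry g \<phi>" "\<phi> P0 = P" "isometry g \<psi>" "\<psi> P0 = Q" using assms by metis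
  have "inv \<phi> P = P0" using *(2) inv_f_f[OF bij_is_inj[OF isometry_bij[OF *(1)]]] by metis
  then show "\<exists>\<phi>. isometry g \<phi> \<and> \<phi> P = Q"
    using * isometry_comp[OF isometry_inv[OF *(1)] *(3)] by (intro exI[of _ "\<psi> \<circ> inv \<phi>"]) simp
qed

text \<open>The geodesic symmetry at \<open>P\<close> is the one at the origin, conjugated by an
  isometry that carries 0 to \<open>P\<close>.\<close>

lemma symmetric_spaceI:
  assumes "homogeneous g" "isometry g uminus"
  shows "symmetric_space g"
  unfolding symmetric_space_def
proof (intro allI)
  fix P
  obtain \<phi> where \<phi>: "isometry g \<phi>" "\<phi> 0 = P" using assms(1) unfolding homogeneous_def by metis
  note b = isometry_bij[OF \<phi>(1)]
  note s = isometry_smooth[OF \<phi>(1)] isometry_smooth[OF assms(2)] isometry_smooth_inv[OF \<phi>(1)]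
  let ?\<sigma> = "\<phi> \<circ> (uminus \<circ> inv \<phi>)"
  have i: "isometry g ?\<sigma>" by (intro isometry_comp isometry_inv \<phi>(1) assms(2))
  have p: "inv \<phi> P = 0" using \<phi>(2) inv_f_f[OF bij_is_inj[OF b]] by metis
  have "frechet_derivative ?\<sigma> (at P) v = - v" for v
  proof -
    have u: "frechet_derivative uminus (at x) w = - w" for x w :: 'a
      by (rule frechet_derivative_eq) (auto intro!: derivative_eq_intros)
    have l: "linear (frechet_derivative \<phi> (at 0))" by (rule has_derivative_linear[OF smooth_deriv(1)[OF s(1)]])
    have "frechet_derivative ?\<sigma> (at P) v =
        frechet_derivative \<phi> (at (- inv \<phi> P)) (- frechet_derivative (inv \<phi>) (at P) v)"
      unfolding o_def using frechet_derivative_comp[OF smooth_compose[OF s(3) s(2)] s(1), of P v]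
        frechet_derivative_comp[OF s(3) s(2), of P v] u by simp
    also have "\<dots> = - v"
      using frechet_derivative_inv[OF \<phi>(1), of 0 v] unfolding p \<phi>(2) by (simp add: linear_neg[OF l])
    finally show ?thesis .
  qed
  then show "\<exists>\<sigma>. isometry g \<sigma> \<and> \<sigma> P = P \<and> (\<forall>v. frechet_derivative \<sigma> (at P) v = - v)"
    using i p \<phi>(2) by (intro exI[of _ ?\<sigma>]) simp
qed

section \<open>Multilinear tensor fields with moving arguments\<close>

definition multilinear_field :: "nat \<Rightarrow> ('a::euclidean_space \<Rightarrow> 'a list \<Rightarrow> 'b::real_normed_vector) \<Rightarrow> bool" where
  "multilinear_field r T \<longleftrightarrow>
     (\<forall>vs P. length vs = r \<longrightarrow> (\<lambda>Q. T Q vs) differentiable (at P)) \<and>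
     (\<forall>us ws P. length us + length ws + 1 = r \<longrightarrow> linear (\<lambda>v. T P (us @ v # ws)))"

lemma multilinear_field_update:
  assumes "multilinear_field r T" "length vs = r" "i < r"
  shows "linear (\<lambda>v. T P (vs[i := v]))"
proof -
  have "vs[i := v] = take i vs @ v # drop (Suc i) vs" for v
    using assms(2,3) by (simp add: upd_conv_take_nth_drop)
  then show ?thesis
    using assms unfolding multilinear_field_def by simp
qed

lemma multilinear_field_Cons:
  assumes "multilinear_field (Suc r) T"
  shows "multilinear_field r (\<lambda>P vs. T P (b # vs))"
  unfolding multilinear_field_def
proof (intro conjI allI impI)
  fix vs :: "'a list" and P assume "length vs = r"
  then show "(\<lambda>Q. T Q (b # vs)) differentiable (at P)"
    using assms unfolding multilinear_field_def by simp
next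
  fix us ws :: "'a list" and P assume "length us + length ws + 1 = r"
  then show "linear (\<lambda>v. T P (b # us @ v # ws))"
    using assms[unfolded multilinear_field_def, THEN conjunct2, rule_format, of "b # us" ws P] by simp
qed

lemma multilinear_field_expand:
  assumes "multilinear_field (Suc r) T" "length vs = r"
  shows "T P (v # vs) = (\<Sum>b\<in>Basis. (v \<bullet> b) *\<^sub>R T P (b # vs))"
proof -
  have l: "linear (\<lambda>v. T P (v # vs))"
    using assms(1)[unfolded multilinear_field_def, THEN conjunct2, rule_format, of "[]" vs P] assms(2) by simp
  have "T P (v # vs) = T P ((\<Sum>b\<in>Basis. (v \<bullet> b) *\<^sub>R b) # vs)"
    by (simp only: euclidean_representation)
  also have "\<dots> = (\<Sum>b\<in>Basis. (v \<bullet> b) *\<^sub>R T P (b # vs))"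
    by (simp only: linear_sum[OF l] linear_scale[OF l])
  finally show ?thesis .
qed

text \<open>Product rule when base point and arguments all move. In the induction the first argument
  is expanded in \<open>Basis\<close>, which leaves tensor fields of lower rank with a frozen first
  argument.\<close>

lemma has_derivative_multilinear_field:
  assumes "multilinear_field r T" "length vs = r" "(\<phi> has_derivative \<phi>') (at P)"
    and "\<And>v. v \<in> set vs \<Longrightarrow> ((\<lambda>Q. A Q v) has_derivative (\<lambda>u. A' u v)) (at P)"
  shows "((\<lambda>Q. T (\<phi> Q) (map (A Q) vs)) has_derivative
    (\<lambda>u. frechet_derivative (\<lambda>R. T R (map (A P) vs)) (at (\<phi> P)) (\<phi>' u)
        + (\<Sum>i<r. T (\<phi> P) ((map (A P) vs)[i := A' u (vs ! i)])))) (at P)"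
  using assms
proof (induction vs arbitrary: r T)
  case Nil
  have "((\<lambda>R. T R []) has_derivative frechet_derivative (\<lambda>R. T R []) (at (\<phi> P))) (at (\<phi> P))"
    using Nil.prems(1,2) unfolding multilinear_field_def by (simp add: frechet_derivative_works)
  from has_derivative_compose[OF Nil.prems(3) this] show ?case using Nil.prems(2) by simp
next
  case (Cons v vs)
  obtain n where r: "r = Suc n" "length vs = n" using Cons.prems(2) by auto
  note m = Cons.prems(1)[unfolded r(1)]
  have e: "T Q (w # l) = (\<Sum>b\<in>Basis. (w \<bullet> b) *\<^sub>R T Q (b # l))" if "length l = n" for Q w l
    by (rule multilinear_field_expand[OF m that])
  let ?l = "map (A P) vs"
  have d: "((\<lambda>R. T R (b # ?l)) has_derivative frechet_derivative (\<lambda>R. T R (b # ?l)) (at Q)) (at Q)" for b Q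
    using m r(2) unfolding multilinear_field_def by (simp add: frechet_derivative_works)
  have IH: "((\<lambda>Q. T (\<phi> Q) (b # map (A Q) vs)) has_derivative
      (\<lambda>u. frechet_derivative (\<lambda>R. T R (b # ?l)) (at (\<phi> P)) (\<phi>' u)
        + (\<Sum>i<n. T (\<phi> P) (b # ?l[i := A' u (vs ! i)])))) (at P)" for b
    using Cons.IH[OF multilinear_field_Cons[OF m] r(2) Cons.prems(3)] Cons.prems(4) by simp
  have fr: "frechet_derivative (\<lambda>R. T R (A P v # ?l)) (at (\<phi> P)) w =
      (\<Sum>b\<in>Basis. (A P v \<bullet> b) *\<^sub>R frechet_derivative (\<lambda>R. T R (b # ?l)) (at (\<phi> P)) w)" for w
  proof -
    have "T R (A P v # ?l) = (\<Sum>b\<in>Basis. (A P v \<bullet> b) *\<^sub>R T R (b # ?l))" for R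
      by (rule e) (simp add: r(2))
    then show ?thesis
      by (simp only:) (rule frechet_derivative_eq, intro has_derivative_sum has_derivative_scaleR_right d)
  qed
  have "((\<lambda>Q. \<Sum>b\<in>Basis. (A Q v \<bullet> b) *\<^sub>R T (\<phi> Q) (b # map (A Q) vs)) has_derivative
      (\<lambda>u. \<Sum>b\<in>Basis. (A P v \<bullet> b) *\<^sub>R (frechet_derivative (\<lambda>R. T R (b # ?l)) (at (\<phi> P)) (\<phi>' u)
        + (\<Sum>i<n. T (\<phi> P) (b # ?l[i := A' u (vs ! i)]))) + (A' u v \<bullet> b) *\<^sub>R T (\<phi> P) (b # ?l))) (at P)"
    by (intro has_derivative_sum has_derivative_scaleR has_derivative_inner_left IH Cons.prems(4)) simp
  moreover have "(\<Sum>b\<in>Basis. (A P v \<bullet> b) *\<^sub>R (frechet_derivative (\<lambda>R. T R (b # ?l)) (at (\<phi> P)) (\<phi>' u)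
        + (\<Sum>i<n. T (\<phi> P) (b # ?l[i := A' u (vs ! i)]))) + (A' u v \<bullet> b) *\<^sub>R T (\<phi> P) (b # ?l))
     = frechet_derivative (\<lambda>R. T R (map (A P) (v # vs))) (at (\<phi> P)) (\<phi>' u)
        + (\<Sum>i<r. T (\<phi> P) ((map (A P) (v # vs))[i := A' u ((v # vs) ! i)]))" for u
  proof -
    have "(\<Sum>b\<in>Basis. (A P v \<bullet> b) *\<^sub>R (\<Sum>i<n. T (\<phi> P) (b # ?l[i := A' u (vs ! i)])))
        = (\<Sum>i<n. T (\<phi> P) (A P v # ?l[i := A' u (vs ! i)]))"
      unfolding scaleR_sum_right by (subst sum.swap) (intro sum.cong refl e[symmetric]; simp add: r(2))
    moreover have "(\<Sum>b\<in>Basis. (A' u v \<bullet> b) *\<^sub>R T (\<phi> P) (b # ?l)) = T (\<phi> P) (A' u v # ?l)"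
      by (rule e[symmetric]) (simp add: r(2))
    ultimately show ?thesis
      unfolding r(1) sum.lessThan_Suc_shift by (simp add: fr sum.distrib scaleR_add_right)
  qed
  moreover have "T (\<phi> Q) (map (A Q) (v # vs)) = (\<Sum>b\<in>Basis. (A Q v \<bullet> b) *\<^sub>R T (\<phi> Q) (b # map (A Q) vs))" for Q
    unfolding list.map by (rule e) (simp add: r(2))
  ultimately show ?case by (simp only:)
qed

context walker
begin

lemma multilinear_nabla_curv_tensor: "multilinear_field (4 + n) (nabla_curv_tensor (met FD) n)"
  unfolding multilinear_field_def
proof (intro conjI allI impI)
  fix vs :: "'a list" and P assume "length vs = 4 + n"
  then obtain us X Y Z W where vs: "vs = us @ [X, Y, Z, W]" "length us = n"
    using split_last4[of vs n] by (metis add.commute)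
  show "(\<lambda>Q. nabla_curv_tensor (met FD) n Q vs) differentiable (at P)"
    unfolding vs(1) nabla_curv_tensor_met[OF vs(2)] differentiable_def using has_derivative_Rform by blast
next
  fix us ws :: "'a list" and P assume len: "length us + length ws + 1 = 4 + n"
  define t where "t = length ws"
  have l: "linear (\<lambda>v. FD (as @ v # bs) P)" for as bs by (rule FD_linear)
  have l1: "linear (\<lambda>v. FD (as @ [v]) P)" for as using l[of as "[]"] .
  have l2: "linear (\<lambda>v. FD (as @ [b, v]) P)" for as b using l[of "as @ [b]" "[]"] by simp
  note ls = linear_add[OF l] linear_scale[OF l] linear_add[OF l2] linear_scale[OF l2]
  have *: "nabla_curv_tensor (met FD) n P (as @ [X, Y, Z, W]) = Rform FD as P X Y Z W"
    if "length as = n" for as X Y Z W using nabla_curv_tensor_met[OF that] .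
  \<comment> \<open>The varied slot is located from the right: the four curvature arguments one by
    one, then any direction of covariant differentiation.\<close>
  consider "ws = []" | W where "ws = [W]" | Z W where "ws = [Z, W]" | Y Z W where "ws = [Y, Z, W]"
    | bs X Y Z W where "ws = bs @ [X, Y, Z, W]"
  proof (cases "length ws < 4")
    case True
    then consider "length ws = 0" | "length ws = Suc 0" | "length ws = Suc (Suc 0)" | "length ws = Suc (Suc (Suc 0))"
      by linarith
    then show thesis using that(1-4) by cases (auto simp only: length_Suc_conv length_0_conv)
  next
    case False
    then show thesis using split_last4[of ws "length ws - 4"] that(5) by (metis le_add_diff_inverse2 not_less)
  qed
  then show "linear (\<lambda>v. nabla_curv_tensor (met FD) n P (us @ v # ws))"
  proof cases
    case 1
    then have "length us = n + 3" using len by simp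
    then obtain as X Y Z where "us = as @ [X, Y, Z]" "length as = n" by (rule split_last3)
    then show ?thesis using 1 by (simp add: *) (rule linearI; simp add: Rform_def ls algebra_simps)
  next
    case (2 W)
    then have "length us = Suc (Suc n)" using len by simp
    then obtain as X Y where "us = as @ [X, Y]" "length as = n" by (rule split_last2)
    then show ?thesis using 2 by (simp add: *) (rule linearI; simp add: Rform_def ls algebra_simps)
  next
    case (3 Z W)
    then have "length us = Suc n" using len by simp
    then obtain as X where "us = as @ [X]" "length as = n" by (rule split_last1)
    then show ?thesis using 3 by (simp add: *) (rule linearI; simp add: Rform_def ls algebra_simps)
  next
    case (4 Y Z W)
    then have "length us = n" using len by simp
    then show ?thesis using 4 by (simp add: *) (rule linearI; simp add: Rform_def ls algebra_simps)
  next
    case (5 bs X Y Z W)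
    then have "length (us @ v # bs) = n" for v using len by simp
    from *[OF this] show ?thesis using 5 by (simp) (rule linearI; simp add: Rform_def ls algebra_simps)
  qed
qed

end


section \<open>Naturality of the curvature under isometries\<close>

context walker
begin

lemma multilinear_chr: "multilinear_field 2 (\<lambda>P vs. chr FD P (vs ! 0) (vs ! 1))"
  unfolding multilinear_field_def
proof (intro conjI allI impI)
  fix vs :: "'a list" and P
  show "(\<lambda>Q. chr FD Q (vs ! 0) (vs ! 1)) differentiable (at P)"
    unfolding differentiable_def using has_derivative_chr by blast
next
  fix us ws :: "'a list" and P assume "length us + length ws + 1 = 2"
  then consider X where "us = [X]" "ws = []" | X where "us = []" "ws = [X]"
    by (cases us; cases ws) auto
  then show "linear (\<lambda>v. chr FD P ((us @ v # ws) ! 0) ((us @ v # ws) ! 1))"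
  proof cases
    case 1
    then show ?thesis using linear_chr by simp
  next
    case (2 X)
    have "(\<lambda>v. chr FD P v X) = chr FD P X" by (rule ext) (rule chr_commute)
    then show ?thesis using linear_chr[of P X] 2 by simp
  qed
qed

text \<open>The derivative of \<open>chr FD Q Y Z\<close> with respect to \<open>Q\<close> in
  direction \<open>u\<close>; the curvature is its antisymmetrization, by
  \<open>Rop_dchr\<close>.\<close>

definition dchr :: "'a \<Rightarrow> 'a \<Rightarrow> 'a \<Rightarrow> 'a \<Rightarrow> 'a" where
  "dchr P u Y Z = (xf Y * xf Z) *\<^sub>R sharp (\<lambda>w. FD [u, w] P) - (FD [u, Y] P * xf Z + FD [u, Z] P * xf Y) *\<^sub>R E"

lemma Rop_dchr: "Rop FD [] P X Y Z = dchr P X Y Z - dchr P Y X Z"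
  by (simp add: Rop_def dchr_def FD_sym[of Y X] algebra_simps)

end

locale walker_isometry = walker +
  fixes \<phi>
  assumes iso: "isometry (met FD) \<phi>"
begin

definition D :: "'a \<Rightarrow> 'a \<Rightarrow> 'a" where "D P u = frechet_derivative \<phi> (at P) u"

definition D2 :: "'a \<Rightarrow> 'a \<Rightarrow> 'a \<Rightarrow> 'a" where "D2 P u v = frechet_derivative (\<lambda>Q. D Q v) (at P) u"

lemma smooth_D: "smooth (\<lambda>P. D P v)"
  unfolding D_def by (rule smooth_deriv(2)[OF isometry_smooth[OF iso]])

lemma has_derivative_phi: "(\<phi> has_derivative D P) (at P)"
  unfolding D_def using smooth_deriv(1)[OF isometry_smooth[OF iso]] by metis

lemma has_derivative_D: "((\<lambda>P. D P v) has_derivative (\<lambda>u. D2 P u v)) (at P)"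
  unfolding D2_def using smooth_deriv(1)[OF smooth_D] by metis

lemma linear_D: "linear (D P)"
  by (rule has_derivative_linear[OF has_derivative_phi])

lemma D2_commute: "D2 P u v = D2 P v u"
  unfolding D2_def D_def by (rule second_derivative_symmetric[OF isometry_smooth[OF iso]])

lemma multilinear_D: "multilinear_field 1 (\<lambda>P vs. D P (vs ! 0))"
  unfolding multilinear_field_def
proof (intro conjI allI impI)
  fix vs :: "'a list" and P
  show "(\<lambda>Q. D Q (vs ! 0)) differentiable (at P)"
    unfolding differentiable_def using has_derivative_D by blast
next
  fix us ws :: "'a list" and P assume "length us + length ws + 1 = 1"
  then show "linear (\<lambda>v. D P ((us @ v # ws) ! 0))" using linear_D by simp
qed

lemma met_D: "met FD (\<phi> P) (D P u) (D P v) = met FD P u v"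
  unfolding D_def by (rule isometry_metric[OF iso])

lemma met_D_deriv:
  "- 2 * FD [D P w] (\<phi> P) * (xf (D P u) * xf (D P v)) + met FD (\<phi> P) (D2 P w u) (D P v)
     + met FD (\<phi> P) (D2 P w v) (D P u) = - 2 * FD [w] P * (xf u * xf v)"
proof -
  have "((\<lambda>Q. met FD (\<phi> Q) (D Q u) (D Q v)) has_derivative
      (\<lambda>w. - 2 * FD [D P w] (\<phi> P) * (xf (D P u) * xf (D P v)) + met FD (\<phi> P) (D2 P w u) (D P v)
         + met FD (\<phi> P) (D P u) (D2 P w v))) (at P)"
    by (rule has_derivative_met[OF has_derivative_phi has_derivative_D has_derivative_D])
  moreover have "((\<lambda>Q. met FD (\<phi> Q) (D Q u) (D Q v)) has_derivative (\<lambda>w. - 2 * FD [w] P * (xf u * xf v))) (at P)"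
    unfolding met_D using has_derivative_met[OF has_derivative_ident has_derivative_const has_derivative_const, of u v P]
    by simp
  ultimately have "(\<lambda>w. - 2 * FD [D P w] (\<phi> P) * (xf (D P u) * xf (D P v)) + met FD (\<phi> P) (D2 P w u) (D P v)
         + met FD (\<phi> P) (D P u) (D2 P w v)) = (\<lambda>w. - 2 * FD [w] P * (xf u * xf v))"
    by (rule has_derivative_unique)
  from fun_cong[OF this, of w] show ?thesis by (simp add: met_commute[of _ "D P u"])
qed

text \<open>
  The Koszul formula: of the six terms with a second derivative of \<open>\<phi>\<close> four cancel by symmetry.
\<close>

lemma D_chr: "D P (chr FD P u v) = D2 P u v + chr FD (\<phi> P) (D P u) (D P v)"
proof (rule met_nondegenerate)
  fix w'
  obtain w where w: "w' = D P w"
    using isometry_surj_deriv[OF iso, of P] unfolding D_def by (metis surjD)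
  show "met FD (\<phi> P) (D P (chr FD P u v)) w' = met FD (\<phi> P) (D2 P u v + chr FD (\<phi> P) (D P u) (D P v)) w'"
    using met_D_deriv[of P u v w] met_D_deriv[of P v u w] met_D_deriv[of P w u v]
    unfolding w met_D met_simps met_chr D2_commute[of P v u] D2_commute[of P w u] D2_commute[of P w v]
    by (simp add: algebra_simps)
qed

lemma has_derivative_D_chr:
  "((\<lambda>Q. D Q (chr FD Q Y Z)) has_derivative (\<lambda>u. D2 P u (chr FD P Y Z) + D P (dchr P u Y Z))) (at P)"
proof -
  \<comment> \<open>The list entry \<open>Y\<close> is a placeholder: the map applied to it ignores
    its argument and supplies the moving vector \<open>chr FD Q Y Z\<close>.\<close>
  have "((\<lambda>Q. D Q (map (\<lambda>_. chr FD Q Y Z) [Y] ! 0)) has_derivative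
    (\<lambda>u. frechet_derivative (\<lambda>R. D R (map (\<lambda>_. chr FD P Y Z) [Y] ! 0)) (at P) u
        + (\<Sum>i<1. D P ((map (\<lambda>_. chr FD P Y Z) [Y])[i := dchr P u Y Z] ! 0)))) (at P)"
    by (rule has_derivative_multilinear_field[OF multilinear_D _ has_derivative_ident, where A' = "\<lambda>u _. dchr P u Y Z"])
      (simp_all add: dchr_def has_derivative_chr)
  then show ?thesis by (simp add: D2_def)
qed

lemma has_derivative_chr_D:
  "((\<lambda>Q. chr FD (\<phi> Q) (D Q Y) (D Q Z)) has_derivative
     (\<lambda>u. dchr (\<phi> P) (D P u) (D P Y) (D P Z)
        + (chr FD (\<phi> P) (D2 P u Y) (D P Z) + chr FD (\<phi> P) (D P Y) (D2 P u Z)))) (at P)"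
proof -
  have "((\<lambda>Q. chr FD (\<phi> Q) (map (D Q) [Y, Z] ! 0) (map (D Q) [Y, Z] ! 1)) has_derivative
    (\<lambda>u. frechet_derivative (\<lambda>R. chr FD R (map (D P) [Y, Z] ! 0) (map (D P) [Y, Z] ! 1)) (at (\<phi> P)) (D P u)
        + (\<Sum>i<2. chr FD (\<phi> P) ((map (D P) [Y, Z])[i := D2 P u ([Y, Z] ! i)] ! 0)
                            ((map (D P) [Y, Z])[i := D2 P u ([Y, Z] ! i)] ! 1)))) (at P)"
    by (rule has_derivative_multilinear_field[OF multilinear_chr _ has_derivative_phi has_derivative_D]) simp
  then show ?thesis
    by (simp add: frechet_derivative_eq[OF has_derivative_chr] dchr_def numeral_2_eq_2)
qed

lemma D_dchr:
  "D2 P u (chr FD P Y Z) + D P (dchr P u Y Z)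
    = frechet_derivative (\<lambda>Q. D2 Q Y Z) (at P) u + (dchr (\<phi> P) (D P u) (D P Y) (D P Z)
        + (chr FD (\<phi> P) (D2 P u Y) (D P Z) + chr FD (\<phi> P) (D P Y) (D2 P u Z)))"
proof -
  have s: "smooth (\<lambda>Q. D2 Q Y Z)" unfolding D2_def by (rule smooth_deriv(2)[OF smooth_D])
  have "((\<lambda>Q. D Q (chr FD Q Y Z)) has_derivative (\<lambda>u. frechet_derivative (\<lambda>Q. D2 Q Y Z) (at P) u
      + (dchr (\<phi> P) (D P u) (D P Y) (D P Z)
        + (chr FD (\<phi> P) (D2 P u Y) (D P Z) + chr FD (\<phi> P) (D P Y) (D2 P u Z))))) (at P)"
    unfolding D_chr by (rule has_derivative_add[OF smooth_deriv(1)[OF s] has_derivative_chr_D])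
  from fun_cong[OF has_derivative_unique[OF has_derivative_D_chr this], of u] show ?thesis .
qed

text \<open>Apply \<open>D_chr\<close> to \<open>chr P X (chr P Y Z)\<close>, which is zero, and
  then once more to the inner coefficient; the term with two coefficients at \<open>\<phi> P\<close>
  vanishes as well.\<close>

lemma D2_chr: "D2 P X (chr FD P Y Z) = - chr FD (\<phi> P) (D P X) (D2 P Y Z)"
proof -
  have "0 = D P (chr FD P X (chr FD P Y Z))"
    by (simp add: linear_0[OF linear_D])
  also have "\<dots> = D2 P X (chr FD P Y Z) + chr FD (\<phi> P) (D P X) (D2 P Y Z + chr FD (\<phi> P) (D P Y) (D P Z))"
    by (simp only: D_chr)
  finally show ?thesis
    by (simp add: linear_add[OF linear_chr] eq_neg_iff_add_eq_0)
qed

text \<open>Antisymmetrize \<open>D_dchr\<close> in \<open>X\<close> and \<open>Y\<close>. The third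
  derivatives of \<open>\<phi>\<close> cancel by symmetry, and \<open>D2_chr\<close> turns the
  remaining terms with second derivatives into ones that cancel against each other.\<close>

lemma D_Rop: "D P (Rop FD [] P X Y Z) = Rop FD [] (\<phi> P) (D P X) (D P Y) (D P Z)"
proof -
  have "frechet_derivative (\<lambda>Q. D2 Q Y Z) (at P) X = frechet_derivative (\<lambda>Q. D2 Q X Z) (at P) Y"
    unfolding D2_def by (rule second_derivative_symmetric[OF smooth_D])
  then show ?thesis
    using D_dchr[of P X Y Z] D_dchr[of P Y X Z] D2_chr[of P X Y Z] D2_chr[of P Y X Z]
    unfolding Rop_dchr linear_diff[OF linear_D] D2_commute[of P Y X]
    by (simp add: algebra_simps)
qed

text \<open>Differentiating the invariance of \<open>T\<close> produces one term with
  \<open>D2\<close> in each slot; by \<open>D_chr\<close> these are exactly the differences between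
  the Christoffel corrections at \<open>P\<close> and at \<open>\<phi> P\<close>.\<close>

lemma cov_deriv_form_natural:
  assumes T: "multilinear_field r T"
    and nat: "\<And>P vs. length vs = r \<Longrightarrow> T (\<phi> P) (map (D P) vs) = T P vs"
    and len: "length vs = r"
  shows "cov_deriv_form (chr FD) T (\<phi> P) (map (D P) (u # vs)) = cov_deriv_form (chr FD) T P (u # vs)"
proof -
  let ?l = "map (D P) vs"
  have "((\<lambda>Q. T Q vs) has_derivative (\<lambda>u. frechet_derivative (\<lambda>R. T R ?l) (at (\<phi> P)) (D P u)
        + (\<Sum>i<r. T (\<phi> P) (?l[i := D2 P u (vs ! i)])))) (at P)"
    using has_derivative_multilinear_field[OF T len has_derivative_phi, where A = D and A' = "D2 P", OF has_derivative_D]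
    by (simp only: nat[OF len])
  then have 1: "frechet_derivative (\<lambda>Q. T Q vs) (at P) u = frechet_derivative (\<lambda>R. T R ?l) (at (\<phi> P)) (D P u)
        + (\<Sum>i<r. T (\<phi> P) (?l[i := D2 P u (vs ! i)]))"
    by (rule frechet_derivative_eq)
  have 2: "T P (vs[i := chr FD P u (vs ! i)]) =
      T (\<phi> P) (?l[i := D2 P u (vs ! i)]) + T (\<phi> P) (?l[i := chr FD (\<phi> P) (D P u) (?l ! i)])" if "i < r" for i
  proof -
    have "T P (vs[i := chr FD P u (vs ! i)]) = T (\<phi> P) (map (D P) (vs[i := chr FD P u (vs ! i)]))"
      by (rule nat[symmetric]) (simp add: len)
    also have "\<dots> = T (\<phi> P) (?l[i := D2 P u (vs ! i) + chr FD (\<phi> P) (D P u) (?l ! i)])"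
      using that len by (simp add: map_update D_chr)
    also have "\<dots> = T (\<phi> P) (?l[i := D2 P u (vs ! i)]) + T (\<phi> P) (?l[i := chr FD (\<phi> P) (D P u) (?l ! i)])"
      by (rule linear_add[OF multilinear_field_update[OF T _ that]]) (simp add: len)
    finally show ?thesis .
  qed
  have "(\<Sum>i<r. T P (vs[i := chr FD P u (vs ! i)])) =
      (\<Sum>i<r. T (\<phi> P) (?l[i := D2 P u (vs ! i)])) + (\<Sum>i<r. T (\<phi> P) (?l[i := chr FD (\<phi> P) (D P u) (?l ! i)]))"
    using 2 by (simp add: sum.distrib)
  then show ?thesis unfolding list.map cov_deriv_form.simps 1 by (simp add: len)
qed

lemma nabla_curv_tensor_natural:
  "length vs = 4 + n \<Longrightarrow> nabla_curv_tensor (met FD) n (\<phi> P) (map (D P) vs) = nabla_curv_tensor (met FD) n P vs"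
proof (induction n arbitrary: P vs)
  case 0
  then obtain us X Y Z W where vs: "vs = us @ [X, Y, Z, W]" "length us = 0"
    using split_last4[of vs 0] by (metis add.commute)
  have "Rform FD [] (\<phi> P) (D P X) (D P Y) (D P Z) (D P W) = met FD (\<phi> P) (D P (Rop FD [] P X Y Z)) (D P W)"
    unfolding D_Rop by (simp add: met_def Rop_in_K eta_Rop)
  also have "\<dots> = Rform FD [] P X Y Z W"
    unfolding met_D by (simp add: met_def Rop_in_K eta_Rop)
  finally show ?case
    using nabla_curv_tensor_met[of "[]" 0] vs by simp
next
  case (Suc n)
  then obtain u ws where vs: "vs = u # ws" "length ws = 4 + n" by (cases vs) auto
  have "nabla_curv_tensor (met FD) (Suc n) = cov_deriv_form (chr FD) (nabla_curv_tensor (met FD) n)"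
    by (simp add: nabla_curv_tensor_def levi_civita_met)
  then show ?case
    using cov_deriv_form_natural[OF multilinear_nabla_curv_tensor Suc.IH vs(2)] vs(1) by simp
qed

lemma isometry_model_iso: "model_iso k (met FD) P (met FD) (\<phi> P)"
  unfolding model_iso_def
proof (intro exI[of _ "D P"] conjI allI impI)
  show "linear (D P)" by (rule linear_D)
  have "surj (D P)" using isometry_surj_deriv[OF iso, of P] unfolding D_def .
  then show "bij (D P)"
    using linear_surjective_imp_injective[OF linear_D] by (auto simp: bij_def)
  show "met FD (\<phi> P) (D P u) (D P v) = met FD P u v" for u v by (rule met_D)
  show "nabla_curv_tensor (met FD) i (\<phi> P) (map (D P) vs) = nabla_curv_tensor (met FD) i P vs"
    if "length vs = 4 + i" for i vs by (rule nabla_curv_tensor_natural[OF that])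
qed

end

context walker
begin

text \<open>Raising the last index: the metric is nondegenerate and preserved by
  \<open>\<Phi>\<close>, and \<open>\<Phi>\<close> is onto, so testing against all
  \<open>\<Phi> w\<close> suffices.\<close>

lemma model_iso_imp_affine:
  assumes "model_iso k (met FD) P (met FD) Q"
  shows "affine_model_iso k (met FD) P (met FD) Q"
proof -
  obtain \<Phi> where \<Phi>: "linear \<Phi>" "bij \<Phi>" "\<And>u v. met FD Q (\<Phi> u) (\<Phi> v) = met FD P u v"
    and R: "\<And>i vs. i \<le> k \<Longrightarrow> length vs = 4 + i \<Longrightarrow>
      nabla_curv_tensor (met FD) i Q (map \<Phi> vs) = nabla_curv_tensor (met FD) i P vs"
    using assms unfolding model_iso_def by blast
  have "nabla_curv_op (met FD) i Q (map \<Phi> vs) = \<Phi> (nabla_curv_op (met FD) i P vs)"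
    if i: "i \<le> k" and vs': "length vs = 3 + i" for i vs
  proof -
    obtain us X Y Z where vs: "vs = us @ [X, Y, Z]" "length us = i"
      using split_last3[of vs i] vs' by (metis add.commute)
    have l: "length (map \<Phi> us) = i" by (simp add: vs(2))
    show ?thesis
    proof (rule met_nondegenerate)
      fix w'
      obtain w where w: "w' = \<Phi> w" using bij_is_surj[OF \<Phi>(2)] by (metis surjD)
      have "Rform FD (map \<Phi> us) Q (\<Phi> X) (\<Phi> Y) (\<Phi> Z) (\<Phi> w) = Rform FD us P X Y Z w"
        using R[OF i, of "us @ [X, Y, Z, w]"] vs(2)
        by (simp add: nabla_curv_tensor_met[OF vs(2)] nabla_curv_tensor_met[OF l])
      then show "met FD Q (nabla_curv_op (met FD) i Q (map \<Phi> vs)) w' = met FD Q (\<Phi> (nabla_curv_op (met FD) i P vs)) w'"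
        unfolding w \<Phi>(3) vs(1) map_append list.map nabla_curv_op_met[OF vs(2)] nabla_curv_op_met[OF l]
        by (simp add: met_def Rop_in_K eta_Rop)
    qed
  qed
  then show ?thesis unfolding affine_model_iso_def using \<Phi>(1,2) by blast
qed

lemma homogeneous_imp_affine_curvature_homogeneous:
  assumes "homogeneous (met FD)"
  shows "affine_curvature_homogeneous k (met FD)"
  unfolding affine_curvature_homogeneous_def
proof (intro allI)
  fix P Q
  obtain \<phi> where \<phi>: "isometry (met FD) \<phi>" "\<phi> P = Q" using assms unfolding homogeneous_def by blast
  interpret walker_isometry \<sigma> E K FD \<phi> by unfold_locales (rule \<phi>(1))
  show "affine_model_iso k (met FD) P (met FD) Q"
    using model_iso_imp_affine[OF isometry_model_iso] \<phi>(2) by blast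
qed

end


section \<open>Constructing model isomorphisms and isometries\<close>

lemma zero_derivative_const:
  fixes f :: "'a::euclidean_space \<Rightarrow> 'b::real_normed_vector"
  assumes "\<And>x. (f has_derivative (\<lambda>h. 0)) (at x)"
  shows "f x = f y"
  using has_derivative_zero_constant[of UNIV f] assms by force

lemma linear_bij_inv:
  assumes "linear f" "bij f"
  shows "linear (inv f)"
proof (rule linearI)
  note b = surj_f_inv_f[OF bij_is_surj[OF assms(2)]] inv_f_f[OF bij_is_inj[OF assms(2)]]
  show "inv f (x + y) = inv f x + inv f y" for x y
    by (metis b linear_add[OF assms(1)])
  show "inv f (c *\<^sub>R x) = c *\<^sub>R inv f x" for c x
    by (metis b linear_scale[OF assms(1)])
qed

context walker
begin

lemma FD_mod_K:
  assumes "list_all2 (\<lambda>u v. u - v \<in> K) us vs"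
  shows "FD us P = FD vs P"
proof -
  have "FD (as @ us) P = FD (as @ vs) P" for as
    using assms
  proof (induction us vs arbitrary: as rule: list_all2_induct)
    case Nil
    show ?case ..
  next
    case (Cons u us v vs)
    have "FD (as @ u # us) P = FD (as @ (v + (u - v)) # us) P" by simp
    also have "\<dots> = FD (as @ v # us) P + FD (as @ (u - v) # us) P"
      by (rule linear_add[OF FD_linear])
    also have "FD (as @ (u - v) # us) P = 0"
      by (rule FD_K[of "u - v"]) (use Cons.hyps in auto)
    also have "FD (as @ v # us) P = FD (as @ v # vs) P"
      using Cons.IH[of "as @ [v]"] by simp
    finally show ?case by simp
  qed
  from this[of "[]"] show ?thesis by simp
qed

lemma FD_shift_K:
  assumes "k \<in> K"
  shows "FD us (P + k) = FD us P"
proof -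
  have "((\<lambda>t. FD us (P + t *\<^sub>R k)) has_derivative (\<lambda>h. 0)) (at t)" for t :: real
  proof -
    have "((\<lambda>t. P + t *\<^sub>R k) has_derivative (\<lambda>h. h *\<^sub>R k)) (at t)"
      by (auto intro!: derivative_eq_intros)
    from has_derivative_compose[OF this FD_deriv[of us]] show ?thesis
      using FD_K[of k "k # us" "P + t *\<^sub>R k"] assms by simp
  qed
  from zero_derivative_const[OF this, of 1 0] show ?thesis by simp
qed

end

lemma (in null_frame) eta_preserving_bij:
  assumes "linear L" "\<And>u v. eta (L u) (L v) = eta u v"
  shows "bij L"
proof -
  have "inj L"
    using assms(2) eta_nondegenerate by (metis injI)
  then show ?thesis
    using linear_injective_imp_surjective[OF assms(1)] by (simp add: bij_def)
qed

text \<open>\<open>L\<close> handles the jets from order 2 on but not the value of \<open>F\<close>,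
  which enters the metric. A multiple of \<open>xf u\<close> along \<open>E\<close> repairs this,
  unnoticed by the derivatives of \<open>F\<close> since \<open>E\<close> lies in \<open>K\<close>.
  The factor \<open>a\<^sup>2\<close> stems from the two factors \<open>xf\<close> in every term of
  \<open>Rform\<close>.\<close>

lemma (in null_frame) model_isoI:
  assumes "walker \<sigma> E K FD" "walker \<sigma> E K FD'"
    and L: "linear L" "\<And>u v. eta (L u) (L v) = eta u v" "\<And>u. xf (L u) = a * xf u" "a \<noteq> 0"
    and jet: "\<And>us. 2 \<le> length us \<Longrightarrow> length us \<le> k + 2 \<Longrightarrow> a\<^sup>2 * FD' (map L us) Q = FD us P"
  shows "model_iso k (met FD) P (met FD') Q"
proof -
  interpret W: walker \<sigma> E K FD by fact
  interpret W': walker \<sigma> E K FD' by fact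
  \<comment> \<open>Adding \<open>(c * xf u) *\<^sub>R E\<close> changes \<open>eta\<close> by
    \<open>2 * a * c\<close> times the product of the \<open>xf\<close> values, which has to
    compensate the change of the values of \<open>F\<close>.\<close>
  define c where "c = (a\<^sup>2 * FD' [] Q - FD [] P) / a"
  define \<Phi> where "\<Phi> u = L u + (c * xf u) *\<^sub>R E" for u
  have x: "xf (\<Phi> u) = a * xf u" for u by (simp add: \<Phi>_def L(3))
  have m: "met FD' Q (\<Phi> u) (\<Phi> v) = met FD P u v" for u v
  proof -
    have "eta (\<Phi> u) (\<Phi> v) = eta u v + 2 * (a * c) * (xf u * xf v)"
      by (simp add: \<Phi>_def L(2,3) algebra_simps)
    also have "a * c = a\<^sup>2 * FD' [] Q - FD [] P" using L(4) by (simp add: c_def)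
    finally show ?thesis by (simp add: met_def x algebra_simps power2_eq_square)
  qed
  have lin: "linear \<Phi>"
    by (rule linearI) (simp_all add: \<Phi>_def linear_add[OF L(1)] linear_scale[OF L(1)] algebra_simps)
  have "inj \<Phi>"
  proof (rule injI, rule W.met_nondegenerate)
    fix u v w assume "\<Phi> u = \<Phi> v"
    then show "met FD P u w = met FD P v w" using m[of u w] m[of v w] by simp
  qed
  then have bij: "bij \<Phi>"
    using linear_injective_imp_surjective[OF lin] by (simp add: bij_def)
  have j: "a\<^sup>2 * FD' (map \<Phi> us) Q = FD us P" if "2 \<le> length us" "length us \<le> k + 2" for us
  proof -
    have "list_all2 (\<lambda>u v. u - v \<in> K) (map \<Phi> us) (map L us)"
      by (simp add: list_all2_conv_all_nth \<Phi>_def)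
    from W'.FD_mod_K[OF this, of Q] show ?thesis using jet[OF that] by (simp only:)
  qed
  have "nabla_curv_tensor (met FD') i Q (map \<Phi> vs) = nabla_curv_tensor (met FD) i P vs"
    if i: "i \<le> k" and "length vs = 4 + i" for i vs
  proof -
    have "length vs = i + 4" using that by simp
    then obtain us X Y Z W where vs: "vs = us @ [X, Y, Z, W]" "length us = i" by (rule split_last4)
    have l: "length (map \<Phi> us) = i" by (simp add: vs(2))
    have j': "a * (a * FD' (map \<Phi> us @ [\<Phi> A, \<Phi> B]) Q) = FD (us @ [A, B]) P" for A B
      using j[of "us @ [A, B]"] i vs(2) by (simp add: power2_eq_square mult.assoc)
    show ?thesis
      unfolding vs(1) map_append list.map W'.nabla_curv_tensor_met[OF l] W.nabla_curv_tensor_met[OF vs(2)]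
      unfolding Rform_def x j'[symmetric] by (simp add: algebra_simps)
  qed
  then show ?thesis
    unfolding model_iso_def by (intro exI[of _ \<Phi>] conjI lin bij allI m impI)
qed

context walker
begin

text \<open>
  The change of \<open>x\<^sup>*\<close> and of the other starred coordinates that turns \<open>F\<close> into \<open>F - l - c\<close>.
\<close>

definition shear :: "('a \<Rightarrow> real) \<Rightarrow> real \<Rightarrow> 'a \<Rightarrow> 'a" where
  "shear l c P = P + ((l P + c) * xf P) *\<^sub>R E - ((xf P)\<^sup>2 / 2) *\<^sub>R sharp l"

lemma shear_inverse:
  assumes "linear l" "\<And>k. k \<in> K \<Longrightarrow> l k = 0"
  shows "shear (\<lambda>P. - l P) (- c) (shear l c P) = P"
proof -
  have w: "sharp l \<in> K" by (rule sharp_in_K[OF assms])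
  have n: "sharp (\<lambda>P. - l P) = - sharp l" by (simp add: sharp_def sum_negf)
  have "xf (shear l c P) = xf P" "l (shear l c P) = l P"
    using w by (simp_all add: shear_def linear_add[OF assms(1)] linear_diff[OF assms(1)]
        linear_scale[OF assms(1)] assms(2))
  then have "shear (\<lambda>P. - l P) (- c) (shear l c P)
      = shear l c P + ((- l P - c) * xf P) *\<^sub>R E - ((xf P)\<^sup>2 / 2) *\<^sub>R (- sharp l)"
    by (simp add: shear_def[of "\<lambda>P. - l P"] n)
  then show ?thesis by (simp add: shear_def algebra_simps)
qed

lemma smooth_shear: "linear l \<Longrightarrow> smooth (shear l c)"
  unfolding shear_def
  by (intro smooth_add smooth_diff smooth_scaleR smooth_const smooth_mult smooth_linear[OF linear_xf]
      smooth_linear smooth_power linear_id[unfolded id_def] smooth_divide_const)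

lemma has_derivative_shear:
  assumes "linear l"
  shows "(shear l c has_derivative
    (\<lambda>u. u + (l u * xf P + (l P + c) * xf u) *\<^sub>R E - (xf P * xf u) *\<^sub>R sharp l)) (at P)"
proof -
  have 1: "(l has_derivative l) (at P)" "(xf has_derivative xf) (at P)"
    using assms linear_xf by (simp_all add: linear_imp_has_derivative)
  show ?thesis
    unfolding shear_def
    by (rule has_derivative_eq_rhs, (rule derivative_intros 1)+) (auto simp: fun_eq_iff algebra_simps)
qed

text \<open>The isometry is \<open>shear\<close>, followed by \<open>L\<close> and the translation
  by \<open>b\<close>: the scaling of \<open>xf\<close> absorbs \<open>a\<^sup>2\<close>, the shear
  absorbs the affine discrepancy.\<close>

lemma ex_isometry:
  assumes L: "linear L" "\<And>u v. eta (L u) (L v) = eta u v" "\<And>u. xf (L u) = a * xf u"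
    and l: "linear l" "\<And>k. k \<in> K \<Longrightarrow> l k = 0"
    and F: "\<And>P. a\<^sup>2 * FD [] (L P + b) = FD [] P + l P + c"
  shows "\<exists>\<phi>. isometry (met FD) \<phi> \<and> \<phi> 0 = b"
proof -
  have w: "sharp l \<in> K" by (rule sharp_in_K[OF l])
  have l': "linear (\<lambda>P. - l P)" "\<And>k. k \<in> K \<Longrightarrow> - l k = 0"
    using l by (auto simp: linear_compose_neg)
  note bL = eta_preserving_bij[OF L(1,2)]
  have iL: "linear (inv L)" "\<And>x. inv L (L x) = x" "\<And>x. L (inv L x) = x"
    by (rule linear_bij_inv[OF L(1) bL], rule inv_f_f[OF bij_is_inj[OF bL]], rule surj_f_inv_f[OF bij_is_surj[OF bL]])
  define \<phi> where "\<phi> P = L (shear l c P) + b" for P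
  define \<psi> where "\<psi> P = shear (\<lambda>P. - l P) (- c) (inv L (P - b))" for P
  have \<psi>\<phi>: "\<psi> (\<phi> P) = P" for P
    unfolding \<phi>_def \<psi>_def by (simp add: iL shear_inverse[OF l])
  have \<phi>\<psi>: "\<phi> (\<psi> P) = P" for P
    using shear_inverse[OF l', of "- c" "inv L (P - b)"] unfolding \<phi>_def \<psi>_def by (simp add: iL)
  have inv: "inv \<phi> = \<psi>" by (rule inv_equality) (rule \<psi>\<phi> \<phi>\<psi>)+
  have der: "(\<phi> has_derivative (\<lambda>u. L (u + (l u * xf P + (l P + c) * xf u) *\<^sub>R E - (xf P * xf u) *\<^sub>R sharp l))) (at P)" for P
    unfolding \<phi>_def
    by (intro has_derivative_add_const bounded_linear.has_derivative[OF _ has_derivative_shear[OF l(1)]])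
      (use L(1) linear_conv_bounded_linear in blast)
  have "isometry (met FD) \<phi>"
    unfolding isometry_def inv
  proof (intro conjI allI)
    show "bij \<phi>" by (rule o_bij[of \<psi>]) (auto simp: fun_eq_iff \<psi>\<phi> \<phi>\<psi>)
    show "smooth \<phi>"
      unfolding \<phi>_def
      by (rule smooth_add[OF smooth_compose[OF smooth_shear[OF l(1)] smooth_linear[OF L(1)]] smooth_const])
    have "smooth (\<lambda>P. inv L (P - b))"
      by (rule smooth_compose[OF smooth_diff[OF smooth_linear smooth_const] smooth_linear[OF iL(1)]])
        (rule linear_id[unfolded id_def])
    then show "smooth \<psi>" unfolding \<psi>_def by (rule smooth_compose[OF _ smooth_shear[OF l'(1)]])
    fix P u v
    define k where "k u = (l u * xf P + (l P + c) * xf u) *\<^sub>R E - (xf P * xf u) *\<^sub>R sharp l" for u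
    have kK: "k u \<in> K" for u unfolding k_def using w by (intro K_closed) auto
    have D: "frechet_derivative \<phi> (at P) u = L (u + k u)" for u
      unfolding frechet_derivative_eq[OF der] k_def by (simp add: add_diff_eq)
    have shP: "shear l c P = P + (((l P + c) * xf P) *\<^sub>R E - ((xf P)\<^sup>2 / 2) *\<^sub>R sharp l)"
      by (simp add: shear_def)
    have kk: "((l P + c) * xf P) *\<^sub>R E - ((xf P)\<^sup>2 / 2) *\<^sub>R sharp l \<in> K"
      using w by (intro K_closed) auto
    have F': "a\<^sup>2 * FD [] (\<phi> P) = FD [] P + l P + c"
    proof -
      have "l (shear l c P) = l P" unfolding shP using linear_add[OF l(1)] l(2)[OF kk] by simp
      then show ?thesis unfolding \<phi>_def F using FD_shift_K[OF kk, of "[]" P] unfolding shP by simp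
    qed
    \<comment> \<open>The terms with \<open>l u * xf P\<close> along \<open>E\<close> cancel against
      those of \<open>sharp l\<close>; this dictates the coefficient
      \<open>(xf P)\<^sup>2 / 2\<close> in \<open>shear\<close>.\<close>
    have ek: "eta (k u) v + eta (k v) u = 2 * (l P + c) * (xf u * xf v)"
      by (simp add: k_def eta_sharp[OF l(1)] algebra_simps)
    have "eta (u + k u) (v + k v) = eta u v + 2 * (l P + c) * (xf u * xf v)"
      using ek eta_K[OF kK kK, of u v] by (simp add: eta_commute[of u "k v"])
    moreover have "2 * FD [] (\<phi> P) * (a * xf (u + k u) * (a * xf (v + k v))) = 2 * (FD [] P + l P + c) * (xf u * xf v)"
      unfolding F'[symmetric] using kK by (simp add: power2_eq_square)
    ultimately show "met FD (\<phi> P) (frechet_derivative \<phi> (at P) u) (frechet_derivative \<phi> (at P) v) = met FD P u v"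
      unfolding met_def D L(2,3) by (simp only:) (simp add: algebra_simps)
  qed
  moreover have "\<phi> 0 = b" by (simp add: \<phi>_def shear_def linear_0[OF L(1)])
  ultimately show ?thesis by blast
qed

lemma homogeneous_metI:
  assumes "\<And>b. \<exists>a L. linear L \<and> (\<forall>u v. eta (L u) (L v) = eta u v) \<and> (\<forall>u. xf (L u) = a * xf u) \<and>
      (\<forall>k\<in>K. L k \<in> K) \<and>
      (\<forall>us. 2 \<le> length us \<and> length us \<le> n \<longrightarrow> a\<^sup>2 * FD (map L us) b = FD us 0) \<and>
      (\<forall>us P. length us = n + 1 \<longrightarrow> a\<^sup>2 * FD (map L us) (L P + b) = FD us P)"
    and n: "n \<ge> 1"
  shows "homogeneous (met FD)"
proof (rule homogeneousI)
  fix b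
  obtain a L where L: "linear L" "\<And>u v. eta (L u) (L v) = eta u v" "\<And>u. xf (L u) = a * xf u"
    and LK: "\<And>k. k \<in> K \<Longrightarrow> L k \<in> K"
    and low: "\<And>us. 2 \<le> length us \<Longrightarrow> length us \<le> n \<Longrightarrow> a\<^sup>2 * FD (map L us) b = FD us 0"
    and top: "\<And>us P. length us = n + 1 \<Longrightarrow> a\<^sup>2 * FD (map L us) (L P + b) = FD us P"
    using assms(1)[of b] by blast
  define G where "G us P = a\<^sup>2 * FD (map L us) (L P + b) - FD us P" for us P
  have dL: "((\<lambda>P. L P + b) has_derivative L) (at P)" for P
    by (intro has_derivative_add_const linear_imp_has_derivative L(1))
  have dG: "(G us has_derivative (\<lambda>u. G (u # us) P)) (at P)" for us P
    unfolding G_def list.map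
    by (intro has_derivative_diff has_derivative_mult_right FD_deriv has_derivative_compose[OF dL FD_deriv])
  \<comment> \<open>Downwards from order \<open>n + 1\<close> to order 2, with \<open>m\<close>
    counting the distance from the top: a vanishing derivative makes \<open>G us\<close> constant,
    and \<open>low\<close> gives its value at the origin.\<close>
  have G0: "G us P = 0" if "2 \<le> length us" "length us + m = n + 1" for us P m
    using that
  proof (induction m arbitrary: us P)
    case 0
    then show ?case using top by (simp add: G_def)
  next
    case (Suc m)
    have "G (u # us) Q = 0" for u Q by (rule Suc.IH) (use Suc.prems in auto)
    then have "(G us has_derivative (\<lambda>u. 0)) (at Q)" for Q using dG[of us Q] by simp
    from zero_derivative_const[OF this, of P 0] show ?case
      using low[of us] Suc.prems by (simp add: G_def linear_0[OF L(1)])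
  qed
  define l where "l u = G [u] 0" for u
  have l: "G [u] P = l u" for u P
  proof -
    have "(G [u] has_derivative (\<lambda>v. 0)) (at Q)" for Q
      using dG[of "[u]" Q] G0[of "[v, u]" "n - 1" Q for v] n by simp
    from zero_derivative_const[OF this] show ?thesis by (simp add: l_def)
  qed
  have lin: "linear l"
    unfolding l_def by (rule has_derivative_linear[OF dG])
  have lK: "l k = 0" if "k \<in> K" for k
    using that LK by (simp add: l_def G_def FD_K)
  have "((\<lambda>P. G [] P - l P) has_derivative (\<lambda>v. 0)) (at Q)" for Q
    by (rule has_derivative_eq_rhs[OF has_derivative_diff[OF dG linear_imp_has_derivative[OF lin]]]) (simp add: l)
  then have "G [] P - l P = G [] 0 - l 0" for P by (rule zero_derivative_const)
  then have G1: "G [] P = l P + G [] 0" for P by (metis diff_zero diff_eq_eq linear_0[OF lin] add.commute)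
  have "a\<^sup>2 * FD [] (L P + b) = FD [] P + l P + G [] 0" for P
    using G1[of P] unfolding G_def[of _ P] list.map by linarith
  from ex_isometry[OF L lin lK this] show "\<exists>\<phi>. isometry (met FD) \<phi> \<and> \<phi> 0 = b" .
qed

lemma isometry_uminus:
  assumes "\<And>P. FD [] (- P) = FD [] P"
  shows "isometry (met FD) uminus"
  unfolding isometry_def
proof (intro conjI allI)
  have s: "smooth (uminus :: 'a \<Rightarrow> 'a)"
    by (rule smooth_linear, rule linearI) simp_all
  have "inv uminus = (uminus :: 'a \<Rightarrow> 'a)" by (rule inv_equality) simp_all
  with s show "smooth (inv uminus :: 'a \<Rightarrow> 'a)" by (simp only:)
  show "smooth (uminus :: 'a \<Rightarrow> 'a)" by (rule s)
  show "bij (uminus :: 'a \<Rightarrow> 'a)" using bij_uminus .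
  fix P u v :: 'a
  have d: "frechet_derivative uminus (at P) w = - w" for w
    by (rule frechet_derivative_eq, rule has_derivative_minus, rule has_derivative_ident)
  show "met FD (- P) (frechet_derivative uminus (at P) u) (frechet_derivative uminus (at P) v) = met FD P u v"
    unfolding d met_def assms by simp
qed

end


section \<open>Holonomy of the symmetric space\<close>

text \<open>\<open>F\<close> is quadratic, and \<open>J\<close> is its \<open>eta\<close>-gradient.
  \<open>J_nondegenerate\<close> says that on the hyperplane \<open>xf = 0\<close> the Hessian has
  no kernel beyond \<open>K\<close>; \<open>K_small\<close> says that this hyperplane is larger than
  \<open>K\<close>.\<close>

locale quadratic_walker = walker +
  fixes J :: "'a \<Rightarrow> 'a" and e :: 'a
  assumes linear_J: "linear J"
    and FD1_J: "FD [w] P = eta (J P) w"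
    and xf_e: "xf e = 1"
    and J_e: "J e = 0"
    and J_nondegenerate: "xf u = 0 \<Longrightarrow> (\<And>\<zeta>. xf \<zeta> = 0 \<Longrightarrow> eta (J \<zeta>) u = 0) \<Longrightarrow> u \<in> K"
    and K_small: "\<exists>u. xf u = 0 \<and> u \<notin> K"
begin

lemma sharp_FD1: "sharp (\<lambda>w. FD [w] P) = J P"
  by (rule eta_nondegenerate) (simp add: FD1_J eta_sharp[OF linear_eta(1)])

lemma J_in_K: "J P \<in> K"
  using grad_in_K[of P] unfolding sharp_FD1 .

text \<open>
  The parallel transport along these loops is a polynomial in \<open>t\<close>; the integral of
  \<open>(t\<^sup>2 - t\<^sup>3) d(t - t\<^sup>2)\<close> over \<open>[0, 1]\<close> is \<open>-1/60\<close>.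
\<close>

definition loop :: "'a \<Rightarrow> 'a \<Rightarrow> real \<Rightarrow> 'a" where
  "loop P \<zeta> t = P + (t - t\<^sup>2) *\<^sub>R e + (t\<^sup>2 - t ^ 3) *\<^sub>R \<zeta>"

text \<open>The polynomial of degree 5 is the primitive of
  \<open>(t\<^sup>2 - t ^ 3) * (1 - 2 * t)\<close>, the current multiple of \<open>\<zeta>\<close>
  times the velocity along \<open>e\<close>. The \<open>E\<close> component integrates the second
  summand of \<open>chr\<close>.\<close>

definition transport :: "'a \<Rightarrow> 'a \<Rightarrow> 'a \<Rightarrow> real \<Rightarrow> 'a" where
  "transport P \<zeta> v t = v
     - xf v *\<^sub>R ((t - t\<^sup>2) *\<^sub>R J P + (t ^ 3 / 3 - 3 * t ^ 4 / 4 + 2 * t ^ 5 / 5) *\<^sub>R J \<zeta>)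
     + (xf v * (FD [] (loop P \<zeta> t) - FD [] P) + (t - t\<^sup>2) * eta (J P) v
        + (t ^ 3 / 3 - 3 * t ^ 4 / 4 + 2 * t ^ 5 / 5) * eta (J \<zeta>) v) *\<^sub>R E"

lemma loop_derivative:
  "(loop P \<zeta> has_vector_derivative (1 - 2 * t) *\<^sub>R e + (2 * t - 3 * t\<^sup>2) *\<^sub>R \<zeta>) (at t)"
  unfolding loop_def
  by (rule derivative_eq_intros refl | simp)+

lemma smooth_loop: "smooth (loop P \<zeta>)"
  unfolding loop_def
  by (intro smooth_add smooth_diff smooth_scaleR smooth_const smooth_power smooth_linear linear_id[unfolded id_def])

lemma transport_derivative:
  assumes \<zeta>: "xf \<zeta> = 0"
  shows "(transport P \<zeta> v has_vector_derivative
    - chr FD (loop P \<zeta> t) ((1 - 2 * t) *\<^sub>R e + (2 * t - 3 * t\<^sup>2) *\<^sub>R \<zeta>) (transport P \<zeta> v t)) (at t)"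
proof -
  let ?w = "(1 - 2 * t) *\<^sub>R e + (2 * t - 3 * t\<^sup>2) *\<^sub>R \<zeta>"
  define s' where "s' = t\<^sup>2 - 3 * t ^ 3 + 2 * t ^ 4"
  have F: "((\<lambda>t. FD [] (loop P \<zeta> t)) has_real_derivative FD [?w] (loop P \<zeta> t)) (at t)"
  proof -
    have "((\<lambda>t. FD [] (loop P \<zeta> t)) has_derivative (\<lambda>h. FD [h *\<^sub>R ?w] (loop P \<zeta> t))) (at t)"
      by (rule has_derivative_compose[OF loop_derivative[unfolded has_vector_derivative_def] FD_deriv])
    then show ?thesis
      by (rule has_derivative_imp_has_field_derivative) (simp only: FD1_simps mult.commute)
  qed
  have s: "((\<lambda>t. t ^ 3 / 3 - 3 * t ^ 4 / 4 + 2 * t ^ 5 / 5) has_real_derivative s') (at t)"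
    unfolding s'_def by (rule derivative_eq_intros refl | simp)+
  have x: "((\<lambda>t. t - t\<^sup>2) has_real_derivative (1 - 2 * t)) (at t)"
    by (rule derivative_eq_intros refl | simp)+
  have "((\<lambda>t. transport P \<zeta> v t) has_vector_derivative
      - (xf v *\<^sub>R ((1 - 2 * t) *\<^sub>R J P + s' *\<^sub>R J \<zeta>))
      + (xf v * FD [?w] (loop P \<zeta> t) + (1 - 2 * t) * eta (J P) v + s' * eta (J \<zeta>) v) *\<^sub>R E) (at t)"
    unfolding transport_def
    by (rule derivative_eq_intros refl F s x | simp)+
  moreover have "- chr FD (loop P \<zeta> t) ?w (transport P \<zeta> v t) =
      - (xf v *\<^sub>R ((1 - 2 * t) *\<^sub>R J P + s' *\<^sub>R J \<zeta>))
      + (xf v * FD [?w] (loop P \<zeta> t) + (1 - 2 * t) * eta (J P) v + s' * eta (J \<zeta>) v) *\<^sub>R E"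
  proof -
    \<comment> \<open>Transport moves \<open>v\<close> only inside \<open>K\<close>, which
      \<open>chr\<close> ignores; hence \<open>chr\<close> may be evaluated at \<open>v\<close>, and
      the equation reduces to an integration.\<close>
    have K: "transport P \<zeta> v t - v \<in> K"
      unfolding transport_def using J_in_K by (simp add: algebra_simps)
    have xV: "xf (transport P \<zeta> v t) = xf v" using xf_K[OF K] by simp
    have V: "FD [transport P \<zeta> v t] (loop P \<zeta> t) = FD [v] (loop P \<zeta> t)"
      using FD_K[OF _ K, of "[transport P \<zeta> v t - v]"] by simp
    have Jl: "J (loop P \<zeta> t) = J P + (t\<^sup>2 - t ^ 3) *\<^sub>R J \<zeta>"
      by (simp add: loop_def linear_add[OF linear_J] linear_scale[OF linear_J] J_e)
    have xw: "xf ?w = 1 - 2 * t" by (simp add: xf_e \<zeta>)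
    have s': "s' = (1 - 2 * t) * (t\<^sup>2 - t ^ 3)" by (simp add: s'_def algebra_simps power_numeral_reduce)
    have v1: "FD [v] (loop P \<zeta> t) = eta (J P) v + (t\<^sup>2 - t ^ 3) * eta (J \<zeta>) v"
      by (simp add: FD1_J Jl)
    show ?thesis
      unfolding chr_def V xV xw sharp_FD1 Jl s' v1 by (simp add: algebra_simps)
  qed
  ultimately show ?thesis by simp
qed

lemma holonomy_group_element:
  assumes \<zeta>: "xf \<zeta> = 0"
  shows "(\<lambda>v. v + xf v *\<^sub>R J \<zeta> - eta (J \<zeta>) v *\<^sub>R E) \<in> holonomy_group (met FD) P"
proof -
  \<comment> \<open>The factor 60 undoes the integral \<open>-1/60\<close> and, by its sign,
    produces \<open>+ xf v *\<^sub>R J \<zeta>\<close>.\<close>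
  define \<xi> where "\<xi> = 60 *\<^sub>R \<zeta>"
  have \<xi>: "xf \<xi> = 0" by (simp add: \<xi>_def \<zeta>)
  have "piecewise_smooth_curve (loop P \<xi>)"
    unfolding piecewise_smooth_curve_def
    by (intro exI[of _ 1] exI[of _ real]) (use smooth_loop in auto)
  moreover have "loop P \<xi> 0 = P" "loop P \<xi> 1 = P" by (simp_all add: loop_def)
  moreover have "parallel_along (met FD) (loop P \<xi>) (transport P \<xi> v)" for v
    unfolding parallel_along_def levi_civita_met
  proof (intro conjI exI[of _ "{}"] ballI finite.emptyI)
    show "continuous_on {0..1} (transport P \<xi> v)"
      using transport_derivative[OF \<xi>] by (meson continuous_at_imp_continuous_on has_vector_derivative_continuous)
    show "(transport P \<xi> v has_vector_derivative
        - chr FD (loop P \<xi> t) (vector_derivative (loop P \<xi>) (at t)) (transport P \<xi> v t)) (at t)" for t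
      unfolding vector_derivative_at[OF loop_derivative] by (rule transport_derivative[OF \<xi>])
  qed
  moreover have "transport P \<xi> v 0 = v" for v by (simp add: transport_def loop_def)
  moreover have "transport P \<xi> v 1 = v + xf v *\<^sub>R J \<zeta> - eta (J \<zeta>) v *\<^sub>R E" for v
    by (simp add: transport_def loop_def \<xi>_def linear_scale[OF linear_J])
  ultimately show ?thesis unfolding holonomy_group_def by blast
qed

text \<open>
  The holonomy moves a vector \<open>v\<close> of one summand by \<open>xf v *\<^sub>R J \<zeta>\<close> modulo \<open>E\<close>, and this difference
  is orthogonal to the other summand.
\<close>

lemma invariant_orthogonal:
  assumes "subspace V" "holonomy_invariant (met FD) P V" "v \<in> V" "\<And>v. v \<in> V \<Longrightarrow> met FD P v w = 0"
  shows "xf v *\<^sub>R w - xf w *\<^sub>R v \<in> K"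
proof (rule J_nondegenerate)
  show "xf (xf v *\<^sub>R w - xf w *\<^sub>R v) = 0" by simp
  fix \<zeta> assume \<zeta>: "xf \<zeta> = 0"
  let ?d = "xf v *\<^sub>R J \<zeta> - eta (J \<zeta>) v *\<^sub>R E"
  have "(\<lambda>v. v + xf v *\<^sub>R J \<zeta> - eta (J \<zeta>) v *\<^sub>R E) ` V \<subseteq> V"
    using assms(2) holonomy_group_element[OF \<zeta>] unfolding holonomy_invariant_def by (rule bspec)
  then have "v + xf v *\<^sub>R J \<zeta> - eta (J \<zeta>) v *\<^sub>R E \<in> V" using imageI[OF assms(3)] by (rule subsetD)
  then have "(v + xf v *\<^sub>R J \<zeta> - eta (J \<zeta>) v *\<^sub>R E) - v \<in> V" by (rule subspace_diff[OF assms(1) _ assms(3)])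
  then have "?d \<in> V" by (simp add: algebra_simps)
  then have "met FD P ?d w = 0" by (rule assms(4))
  then show "eta (J \<zeta>) (xf v *\<^sub>R w - xf w *\<^sub>R v) = 0"
    by (simp add: met_def J_in_K algebra_simps)
qed

lemma scaleR_K_iff: "c \<noteq> 0 \<Longrightarrow> c *\<^sub>R x \<in> K \<longleftrightarrow> x \<in> K"
  using K_closed(4)[of "c *\<^sub>R x" "1 / c"] by auto

text \<open>If \<open>W\<close> also contains a vector with non-zero \<open>xf\<close>, then
  \<open>V\<close> and \<open>W\<close> both lie in the span of \<open>v\<close> and
  \<open>K\<close>, so the hyperplane \<open>xf = 0\<close> would be contained in \<open>K\<close>.
  Otherwise \<open>W\<close> lies in \<open>K\<close>, is orthogonal to itself and to
  \<open>V\<close>, and so is zero.\<close>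

lemma no_invariant_splitting:
  assumes V: "subspace V" "holonomy_invariant (met FD) P V"
    and W: "subspace W" "holonomy_invariant (met FD) P W" "W \<noteq> {0}"
    and span: "{v + w |v w. v \<in> V \<and> w \<in> W} = UNIV"
    and orth: "\<And>v w. v \<in> V \<Longrightarrow> w \<in> W \<Longrightarrow> met FD P v w = 0"
    and v: "v \<in> V" "xf v \<noteq> 0"
  shows False
proof (cases "\<exists>w\<in>W. xf w \<noteq> 0")
  case True
  then obtain w where w: "w \<in> W" "xf w \<noteq> 0" by blast
  have VK: "xf y *\<^sub>R x - xf x *\<^sub>R y \<in> K" "xf x *\<^sub>R y - xf y *\<^sub>R x \<in> K" if xy: "x \<in> V" "y \<in> W" for x y
  proof -
    show "xf y *\<^sub>R x - xf x *\<^sub>R y \<in> K"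
      by (rule invariant_orthogonal[OF W(1,2) xy(2)]) (metis met_commute orth xy(1))
    show "xf x *\<^sub>R y - xf y *\<^sub>R x \<in> K"
      by (rule invariant_orthogonal[OF V xy(1)]) (rule orth[OF _ xy(2)])
  qed
  obtain u where u: "xf u = 0" "u \<notin> K" using K_small by blast
  obtain v' w' where u': "u = v' + w'" "v' \<in> V" "w' \<in> W" using span by blast
  have "(xf w * xf v) *\<^sub>R u = xf v *\<^sub>R (xf w *\<^sub>R v' - xf v' *\<^sub>R w) + xf w *\<^sub>R (xf v *\<^sub>R w' - xf w' *\<^sub>R v)
      + xf v' *\<^sub>R (xf v *\<^sub>R w - xf w *\<^sub>R v)"
  proof -
    have "xf w' = - xf v'" using u(1) u'(1) by simp
    then show ?thesis by (simp add: u'(1) algebra_simps)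
  qed
  moreover have "\<dots> \<in> K"
    by (intro K_closed VK u' v w)
  ultimately have "u \<in> K" using scaleR_K_iff w(2) v(2) by (metis mult_eq_0_iff)
  then show False using u(2) by blast
next
  case False
  have WK: "w \<in> K" if "w \<in> W" for w
  proof -
    have "xf v *\<^sub>R w - xf w *\<^sub>R v \<in> K"
      by (rule invariant_orthogonal[OF V v(1)]) (rule orth[OF _ that])
    then show ?thesis using False that scaleR_K_iff[OF v(2)] by simp
  qed
  obtain w where w: "w \<in> W" "w \<noteq> 0" using W(1,3) subspace_0 by blast
  have "w = 0"
  proof (rule met_nondegenerate)
    fix u
    obtain v' w' where u': "u = v' + w'" "v' \<in> V" "w' \<in> W" using span by blast
    have "met FD P w w' = 0"
      using WK[OF w(1)] WK[OF u'(3)] by (simp add: met_def eta_K)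
    then show "met FD P w u = met FD P 0 u"
      using orth[OF u'(2) w(1)] by (simp add: u'(1) met_commute[of P w v'])
  qed
  then show False using w(2) by blast
qed

lemma indecomposable_met: "indecomposable (met FD)"
  unfolding indecomposable_def
proof (intro allI notI)
  fix P
  assume "\<exists>V W. subspace V \<and> subspace W \<and> V \<noteq> {0} \<and> W \<noteq> {0} \<and>
        V \<inter> W = {0} \<and> {v + w |v w. v \<in> V \<and> w \<in> W} = UNIV \<and>
        (\<forall>v\<in>V. \<forall>w\<in>W. met FD P v w = 0) \<and>
        holonomy_invariant (met FD) P V \<and> holonomy_invariant (met FD) P W"
  then obtain V W where VW: "subspace V" "subspace W" "V \<noteq> {0}" "W \<noteq> {0}"
    "{v + w |v w. v \<in> V \<and> w \<in> W} = UNIV" "\<And>v w. v \<in> V \<Longrightarrow> w \<in> W \<Longrightarrow> met FD P v w = 0"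
    "holonomy_invariant (met FD) P V" "holonomy_invariant (met FD) P W" by blast
  have sym: "{v + w |v w. v \<in> W \<and> w \<in> V} = UNIV"
    unfolding VW(5)[symmetric] by (auto, metis add.commute, metis add.commute)
  obtain v w where e: "e = v + w" "v \<in> V" "w \<in> W" using VW(5) by blast
  then have "xf v \<noteq> 0 \<or> xf w \<noteq> 0" using xf_e by (metis add_0 xf_simps(1) zero_neq_one)
  then show False
  proof
    assume "xf v \<noteq> 0"
    then show False
      using no_invariant_splitting[OF VW(1,7,2,8,4,5) _ e(2)] VW(6) by blast
  next
    assume "xf w \<noteq> 0"
    then show False
      using no_invariant_splitting[OF VW(2,8,1,7,3) sym _ e(3)] VW(6) by (metis met_commute)
  qed
qed

end


section \<open>Coordinates\<close>

lemma sum_coord: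
  fixes f :: "'i::finite coord \<Rightarrow> 'b::comm_monoid_add"
  shows "(\<Sum>c\<in>UNIV. f c) = f Cx + f Cxs + ((\<Sum>i\<in>UNIV. f (Cz i)) + (\<Sum>i\<in>UNIV. f (Czt i)))
    + ((\<Sum>i\<in>UNIV. f (Czs i)) + (\<Sum>i\<in>UNIV. f (Czts i)))"
proof -
  have r: "sum f (range h) = (\<Sum>i\<in>UNIV. f (h i))" if "inj h" for h :: "'i \<Rightarrow> 'i coord"
    using sum.reindex[OF that, of f] by simp
  have i: "inj Cz" "inj Czt" "inj Czs" "inj Czts" by (auto intro: injI)
  have 1: "sum f (range Cz \<union> range Czt) = (\<Sum>i\<in>UNIV. f (Cz i)) + (\<Sum>i\<in>UNIV. f (Czt i))"
    by (subst sum.union_disjoint) (auto simp: r i)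
  have 2: "sum f (range Czs \<union> range Czts) = (\<Sum>i\<in>UNIV. f (Czs i)) + (\<Sum>i\<in>UNIV. f (Czts i))"
    by (subst sum.union_disjoint) (auto simp: r i)
  have 3: "sum f {Cx, Cxs} = f Cx + f Cxs" by simp
  have "sum f ({Cx, Cxs} \<union> (range Cz \<union> range Czt)) = sum f {Cx, Cxs} + sum f (range Cz \<union> range Czt)"
    by (rule sum.union_disjoint) auto
  moreover have "sum f ({Cx, Cxs} \<union> (range Cz \<union> range Czt) \<union> (range Czs \<union> range Czts))
      = sum f ({Cx, Cxs} \<union> (range Cz \<union> range Czt)) + sum f (range Czs \<union> range Czts)"
    by (rule sum.union_disjoint) auto
  ultimately show ?thesis unfolding UNIV_coord by (simp only: 1 2 3)
qed

definition zc :: "real ^ 'i coord \<Rightarrow> real ^ 'i::finite" where "zc P = (\<chi> i. P $ Cz i)"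
definition ztc :: "real ^ 'i coord \<Rightarrow> real ^ 'i::finite" where "ztc P = (\<chi> i. P $ Czt i)"
definition zsc :: "real ^ 'i coord \<Rightarrow> real ^ 'i::finite" where "zsc P = (\<chi> i. P $ Czs i)"
definition ztsc :: "real ^ 'i coord \<Rightarrow> real ^ 'i::finite" where "ztsc P = (\<chi> i. P $ Czts i)"

definition point :: "real \<Rightarrow> real ^ 'i \<Rightarrow> real ^ 'i \<Rightarrow> real \<Rightarrow> real ^ 'i \<Rightarrow> real ^ 'i \<Rightarrow> real ^ 'i::finite coord" where
  "point x z w xs zs ws = (\<chi> c. case c of Cx \<Rightarrow> x | Cz i \<Rightarrow> z $ i | Czt i \<Rightarrow> w $ i | Cxs \<Rightarrow> xs
      | Czs i \<Rightarrow> zs $ i | Czts i \<Rightarrow> ws $ i)"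

lemma point_simps [simp]:
  "point x z w xs zs ws $ Cx = x" "point x z w xs zs ws $ Cxs = xs"
  "zc (point x z w xs zs ws) = z" "ztc (point x z w xs zs ws) = w"
  "zsc (point x z w xs zs ws) = zs" "ztsc (point x z w xs zs ws) = ws"
  by (simp_all add: point_def zc_def ztc_def zsc_def ztsc_def vec_eq_iff)

lemma blocks_linear [simp]:
  "zc (u + v) = zc u + zc v" "ztc (u + v) = ztc u + ztc v" "zsc (u + v) = zsc u + zsc v" "ztsc (u + v) = ztsc u + ztsc v"
  "zc (c *\<^sub>R u) = c *\<^sub>R zc u" "ztc (c *\<^sub>R u) = c *\<^sub>R ztc u" "zsc (c *\<^sub>R u) = c *\<^sub>R zsc u" "ztsc (c *\<^sub>R u) = c *\<^sub>R ztsc u"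
  "zc 0 = 0" "ztc 0 = 0" "zsc 0 = 0" "ztsc 0 = 0"
  "zc (- u) = - zc u" "ztc (- u) = - ztc u"
  by (simp_all add: zc_def ztc_def zsc_def ztsc_def vec_eq_iff)

lemma coord_eq_iff:
  "P = Q \<longleftrightarrow> P $ Cx = Q $ Cx \<and> zc P = zc Q \<and> ztc P = ztc Q \<and> P $ Cxs = Q $ Cxs \<and> zsc P = zsc Q \<and> ztsc P = ztsc Q"
proof
  assume *: "P $ Cx = Q $ Cx \<and> zc P = zc Q \<and> ztc P = ztc Q \<and> P $ Cxs = Q $ Cxs \<and> zsc P = zsc Q \<and> ztsc P = ztsc Q"
  have "P $ c = Q $ c" for c
    using * by (cases c) (auto simp: zc_def ztc_def zsc_def ztsc_def vec_eq_iff)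
  then show "P = Q" by (simp add: vec_eq_iff)
qed simp

definition swap :: "real ^ 'i coord \<Rightarrow> real ^ 'i::finite coord" where
  "swap P = point (P $ Cxs) (zsc P) (ztsc P) (P $ Cx) (zc P) (ztc P)"

definition E0 :: "real ^ 'i::finite coord" where "E0 = point 0 0 0 1 0 0"

definition K0 :: "(real ^ 'i::finite coord) set" where "K0 = {P. P $ Cx = 0 \<and> zc P = 0 \<and> ztc P = 0}"

lemma inner_coord:
  "P \<bullet> Q = P $ Cx * Q $ Cx + P $ Cxs * Q $ Cxs + (zc P \<bullet> zc Q + ztc P \<bullet> ztc Q) + (zsc P \<bullet> zsc Q + ztsc P \<bullet> ztsc Q)"
  by (simp add: inner_vec_def sum_coord zc_def ztc_def zsc_def ztsc_def)

lemma inner_swap: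
  "u \<bullet> swap v = u $ Cx * v $ Cxs + u $ Cxs * v $ Cx + (zc u \<bullet> zsc v + ztc u \<bullet> ztsc v) + (zsc u \<bullet> zc v + ztsc u \<bullet> ztc v)"
  by (simp add: inner_coord swap_def)

interpretation nf: null_frame "swap :: real ^ 'i::finite coord \<Rightarrow> _" E0 K0
proof (rule null_frame.intro)
  show "linear (swap :: real ^ 'i coord \<Rightarrow> _)"
    by (rule linearI) (simp_all add: swap_def coord_eq_iff)
  fix u v :: "real ^ 'i coord"
  show "swap (swap u) = u" by (simp add: swap_def coord_eq_iff)
  show "swap u \<bullet> v = u \<bullet> swap v"
    by (subst inner_commute) (simp add: inner_swap inner_commute[of "zsc v"] inner_commute[of "ztsc v"]
        inner_commute[of "zc v"] inner_commute[of "ztc v"])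
  show "(E0 :: real ^ 'i coord) \<in> K0" by (simp add: E0_def K0_def)
  show "u \<in> K0 \<longleftrightarrow> (\<forall>v\<in>K0. u \<bullet> swap v = 0)"
  proof
    assume "\<forall>v\<in>K0. u \<bullet> swap v = 0"
    \<comment> \<open>Pairing with the vector of \<open>K0\<close> whose starred coordinates copy
      the unstarred ones of \<open>u\<close> gives a sum of squares.\<close>
    then have *: "u \<bullet> swap (point 0 0 0 (u $ Cx) (zc u) (ztc u)) = 0" by (simp add: K0_def)
    have "u $ Cx * u $ Cx + (zc u \<bullet> zc u + ztc u \<bullet> ztc u) = 0"
      using * by (simp add: inner_swap)
    moreover have "u $ Cx * u $ Cx \<ge> 0" "zc u \<bullet> zc u \<ge> 0" "ztc u \<bullet> ztc u \<ge> 0" by simp_all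
    ultimately have "u $ Cx * u $ Cx = 0" "zc u \<bullet> zc u = 0" "ztc u \<bullet> ztc u = 0" by linarith+
    then show "u \<in> K0" by (simp add: K0_def)
  qed (auto simp: K0_def inner_swap)
qed

lemma eta_coord:
  "nf.eta u v = u $ Cx * v $ Cxs + u $ Cxs * v $ Cx + (zc u \<bullet> zsc v + ztc u \<bullet> ztsc v) + (zsc u \<bullet> zc v + ztsc u \<bullet> ztc v)"
  by (simp add: nf.eta_def inner_swap)

lemma xf_coord: "nf.xf u = u $ Cx"
  unfolding nf.xf_def eta_coord by (simp add: E0_def)

text \<open>The freedom available for matching jets: \<open>M\<close> acts at will on the
  \<open>z\<close> block, and the \<open>z~\<close> block provides any symmetric correction
  \<open>S\<close> of the Hessian, without disturbing \<open>eta\<close>.\<close>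

lemma ex_frame_map:
  fixes M :: "real ^ 'i::finite \<Rightarrow> real ^ 'i"
  assumes M: "linear M" "bij M" and a: "a \<noteq> 0"
    and S: "bilinear S" "\<And>y z. S y z = S z y"
  shows "\<exists>L. linear L \<and> (\<forall>u v. nf.eta (L u) (L v) = nf.eta u v) \<and> (\<forall>u. nf.xf (L u) = a * nf.xf u) \<and>
    (\<forall>u\<in>K0. L u \<in> K0) \<and> (\<forall>u. zc (L u) = M (zc u)) \<and>
    (\<forall>u v. a\<^sup>2 * (zc (L u) \<bullet> ztc (L v) + zc (L v) \<bullet> ztc (L u))
      = zc u \<bullet> ztc v + zc v \<bullet> ztc u + S (zc u) (zc v))"
proof -
  define N where "N = adjoint (inv M)"
  define T where "T z = (\<Sum>b\<in>Basis. (S b z / 2) *\<^sub>R b)" for z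
  have lS: "linear (S b)" for b using S(1) by (simp add: bilinear_def)
  have lN: "linear N" unfolding N_def by (rule adjoint_linear[OF linear_bij_inv[OF M]])
  have MN: "M y \<bullet> N x = y \<bullet> x" for x y
    unfolding N_def using adjoint_works[OF linear_bij_inv[OF M], of "M y" x]
    by (simp add: inv_f_f[OF bij_is_inj[OF M(2)]])
  then have NM: "N x \<bullet> M y = x \<bullet> y" for x y by (metis inner_commute)
  have lT: "linear T"
    by (rule linearI) (simp_all add: T_def linear_add[OF lS] linear_scale[OF lS] add_divide_distrib
        scaleR_add_left sum.distrib scaleR_sum_right)
  have yT: "y \<bullet> T z = S y z / 2" for y z
  proof -
    have l: "linear (\<lambda>y. S y z)" using S(1) by (simp add: bilinear_def)
    have "y \<bullet> T z = (\<Sum>b\<in>Basis. (y \<bullet> b) * S b z) / 2"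
      by (simp add: T_def inner_sum_right sum_divide_distrib mult.commute)
    also have "(\<Sum>b\<in>Basis. (y \<bullet> b) * S b z) = S (\<Sum>b\<in>Basis. (y \<bullet> b) *\<^sub>R b) z"
      by (simp add: linear_sum[OF l] linear_scale[OF l])
    finally show ?thesis by (simp add: euclidean_representation)
  qed
  have Ty: "T y \<bullet> z = S y z / 2" for y z using yT[of z y] S(2) by (metis inner_commute)
  \<comment> \<open>\<open>N\<close> is the inverse transpose of \<open>M\<close>, and each of the
    two mixed products contributes half of \<open>S\<close> through \<open>T\<close>. The starred
    blocks transform by the inverse transpose of the unstarred ones, as preservation of
    \<open>eta\<close> demands.\<close>
  define L where "L u = point (a * u $ Cx) (M (zc u)) ((1 / a\<^sup>2) *\<^sub>R N (T (zc u) + ztc u)) (u $ Cxs / a)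
      (N (zsc u - T (ztsc u))) (a\<^sup>2 *\<^sub>R M (ztsc u))" for u
  note lins = linear_add[OF M(1)] linear_add[OF lN] linear_add[OF lT] linear_scale[OF M(1)] linear_scale[OF lN]
    linear_scale[OF lT] linear_0[OF M(1)] linear_0[OF lN] linear_0[OF lT] linear_diff[OF lN]
  have 1: "linear L"
    by (rule linearI) (simp_all add: L_def coord_eq_iff lins algebra_simps add_divide_distrib)
  have 2: "nf.eta (L u) (L v) = nf.eta u v" for u v
    using a by (simp add: eta_coord L_def MN NM inner_add_left inner_add_right inner_diff_left inner_diff_right yT Ty S(2)[of "ztsc u"] S(2)[of "ztsc v"])
  have 3: "nf.xf (L u) = a * nf.xf u" for u by (simp add: xf_coord L_def)
  have 4: "L u \<in> K0" if "u \<in> K0" for u using that by (simp add: K0_def L_def lins)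
  have 5: "a\<^sup>2 * (zc (L u) \<bullet> ztc (L v) + zc (L v) \<bullet> ztc (L u))
      = zc u \<bullet> ztc v + zc v \<bullet> ztc u + S (zc u) (zc v)" for u v
    using a by (simp add: L_def MN inner_add_right yT S(2)[of "zc v"] distrib_left)
  have 6: "zc (L u) = M (zc u)" for u by (simp add: L_def)
  show ?thesis by (intro exI[of _ L] conjI allI ballI 1 2 3 4 5 6)
qed

text \<open>
  The \<open>n\<close>-th derivative of \<open>t\<^sup>e\<close>; the exponent \<open>e - n\<close> is truncated only when the binomial coefficient is \<open>0\<close>.
\<close>

definition pw :: "nat \<Rightarrow> nat \<Rightarrow> real \<Rightarrow> real" where
  "pw e n t = fact n * real (e choose n) * t ^ (e - n)"

lemma pw_deriv: "(pw e n has_real_derivative pw e (Suc n) t) (at t)"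
proof -
  have "(pw e n has_real_derivative fact n * real (e choose n) * (real (e - n) * t ^ (e - n - 1))) (at t)"
    unfolding pw_def by (rule derivative_eq_intros refl | simp)+
  moreover have "fact n * real (e choose n) * (real (e - n) * t ^ (e - n - 1)) = pw e (Suc n) t"
  proof -
    have "real (e choose n) * real (e - n) = real (Suc n) * real (e choose Suc n)"
      using binomial_absorb_comp[of e n] binomial_absorption[of n e]
      by (metis choose_mult_lemma mult.commute of_nat_mult binomial_absorb_comp binomial_absorption)
    then have "fact n * (real (e choose n) * real (e - n)) * t ^ (e - n - 1)
        = fact n * (real (Suc n) * real (e choose Suc n)) * t ^ (e - n - 1)" by (simp only:)
    moreover have "pw e (Suc n) t = fact n * (real (Suc n) * real (e choose Suc n)) * t ^ (e - n - 1)"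
      by (simp add: pw_def algebra_simps del: binomial_Suc_Suc)
    ultimately show ?thesis by (simp only: mult.assoc)
  qed
  ultimately show ?thesis by simp
qed

lemma pw_simps: "pw e 0 t = t ^ e" "e < n \<Longrightarrow> pw e n t = 0" "pw e e t = fact e"
  by (simp_all add: pw_def)

section \<open>Derivatives of the defining functions\<close>

text \<open>A sequence of successive derivatives given explicitly, so that zero, powers,
  \<open>exp\<close> and the iterates of \<open>deriv\<close> are treated alike.\<close>

definition deriv_seq :: "(nat \<Rightarrow> real \<Rightarrow> real) \<Rightarrow> bool" where
  "deriv_seq X \<longleftrightarrow> (\<forall>n t. (X n has_real_derivative X (Suc n) t) (at t))"

lemma deriv_seqs: "deriv_seq (\<lambda>n t. 0)" "deriv_seq (pw e)" "deriv_seq (\<lambda>n. exp)"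
    "smooth f \<Longrightarrow> deriv_seq (\<lambda>n. (deriv ^^ n) f)"
  unfolding deriv_seq_def by (intro allI DERIV_const pw_deriv DERIV_exp smooth_higher_deriv(2); assumption)+

locale coords =
  fixes \<iota> :: "nat \<Rightarrow> 'i::finite" and p :: nat
  assumes iota: "bij_betw \<iota> {0..p} UNIV"
begin

definition z0 :: "real ^ 'i coord \<Rightarrow> real" where "z0 u = zc u $ \<iota> 0"

text \<open>
  \<open>X n\<close> is the \<open>n\<close>-th derivative of the summand depending on \<open>z\<^sub>0\<close> only, and \<open>FDm m X\<close> is the family of
  iterated derivatives of \<open>\<Sum> z\<^sub>i z~\<^sub>i + \<Sum>\<^sub>i\<^sub>\<le>\<^sub>m z\<^sub>i z\<^sub>0\<^sup>i\<^sup>+\<^sup>1 + X 0 z\<^sub>0\<close>. In a derivative of the middle sum at most one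
  direction hits \<open>z\<^sub>i\<close>; \<open>leib\<close> sums over this direction.
\<close>

definition cf :: "nat \<Rightarrow> (nat \<Rightarrow> real \<Rightarrow> real) \<Rightarrow> nat \<Rightarrow> real ^ 'i coord \<Rightarrow> real" where
  "cf m X n P = X n (z0 P) + (\<Sum>i=1..m. zc P $ \<iota> i * pw (i + 1) n (z0 P))"

definition lf :: "nat \<Rightarrow> nat \<Rightarrow> real \<Rightarrow> real ^ 'i \<Rightarrow> real" where
  "lf m n t y = (\<Sum>i=1..m. y $ \<iota> i * pw (i + 1) n t)"

primrec leib :: "(real ^ 'i \<Rightarrow> real) \<Rightarrow> (real ^ 'i coord) list \<Rightarrow> real" where
  "leib N [] = 0"
| "leib N (u # us) = N (zc u) * prod_list (map z0 us) + z0 u * leib N us"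

fun qd :: "(real ^ 'i coord) list \<Rightarrow> real ^ 'i coord \<Rightarrow> real" where
  "qd [] P = zc P \<bullet> ztc P"
| "qd [u] P = zc u \<bullet> ztc P + zc P \<bullet> ztc u"
| "qd [u, v] P = zc u \<bullet> ztc v + zc v \<bullet> ztc u"
| "qd (u # v # w # us) P = 0"

definition FDm :: "nat \<Rightarrow> (nat \<Rightarrow> real \<Rightarrow> real) \<Rightarrow> (real ^ 'i coord) list \<Rightarrow> real ^ 'i coord \<Rightarrow> real" where
  "FDm m X us P = qd us P + cf m X (length us) P * prod_list (map z0 us)
     + leib (lf m (length us - 1) (z0 P)) us"

lemma z0_simps [simp]: "z0 (u + v) = z0 u + z0 v" "z0 (c *\<^sub>R u) = c * z0 u" "z0 0 = 0"
  by (simp_all add: z0_def)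

lemma linear_coords: "linear z0" "linear (zc :: real ^ 'i coord \<Rightarrow> _)" "linear (ztc :: real ^ 'i coord \<Rightarrow> _)"
    "linear (\<lambda>u. zc u $ (j :: 'i))"
  by (rule linearI; simp)+

lemma linear_lf: "linear (lf m n t)"
  by (rule linearI) (simp_all add: lf_def distrib_right sum.distrib sum_distrib_left mult.assoc)

lemma has_derivative_z0_comp:
  assumes "(f has_real_derivative d) (at (z0 P))"
  shows "((\<lambda>P. f (z0 P)) has_derivative (\<lambda>u. d * z0 u)) (at P)"
  by (rule has_derivative_compose[OF linear_imp_has_derivative[OF linear_coords(1)] assms[unfolded has_field_derivative_def]])

lemma qd_fun:
  "qd [] = (\<lambda>P. zc P \<bullet> ztc P)" "qd [u] = (\<lambda>P. zc u \<bullet> ztc P + zc P \<bullet> ztc u)"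
  "qd [u, v] = (\<lambda>P. zc u \<bullet> ztc v + zc v \<bullet> ztc u)" "qd (u # v # w # vs) = (\<lambda>P. 0)"
  by (rule ext; simp)+

lemma has_derivative_qd: "(qd us has_derivative (\<lambda>u. qd (u # us) P)) (at P)"
proof -
  have d: "(zc has_derivative zc) (at P)" "(ztc has_derivative ztc) (at P)" for P :: "real ^ 'i coord"
    by (intro linear_imp_has_derivative linear_coords)+
  consider "us = []" | u where "us = [u]" | u v where "us = [u, v]" | u v w vs where "us = u # v # w # vs"
    by (metis neq_Nil_conv)
  then show ?thesis
  proof cases
    case 1
    have "((\<lambda>P :: real ^ 'i coord. zc P \<bullet> ztc P) has_derivative (\<lambda>u. zc P \<bullet> ztc u + zc u \<bullet> ztc P)) (at P)"
      by (rule has_derivative_inner[OF d])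
    then show ?thesis using 1 by (simp add: qd_fun(1) add.commute)
  next
    case (2 u)
    have "((\<lambda>P :: real ^ 'i coord. zc u \<bullet> ztc P + zc P \<bullet> ztc u) has_derivative (\<lambda>v. zc u \<bullet> ztc v + zc v \<bullet> ztc u)) (at P)"
      by (intro has_derivative_add has_derivative_inner_right has_derivative_inner_left d)
    then show ?thesis using 2 by (simp add: qd_fun(2) add.commute)
  qed (simp_all add: qd_fun(3,4))
qed

lemma has_derivative_lf: "((\<lambda>P. lf m n (z0 P) y) has_derivative (\<lambda>u. lf m (Suc n) (z0 P) y * z0 u)) (at P)"
proof -
  have "((\<lambda>P. y $ \<iota> i * pw (i + 1) n (z0 P)) has_derivative
      (\<lambda>u. y $ \<iota> i * (pw (i + 1) (Suc n) (z0 P) * z0 u))) (at P)" for i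
    by (intro has_derivative_mult_right has_derivative_z0_comp pw_deriv)
  then have "((\<lambda>P. lf m n (z0 P) y) has_derivative
      (\<lambda>u. \<Sum>i=1..m. y $ \<iota> i * (pw (i + 1) (Suc n) (z0 P) * z0 u))) (at P)"
    unfolding lf_def by (intro has_derivative_sum)
  then show ?thesis
    by (rule has_derivative_eq_rhs) (simp add: fun_eq_iff lf_def sum_distrib_right mult.assoc)
qed

lemma has_derivative_leib:
  "((\<lambda>P. leib (lf m n (z0 P)) us) has_derivative (\<lambda>u. z0 u * leib (lf m (Suc n) (z0 P)) us)) (at P)"
proof (induction us)
  case (Cons v us)
  show ?case
    unfolding leib.simps
    by (rule has_derivative_eq_rhs[OF has_derivative_add[OF has_derivative_mult_left[OF has_derivative_lf]
            has_derivative_mult_right[OF Cons]]])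
      (simp add: fun_eq_iff algebra_simps)
qed simp

lemma has_derivative_cf:
  assumes "deriv_seq X"
  shows "(cf m X n has_derivative (\<lambda>u. cf m X (Suc n) P * z0 u + lf m n (z0 P) (zc u))) (at P)"
proof -
  have "((\<lambda>P. zc P $ \<iota> i * pw (i + 1) n (z0 P)) has_derivative
      (\<lambda>u. zc P $ \<iota> i * (pw (i + 1) (Suc n) (z0 P) * z0 u) + zc u $ \<iota> i * pw (i + 1) n (z0 P))) (at P)" for i
    by (intro has_derivative_mult linear_imp_has_derivative linear_coords has_derivative_z0_comp pw_deriv)
  then have "(cf m X n has_derivative (\<lambda>u. X (Suc n) (z0 P) * z0 u + (\<Sum>i=1..m.
      zc P $ \<iota> i * (pw (i + 1) (Suc n) (z0 P) * z0 u) + zc u $ \<iota> i * pw (i + 1) n (z0 P)))) (at P)"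
    unfolding cf_def
    by (intro has_derivative_add has_derivative_sum has_derivative_z0_comp assms[unfolded deriv_seq_def, rule_format])
  then show ?thesis
    by (rule has_derivative_eq_rhs)
      (simp add: fun_eq_iff cf_def lf_def sum.distrib distrib_right sum_distrib_right mult.assoc)
qed

lemma leib_K:
  assumes "u \<in> set us" "zc u = 0" "N 0 = 0"
  shows "leib N us = 0"
  using assms(1)
proof (induction us)
  case (Cons v us)
  have z: "z0 u = 0" by (simp add: z0_def assms(2))
  show ?case
  proof (cases "u = v")
    case True
    then show ?thesis using z assms(2,3) by simp
  next
    case False
    then have u: "u \<in> set us" using Cons.prems by simp
    then have "prod_list (map z0 us) = 0" using z by (force simp: prod_list_zero_iff)
    then show ?thesis using Cons.IH[OF u] by simp
  qed
qed simp

lemma walker_FDm: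
  assumes X: "deriv_seq X"
  shows "walker swap E0 K0 (FDm m X)"
proof (intro walker.intro nf.null_frame_axioms walker_axioms.intro)
  fix us :: "(real ^ 'i coord) list" and P
  have "(FDm m X us has_derivative (\<lambda>u. qd (u # us) P
      + (cf m X (Suc (length us)) P * z0 u + lf m (length us) (z0 P) (zc u)) * prod_list (map z0 us)
      + z0 u * leib (lf m (Suc (length us - 1)) (z0 P)) us)) (at P)"
    unfolding FDm_def
    by (intro has_derivative_add has_derivative_qd has_derivative_mult_left has_derivative_cf X has_derivative_leib)
  \<comment> \<open>The truncated \<open>length us - 1\<close> goes wrong only for the empty list,
    where \<open>leib\<close> is 0.\<close>
  moreover have "leib (lf m (Suc (length us - 1)) (z0 P)) us = leib (lf m (length us) (z0 P)) us"
    by (cases us) simp_all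
  ultimately show "(FDm m X us has_derivative (\<lambda>u. FDm m X (u # us) P)) (at P)"
    by (elim has_derivative_eq_rhs) (simp add: fun_eq_iff FDm_def algebra_simps)
next
  fix u v P :: "real ^ 'i coord" show "FDm m X [u, v] P = FDm m X [v, u] P"
    by (simp add: FDm_def algebra_simps)
next
  fix u P :: "real ^ 'i coord" and us assume u: "u \<in> set us" "u \<in> K0"
  have z: "zc u = 0" "ztc u = 0" using u(2) by (simp_all add: K0_def)
  have z0: "z0 u = 0" by (simp add: z0_def z(1))
  have 1: "leib (lf m n t) us = 0" for n t
    by (rule leib_K[OF u(1) z(1)]) (simp add: lf_def)
  have 2: "prod_list (map z0 us) = 0" using u(1) z0 by (force simp: prod_list_zero_iff)
  have 3: "qd us P = 0"
    using u(1) z by (cases "(us, P)" rule: qd.cases) auto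
  show "FDm m X us P = 0" by (simp add: FDm_def 1 2 3)
qed

text \<open>Each summand of \<open>leib\<close> has one factor \<open>N\<close> and
  \<open>length us - 1\<close> factors \<open>z0\<close>; the additional factor \<open>r\<close> on
  the left avoids the subtraction in the exponent.\<close>

lemma leib_scale:
  assumes "\<And>u. N' (zc (L u)) = \<kappa> * N (zc u)" "\<And>u. z0 (L u) = r * z0 u"
  shows "leib N' (map L us) * r = \<kappa> * r ^ length us * leib N us"
proof (induction us)
  case (Cons u us)
  have "prod_list (map z0 (map L us)) = r ^ length us * prod_list (map z0 us)"
    by (induction us) (simp_all add: assms(2) algebra_simps)
  then have "leib N' (map L (u # us)) * r = \<kappa> * N (zc u) * (r ^ length us * prod_list (map z0 us)) * r
      + r * z0 u * (leib N' (map L us) * r)"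
    by (simp add: assms algebra_simps)
  also have "\<dots> = \<kappa> * r ^ length (u # us) * leib N (u # us)"
    unfolding Cons by (simp add: algebra_simps)
  finally show ?case .
qed simp

lemma prod_list_scale:
  assumes "\<And>u. z0 (L u) = r * z0 u"
  shows "prod_list (map z0 (map L us)) = r ^ length us * prod_list (map z0 us)"
  by (induction us) (simp_all add: assms algebra_simps)

lemma leib_add: "leib (\<lambda>y. N y + c * y $ \<iota> 0) us = leib N us + real (length us) * c * prod_list (map z0 us)"
  by (induction us) (simp_all add: algebra_simps flip: z0_def)

text \<open>
  The linear form \<open>N\<^sub>j\<close>, \<open>j = i + 2\<close>: the derivatives in direction \<open>z\<^sub>0\<close> alone are distributed evenly over the
  \<open>j\<close> arguments.
\<close>

definition trif :: "nat \<Rightarrow> (nat \<Rightarrow> real \<Rightarrow> real) \<Rightarrow> real ^ 'i coord \<Rightarrow> nat \<Rightarrow> real ^ 'i \<Rightarrow> real" where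
  "trif m X P i y = lf m (i + 1) (z0 P) y + cf m X (i + 2) P / real (i + 2) * y $ \<iota> 0"

lemma FDm_leib:
  assumes "length us = i + 2" "i \<ge> 1"
  shows "FDm m X us P = leib (trif m X P i) us"
proof -
  have "qd us P = 0"
    using assms by (cases "(us, P)" rule: qd.cases) auto
  then show ?thesis
    unfolding FDm_def trif_def leib_add assms(1) by simp
qed

lemma FDm_high:
  assumes "length us \<ge> m + 3"
  shows "FDm m X us P = X (length us) (z0 P) * prod_list (map z0 us)"
proof -
  have "qd us P = 0" using assms by (cases "(us, P)" rule: qd.cases) auto
  \<comment> \<open>The exponents are at most \<open>m + 1\<close>, while the order of
    differentiation is \<open>length us - 1\<close>, hence at least \<open>m + 2\<close>.\<close>
  moreover have "lf m (length us - 1) t = (\<lambda>y. 0)" for t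
    by (rule ext) (use assms in \<open>auto simp: lf_def pw_simps intro!: sum.neutral\<close>)
  moreover have "leib (\<lambda>y. 0) us = 0" by (induction us) simp_all
  moreover have "cf m X (length us) P = X (length us) (z0 P)"
    using assms by (auto simp: cf_def pw_simps intro!: sum.neutral)
  ultimately show ?thesis by (simp add: FDm_def)
qed

section \<open>Triangular systems of linear forms\<close>

lemma iota_inj: "i \<le> p \<Longrightarrow> j \<le> p \<Longrightarrow> \<iota> i = \<iota> j \<longleftrightarrow> i = j"
  using iota unfolding bij_betw_def inj_on_def by auto

lemma iota_surj: "\<exists>i\<le>p. c = \<iota> i"
  using iota unfolding bij_betw_def by (metis UNIV_I atLeastAtMost_iff image_iff)

text \<open>The kernel condition says that \<open>R i\<close> is a non-zero multiple of the
  \<open>i\<close>-th coordinate once coordinate 0 and all coordinates above \<open>i\<close> are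
  zero. This is triangularity without matrix entries.\<close>

definition tri :: "nat \<Rightarrow> (nat \<Rightarrow> real ^ 'i \<Rightarrow> real) \<Rightarrow> bool" where
  "tri k R \<longleftrightarrow> k \<le> p \<and> (\<forall>i\<in>{1..k}. linear (R i) \<and>
     (\<forall>y. y $ \<iota> 0 = 0 \<longrightarrow> (\<forall>l. i < l \<and> l \<le> p \<longrightarrow> y $ \<iota> l = 0) \<longrightarrow> R i y = 0 \<longrightarrow> y $ \<iota> i = 0))"

text \<open>The coefficient of the \<open>l\<close>-th coordinate in the \<open>i\<close>-th form is
  the derivative of order \<open>i + 1\<close> of a power with exponent \<open>l + 1\<close>: zero
  for \<open>l < i\<close> and \<open>fact (i + 1)\<close> for \<open>l = i\<close>, at every
  point.\<close>

lemma tri_trif: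
  assumes "k \<le> m" "m \<le> p"
  shows "tri k (trif m X P)"
  unfolding tri_def
proof (intro conjI ballI allI impI)
  show "k \<le> p" using assms by simp
  fix i assume i: "i \<in> {1..k}"
  show "linear (trif m X P i)"
    by (rule linearI) (simp_all add: trif_def linear_add[OF linear_lf] linear_scale[OF linear_lf] algebra_simps add_divide_distrib)
  fix y assume y: "y $ \<iota> 0 = 0" "\<forall>l. i < l \<and> l \<le> p \<longrightarrow> y $ \<iota> l = 0" "trif m X P i y = 0"
  have "lf m (i + 1) (z0 P) y = (\<Sum>l\<in>{i}. y $ \<iota> l * pw (l + 1) (i + 1) (z0 P))"
    unfolding lf_def
  proof (rule sum.mono_neutral_right)
    show "\<forall>l\<in>{1..m} - {i}. y $ \<iota> l * pw (l + 1) (i + 1) (z0 P) = 0"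
    proof
      fix l assume l: "l \<in> {1..m} - {i}"
      show "y $ \<iota> l * pw (l + 1) (i + 1) (z0 P) = 0"
      proof (cases "l < i")
        case True
        then show ?thesis by (simp add: pw_simps(2))
      next
        case False
        then have "y $ \<iota> l = 0" using y(2) l assms by auto
        then show ?thesis by simp
      qed
    qed
  qed (use i assms in auto)
  then have "y $ \<iota> i * fact (i + 1) = 0"
    using y(1,3) by (simp add: trif_def pw_simps)
  then show "y $ \<iota> i = 0" by simp
qed

definition tmap :: "nat \<Rightarrow> (nat \<Rightarrow> real ^ 'i \<Rightarrow> real) \<Rightarrow> real ^ 'i \<Rightarrow> real ^ 'i" where
  "tmap k R y = (\<chi> c. if \<exists>i\<in>{1..k}. c = \<iota> i then R (inv_into {0..p} \<iota> c) y else y $ c)"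

lemma tmap_nth:
  assumes "k \<le> p" "i \<le> p"
  shows "tmap k R y $ \<iota> i = (if 1 \<le> i \<and> i \<le> k then R i y else y $ \<iota> i)"
proof -
  have "inv_into {0..p} \<iota> (\<iota> i) = i"
    using iota assms(2) by (simp add: bij_betw_def inv_into_f_f)
  moreover have "(\<exists>j\<in>{1..k}. \<iota> i = \<iota> j) \<longleftrightarrow> 1 \<le> i \<and> i \<le> k"
    using iota_inj assms by (metis atLeastAtMost_iff order_trans)
  ultimately show ?thesis by (simp add: tmap_def)
qed

lemma tmap_bij:
  assumes "tri k R"
  shows "linear (tmap k R)" "bij (tmap k R)"
proof -
  have k: "k \<le> p" and l: "\<And>i. i \<in> {1..k} \<Longrightarrow> linear (R i)"
    and t: "\<And>i y. i \<in> {1..k} \<Longrightarrow> y $ \<iota> 0 = 0 \<Longrightarrow> (\<And>l. i < l \<Longrightarrow> l \<le> p \<Longrightarrow> y $ \<iota> l = 0) \<Longrightarrow> R i y = 0 \<Longrightarrow> y $ \<iota> i = 0"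
    using assms unfolding tri_def by auto
  note n = tmap_nth[OF k]
  show lin: "linear (tmap k R)"
  proof (rule linearI)
    fix x y :: "real ^ 'i" and c :: real
    show "tmap k R (x + y) = tmap k R x + tmap k R y"
      unfolding vec_eq_iff
    proof
      fix j obtain i where "i \<le> p" "j = \<iota> i" using iota_surj by blast
      then show "tmap k R (x + y) $ j = (tmap k R x + tmap k R y) $ j"
        using l[of i] by (simp add: n linear_add)
    qed
    show "tmap k R (c *\<^sub>R x) = c *\<^sub>R tmap k R x"
      unfolding vec_eq_iff
    proof
      fix j obtain i where "i \<le> p" "j = \<iota> i" using iota_surj by blast
      then show "tmap k R (c *\<^sub>R x) $ j = (c *\<^sub>R tmap k R x) $ j"
        using l[of i] by (simp add: n linear_scale)
    qed
  qed
  have "y = 0" if y: "tmap k R y = 0" for y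
  proof -
    have y0: "y $ \<iota> 0 = 0" using n[of 0 R y] y by simp
    \<comment> \<open>Back substitution from index \<open>p\<close> downwards: the coordinates above
      \<open>p - d\<close> are already known to vanish.\<close>
    have yi: "y $ \<iota> (p - d) = 0" for d
    proof (induction d rule: less_induct)
      case (less d)
      have up: "y $ \<iota> l = 0" if "p - d < l" "l \<le> p" for l
        using less[of "p - l"] that by simp
      show ?case
      proof (cases "1 \<le> p - d \<and> p - d \<le> k")
        case True
        have "R (p - d) y = 0" using n[of "p - d" R y] y True by simp
        show ?thesis by (rule t[OF _ y0 up]) (use True \<open>R (p - d) y = 0\<close> in auto)
      next
        case False
        then show ?thesis using n[of "p - d" R y] y by (auto split: if_splits)
      qed
    qed
    have "y $ c = 0" for c
    proof -
      obtain i where "i \<le> p" "c = \<iota> i" using iota_surj by blast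
      then show ?thesis using yi[of "p - i"] by simp
    qed
    then show "y = 0" by (simp add: vec_eq_iff)
  qed
  then have "inj (tmap k R)" using linear_injective_0[OF lin] by blast
  then show "bij (tmap k R)" using linear_injective_imp_surjective[OF lin] by (simp add: bij_def)
qed

text \<open>In the coordinates given by \<open>tmap k R\<close> and \<open>tmap k R'\<close> the
  desired map is the diagonal \<open>D\<close>, which in turn is a scaling of coordinate 0 followed
  by \<open>tmap\<close> for diagonal forms.\<close>

lemma ex_triangular:
  assumes R: "tri k R" and R': "tri k R'" and nz: "r \<noteq> 0" "\<And>i. \<kappa> i \<noteq> 0"
  shows "\<exists>M. linear M \<and> bij M \<and> (\<forall>y. M y $ \<iota> 0 = r * y $ \<iota> 0) \<and> (\<forall>i\<in>{1..k}. \<forall>y. R' i (M y) = \<kappa> i * R i y)"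
proof -
  have k: "k \<le> p" using R by (simp add: tri_def)
  define D where "D = tmap k (\<lambda>i y. \<kappa> i * y $ \<iota> i) \<circ> (\<lambda>y. \<chi> c. if c = \<iota> 0 then r * y $ c else y $ c)"
  have t: "tri k (\<lambda>i y. \<kappa> i * y $ \<iota> i)"
    unfolding tri_def using k nz by (auto intro!: linearI simp: algebra_simps)
  have d0: "linear (\<lambda>y :: real ^ 'i. \<chi> c. if c = \<iota> 0 then r * y $ c else y $ c)"
    by (rule linearI) (auto simp: vec_eq_iff algebra_simps)
  have "y = 0" if y: "(\<chi> c. if c = \<iota> 0 then r * y $ c else y $ c) = 0" for y :: "real ^ 'i"
  proof -
    have "y $ c = 0" for c
      using arg_cong[OF y, of "\<lambda>v. v $ c"] nz(1) by (simp split: if_splits)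
    then show ?thesis by (simp add: vec_eq_iff)
  qed
  then have d1: "bij (\<lambda>y :: real ^ 'i. \<chi> c. if c = \<iota> 0 then r * y $ c else y $ c)"
    unfolding bij_def
    by (intro conjI linear_injective_imp_surjective[OF d0]) (unfold linear_injective_0[OF d0], blast+)
  note T = tmap_bij[OF R] and T' = tmap_bij[OF R']
  have D: "linear D" "bij D"
    unfolding D_def by (rule linear_compose[OF d0 tmap_bij(1)[OF t]], rule bij_comp[OF d1 tmap_bij(2)[OF t]])
  define M where "M = inv (tmap k R') \<circ> (D \<circ> tmap k R)"
  have 1: "linear M" "bij M"
    unfolding M_def
    by (rule linear_compose[OF linear_compose[OF T(1) D(1)] linear_bij_inv[OF T']],
        rule bij_comp[OF bij_comp[OF T(2) D(2)] bij_imp_bij_inv[OF T'(2)]])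
  have TM: "tmap k R' (M y) = D (tmap k R y)" for y
    by (simp add: M_def surj_f_inv_f[OF bij_is_surj[OF T'(2)]])
  have z: "\<iota> i = \<iota> 0 \<longleftrightarrow> i = 0" if "i \<le> p" for i using iota_inj[OF that, of 0] by simp
  have Dn: "D x $ \<iota> i = (if i = 0 then r * x $ \<iota> 0 else if i \<le> k then \<kappa> i * x $ \<iota> i else x $ \<iota> i)" if "i \<le> p" for x i
    unfolding D_def o_def tmap_nth[OF k that] by (simp add: z[OF that])
  have "M y $ \<iota> 0 = r * y $ \<iota> 0" for y
    using TM[of y] Dn[of 0 "tmap k R y"] tmap_nth[OF k, of 0 R y] tmap_nth[OF k, of 0 R' "M y"] by simp
  moreover have "R' i (M y) = \<kappa> i * R i y" if i: "i \<in> {1..k}" for i y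
    using TM[of y] Dn[of i "tmap k R y"] tmap_nth[OF k, of i R y] tmap_nth[OF k, of i R' "M y"] i k by simp
  ultimately show ?thesis using 1 by blast
qed

end


section \<open>The manifolds of the theorem\<close>

context coords
begin

text \<open>The Hessian of the part of \<open>F\<close> that depends on the \<open>z\<close> block
  only.\<close>

definition hz :: "nat \<Rightarrow> (nat \<Rightarrow> real \<Rightarrow> real) \<Rightarrow> real ^ 'i coord \<Rightarrow> real ^ 'i \<Rightarrow> real ^ 'i \<Rightarrow> real" where
  "hz m X P y z = cf m X 2 P * (y $ \<iota> 0 * z $ \<iota> 0) + (lf m 1 (z0 P) y * z $ \<iota> 0 + y $ \<iota> 0 * lf m 1 (z0 P) z)"

lemma FDm_2: "FDm m X [u, v] P = zc u \<bullet> ztc v + zc v \<bullet> ztc u + hz m X P (zc u) (zc v)"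
  by (simp add: FDm_def hz_def z0_def numeral_2_eq_2)

lemma bilinear_hz: "bilinear (hz m X P)"
  unfolding bilinear_def
  by (intro conjI allI linearI)
    (simp_all add: hz_def linear_add[OF linear_lf] linear_scale[OF linear_lf] algebra_simps)

lemma hz_commute: "hz m X P y z = hz m X P z y"
  by (simp add: hz_def algebra_simps)

text \<open>Orders 3 to \<open>k + 2\<close> are matched by triangular forms, whatever the further
  mixed terms are. Beyond that order the functions may have no mixed terms left, hence
  \<open>m = k\<close> and \<open>m' = k\<close>, and each order costs one scalar equation. For
  \<open>n \<le> k + 2\<close> the hypothesis on high orders is empty.\<close>

lemma jet_match:
  assumes m: "m \<le> p" "m' \<le> p" "k \<le> m" "k \<le> m'" and nz: "a \<noteq> 0" "r \<noteq> 0"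
    and high: "\<And>j. k + 3 \<le> j \<Longrightarrow> j \<le> n \<Longrightarrow> m = k \<and> m' = k \<and> a\<^sup>2 * r ^ j * X' j (z0 Q) = X j (z0 P)"
  shows "\<exists>L. linear L \<and> (\<forall>u v. nf.eta (L u) (L v) = nf.eta u v) \<and> (\<forall>u. nf.xf (L u) = a * nf.xf u) \<and>
    (\<forall>u\<in>K0. L u \<in> K0) \<and> (\<forall>u. z0 (L u) = r * z0 u) \<and>
    (\<forall>us. 2 \<le> length us \<and> length us \<le> n \<longrightarrow> a\<^sup>2 * FDm m' X' (map L us) Q = FDm m X us P)"
proof -
  \<comment> \<open>At order \<open>i + 2\<close> each summand has \<open>i + 1\<close> factors
    \<open>z0\<close>, each scaled by \<open>r\<close>; \<open>\<kappa> i\<close> cancels these and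
    \<open>a\<^sup>2\<close>.\<close>
  define \<kappa> where "\<kappa> i = 1 / (a\<^sup>2 * r ^ (i + 1))" for i :: nat
  have \<kappa>: "\<kappa> i \<noteq> 0" for i using nz by (simp add: \<kappa>_def)
  obtain M where M: "linear M" "bij M" "\<And>y. M y $ \<iota> 0 = r * y $ \<iota> 0"
    "\<And>i y. i \<in> {1..k} \<Longrightarrow> trif m' X' Q i (M y) = \<kappa> i * trif m X P i y"
    using ex_triangular[where \<kappa> = \<kappa>, OF tri_trif[OF m(3,1), of X P] tri_trif[OF m(4,2), of X' Q] nz(2) \<kappa>] by blast
  \<comment> \<open>The mismatch of the Hessians left by \<open>M\<close>, to be absorbed by the
    \<open>z~\<close> block.\<close>
  define S where "S y z = hz m X P y z - a\<^sup>2 * hz m' X' Q (M y) (M z)" for y z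
  have bl: "linear (hz m X P y)" "linear (\<lambda>y. hz m X P y z)" for m X P y z
    using bilinear_hz[of m X P] by (simp_all add: bilinear_def)
  have S: "bilinear S"
    unfolding bilinear_def
  proof (intro conjI allI linearI)
    fix x y z :: "real ^ 'i" and c :: real
    note l = linear_add[OF bl(1)] linear_add[OF bl(2)] linear_scale[OF bl(1)] linear_scale[OF bl(2)]
      linear_add[OF M(1)] linear_scale[OF M(1)]
    show "S x (y + z) = S x y + S x z" "S (y + z) x = S y x + S z x"
      "S x (c *\<^sub>R y) = c *\<^sub>R S x y" "S (c *\<^sub>R y) x = c *\<^sub>R S y x"
      by (simp_all add: S_def l algebra_simps)
  qed
  have Sc: "S y z = S z y" for y z
    unfolding S_def hz_commute[of m X P y z] hz_commute[of m' X' Q "M y"] ..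
  obtain L where L: "linear L" "\<And>u v. nf.eta (L u) (L v) = nf.eta u v" "\<And>u. nf.xf (L u) = a * nf.xf u"
    "\<And>u. u \<in> K0 \<Longrightarrow> L u \<in> K0" "\<And>u. zc (L u) = M (zc u)"
    "\<And>u v. a\<^sup>2 * (zc (L u) \<bullet> ztc (L v) + zc (L v) \<bullet> ztc (L u)) = zc u \<bullet> ztc v + zc v \<bullet> ztc u + S (zc u) (zc v)"
    using ex_frame_map[OF M(1,2) nz(1) S Sc] by blast
  have Lz: "z0 (L u) = r * z0 u" for u by (simp add: z0_def L(5) M(3))
  have "a\<^sup>2 * FDm m' X' (map L us) Q = FDm m X us P" if us: "2 \<le> length us" "length us \<le> n" for us
  proof -
    define i where "i = length us - 2"
    have i: "length us = i + 2" using us by (simp add: i_def)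
    consider "i = 0" | "1 \<le> i" "i \<le> k" | "k < i" by linarith
    then show ?thesis
    proof cases
      case 1
      then have "length us = Suc (Suc 0)" using i by simp
      then obtain u v where uv: "us = [u, v]" unfolding length_Suc_conv length_0_conv by blast
      have "a\<^sup>2 * FDm m' X' (map L us) Q = a\<^sup>2 * (zc (L u) \<bullet> ztc (L v) + zc (L v) \<bullet> ztc (L u))
          + a\<^sup>2 * hz m' X' Q (M (zc u)) (M (zc v))"
        unfolding uv list.map FDm_2 by (simp add: L(5) distrib_left)
      then show ?thesis unfolding L(6) uv FDm_2 S_def by simp
    next
      case 2
      have "leib (trif m' X' Q i) (map L us) * r = \<kappa> i * r ^ length us * leib (trif m X P i) us"
        by (rule leib_scale) (use M(4) 2 in \<open>auto simp: L(5) Lz\<close>)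
      also have "\<kappa> i * r ^ length us = r / a\<^sup>2" using nz by (simp add: \<kappa>_def i)
      finally have "a\<^sup>2 * leib (trif m' X' Q i) (map L us) = leib (trif m X P i) us"
        using nz by (simp add: field_simps)
      then show ?thesis using FDm_leib[of us i] FDm_leib[of "map L us" i] i 2 by simp
    next
      case 3
      then have j: "k + 3 \<le> length us" using i by simp
      note h = high[OF j us(2)]
      have "FDm m' X' (map L us) Q = X' (length us) (z0 Q) * (r ^ length us * prod_list (map z0 us))"
        using FDm_high[of m' "map L us" X' Q] prod_list_scale[of L r us, OF Lz] h j by simp
      moreover have "FDm m X us P = X (length us) (z0 P) * prod_list (map z0 us)"
        using FDm_high[of m us X P] h j by simp
      moreover have "X (length us) (z0 P) = a\<^sup>2 * r ^ length us * X' (length us) (z0 Q)" using h by simp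
      ultimately show ?thesis by (simp add: mult_ac)
    qed
  qed
  then show ?thesis using L(1-4) Lz by blast
qed

lemma model_iso_FDm:
  assumes X: "deriv_seq X" "deriv_seq X'"
    and m: "m \<le> p" "m' \<le> p" "k \<le> m" "k \<le> m'" and nz: "a \<noteq> 0" "r \<noteq> 0"
    and high: "\<And>j. k + 3 \<le> j \<Longrightarrow> j \<le> n + 2 \<Longrightarrow> m = k \<and> m' = k \<and> a\<^sup>2 * r ^ j * X' j (z0 Q) = X j (z0 P)"
  shows "model_iso n (nf.met (FDm m X)) P (nf.met (FDm m' X')) Q"
proof -
  obtain L where L: "linear L" "\<And>u v. nf.eta (L u) (L v) = nf.eta u v" "\<And>u. nf.xf (L u) = a * nf.xf u"
    "\<And>us. 2 \<le> length us \<Longrightarrow> length us \<le> n + 2 \<Longrightarrow> a\<^sup>2 * FDm m' X' (map L us) Q = FDm m X us P"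
    using jet_match[where X = X and X' = X' and n = "n + 2", OF m nz high] by blast
  show ?thesis
    by (rule nf.model_isoI[OF walker_FDm walker_FDm L(1,2,3) nz(1) L(4)]) (use X in auto)
qed

lemma model_iso_FDm_top:
  assumes X: "deriv_seq X" "deriv_seq X'"
    and pos: "X (p + 3) (z0 P) > 0" "X (p + 4) (z0 P) > 0" "X' (p + 3) (z0 Q) > 0" "X' (p + 4) (z0 Q) > 0"
  shows "model_iso (p + 2) (nf.met (FDm p X)) P (nf.met (FDm p X')) Q"
proof -
  \<comment> \<open>The quotient of the equations of orders \<open>p + 4\<close> and
    \<open>p + 3\<close> is free of \<open>a\<close> and determines \<open>r\<close>; the equation
    of order \<open>p + 3\<close> then determines \<open>a\<^sup>2\<close>, which is positive by the
    sign assumptions.\<close>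
  define r where "r = (X (p + 4) (z0 P) / X (p + 3) (z0 P)) / (X' (p + 4) (z0 Q) / X' (p + 3) (z0 Q))"
  define a where "a = sqrt (X (p + 3) (z0 P) / (r ^ (p + 3) * X' (p + 3) (z0 Q)))"
  have r: "r > 0" using pos by (simp add: r_def)
  have a2: "a\<^sup>2 = X (p + 3) (z0 P) / (r ^ (p + 3) * X' (p + 3) (z0 Q))" and a: "a > 0"
    using pos r by (simp_all add: a_def)
  have 3: "a\<^sup>2 * r ^ (p + 3) * X' (p + 3) (z0 Q) = X (p + 3) (z0 P)"
    using pos r by (simp add: a2)
  have "a\<^sup>2 * r ^ (p + 4) * X' (p + 4) (z0 Q)
      = (a\<^sup>2 * r ^ (p + 3) * X' (p + 3) (z0 Q)) * (r * X' (p + 4) (z0 Q) / X' (p + 3) (z0 Q))"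
    using pos by (simp add: eval_nat_numeral)
  also have "\<dots> = X (p + 4) (z0 P)" unfolding 3 using pos by (simp add: r_def)
  finally have 4: "a\<^sup>2 * r ^ (p + 4) * X' (p + 4) (z0 Q) = X (p + 4) (z0 P)" .
  show ?thesis
  proof (rule model_iso_FDm[where k = p and a = a and r = r, OF X])
    fix j assume "p + 3 \<le> j" "j \<le> p + 2 + 2"
    then have "j = p + 3 \<or> j = p + 4" by auto
    then show "p = p \<and> p = p \<and> a\<^sup>2 * r ^ j * X' j (z0 Q) = X j (z0 P)" using 3 4 by auto
  qed (use a r in auto)
qed

lemma homogeneous_FDm:
  assumes X: "deriv_seq X" and m: "m \<le> p"
    and shift: "\<And>s. \<exists>a. a \<noteq> 0 \<and> (\<forall>t. a\<^sup>2 * X (m + 3) (t + s) = X (m + 3) t)"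
  shows "homogeneous (nf.met (FDm m X))"
proof (rule walker.homogeneous_metI[OF walker_FDm[OF X], where n = "m + 2"])
  fix b
  obtain a where a: "a \<noteq> 0" "\<And>t. a\<^sup>2 * X (m + 3) (t + z0 b) = X (m + 3) t" using shift[of "z0 b"] by blast
  obtain L where L: "linear L" "\<And>u v. nf.eta (L u) (L v) = nf.eta u v" "\<And>u. nf.xf (L u) = a * nf.xf u"
    "\<And>u. u \<in> K0 \<Longrightarrow> L u \<in> K0" "\<And>u. z0 (L u) = 1 * z0 u"
    "\<And>us. 2 \<le> length us \<Longrightarrow> length us \<le> m + 2 \<Longrightarrow> a\<^sup>2 * FDm m X (map L us) b = FDm m X us 0"
    \<comment> \<open>With \<open>n = m + 2\<close> no scalar equation arises, and
      \<open>r = 1\<close> makes \<open>L P + b\<close> act on \<open>z0\<close> as translation by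
      \<open>z0 b\<close>.\<close>
    using jet_match[where X = X and X' = X and n = "m + 2" and k = m and r = 1 and a = a and Q = b and P = 0, OF m m order_refl order_refl a(1)]
    by fastforce
  have top: "a\<^sup>2 * FDm m X (map L us) (L P + b) = FDm m X us P" if us: "length us = m + 2 + 1" for us P
  proof -
    have "prod_list (map z0 (map L us)) = prod_list (map z0 us)"
      using prod_list_scale[of L 1 us, OF L(5)] by simp
    moreover have l: "length us = m + 3" using us by simp
    have "FDm m X us P = X (m + 3) (z0 P) * prod_list (map z0 us)"
      by (subst FDm_high) (simp_all only: l order_refl)
    moreover have "FDm m X (map L us) (L P + b) = X (m + 3) (z0 P + z0 b) * prod_list (map z0 (map L us))"
      by (subst FDm_high) (simp_all only: length_map l order_refl z0_simps(1) L(5) mult_1)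
    ultimately show ?thesis using a(2)[of "z0 P"] by (simp only: mult.assoc[symmetric])
  qed
  show "\<exists>a L. linear L \<and> (\<forall>u v. nf.eta (L u) (L v) = nf.eta u v) \<and> (\<forall>u. nf.xf (L u) = a * nf.xf u) \<and>
      (\<forall>k\<in>K0. L k \<in> K0) \<and>
      (\<forall>us. 2 \<le> length us \<and> length us \<le> m + 2 \<longrightarrow> a\<^sup>2 * FDm m X (map L us) b = FDm m X us 0) \<and>
      (\<forall>us P. length us = m + 2 + 1 \<longrightarrow> a\<^sup>2 * FDm m X (map L us) (L P + b) = FDm m X us P)"
    by (intro exI[of _ a] exI[of _ L] conjI allI ballI impI L top) auto
qed simp

lemma met_FDm:
  "nf.met (FDm m X) = metric_M \<iota> (\<lambda>z. (\<Sum>i=1..m. z i * z 0 ^ (i + 1)) + X 0 (z 0))"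
proof (intro ext)
  fix P u v :: "real ^ 'i coord"
  have "nf.eta u v = (u $ Cx * v $ Cxs + u $ Cxs * v $ Cx)
     + (\<Sum>i\<in>UNIV. u $ Cz i * v $ Czs i + u $ Czs i * v $ Cz i)
     + (\<Sum>i\<in>UNIV. u $ Czt i * v $ Czts i + u $ Czts i * v $ Czt i)"
    by (simp add: eta_coord inner_vec_def zc_def ztc_def zsc_def ztsc_def sum.distrib)
  moreover have "FDm m X [] P = (\<Sum>i=1..m. P $ Cz (\<iota> i) * P $ Cz (\<iota> 0) ^ (i + 1)) + X 0 (P $ Cz (\<iota> 0))
      + (\<Sum>i\<in>UNIV. P $ Cz i * P $ Czt i)"
    by (simp add: FDm_def cf_def pw_simps z0_def zc_def ztc_def inner_vec_def)
  ultimately show "nf.met (FDm m X) P u v = metric_M \<iota> (\<lambda>z. (\<Sum>i=1..m. z i * z 0 ^ (i + 1)) + X 0 (z 0)) P u v"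
    unfolding nf.met_def metric_M_def xf_coord by (simp add: algebra_simps)
qed

lemma metric_S_FDm: "metric_S \<iota> = nf.met (FDm 0 (\<lambda>n t. 0))"
  unfolding met_FDm metric_S_def by simp

lemma metric_N_FDm: "metric_N p \<iota> \<psi> = nf.met (FDm p (\<lambda>n. (deriv ^^ n) \<psi>))"
  unfolding met_FDm metric_N_def f_N_def[abs_def] by simp

lemma metric_H_FDm:
  "j \<le> p \<Longrightarrow> metric_H p \<iota> j = nf.met (FDm j (\<lambda>n t. 0))"
  "metric_H p \<iota> (p + 1) = nf.met (FDm p (pw (p + 3)))"
  "metric_H p \<iota> (p + 2) = nf.met (FDm p (\<lambda>n. exp))"
  unfolding met_FDm metric_H_def f_H_def[abs_def] by (simp_all add: pw_simps)

lemma indecomposable_S: "indecomposable (metric_S \<iota>)"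
proof -
  interpret walker swap E0 K0 "FDm 0 (\<lambda>n t. 0)" by (rule walker_FDm[OF deriv_seqs(1)])
  interpret quadratic_walker swap E0 K0 "FDm 0 (\<lambda>n t. 0)" "\<lambda>P. point 0 0 0 0 (ztc P) (zc P)" "point 1 0 0 0 0 0"
  proof unfold_locales
    show "FDm 0 (\<lambda>n t. 0) [w] P = nf.eta (point 0 0 0 0 (ztc P) (zc P)) w" for w P :: "real ^ 'i coord"
      by (simp add: FDm_def cf_def lf_def eta_coord inner_commute)
    show "nf.xf (point 1 0 0 0 0 (0 :: real ^ 'i)) = 1" by (simp add: xf_coord)
    show "point 0 0 0 0 (ztc (point 1 0 0 0 0 (0 :: real ^ 'i))) (zc (point 1 0 0 0 0 (0 :: real ^ 'i))) = 0"
      by (simp add: coord_eq_iff)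
    show "u \<in> K0" if "nf.xf u = 0"
      and *: "\<And>\<zeta>. nf.xf \<zeta> = 0 \<Longrightarrow> nf.eta (point 0 0 0 0 (ztc \<zeta>) (zc \<zeta>)) u = 0" for u :: "real ^ 'i coord"
    proof -
      \<comment> \<open>The test vector exchanges the two blocks of \<open>u\<close>, so that its
        image under the gradient map pairs with \<open>u\<close> to a sum of squares.\<close>
      have "zc u \<bullet> zc u + ztc u \<bullet> ztc u = 0"
        using *[of "point 0 (ztc u) (zc u) 0 0 0"] by (simp add: eta_coord xf_coord)
      moreover have "zc u \<bullet> zc u \<ge> 0" "ztc u \<bullet> ztc u \<ge> 0" by simp_all
      ultimately have "zc u \<bullet> zc u = 0" "ztc u \<bullet> ztc u = 0" by linarith+
      then show ?thesis using that(1) by (simp add: K0_def xf_coord)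
    qed
    have "point 0 1 0 0 0 (0 :: real ^ 'i) \<notin> K0" by (simp add: K0_def vec_eq_iff)
    then show "\<exists>u :: real ^ 'i coord. nf.xf u = 0 \<and> u \<notin> K0"
      by (intro exI[of _ "point 0 1 0 0 0 0"]) (simp add: xf_coord)
  qed (simp_all add: coord_eq_iff)
  show ?thesis unfolding metric_S_FDm by (rule indecomposable_met)
qed

lemma homogeneous_S: "homogeneous (metric_S \<iota>)"
  unfolding metric_S_FDm by (rule homogeneous_FDm[OF deriv_seqs(1)]) (auto intro: exI[of _ 1])

lemma symmetric_S: "symmetric_space (metric_S \<iota>)"
proof (rule symmetric_spaceI[OF homogeneous_S])
  interpret walker swap E0 K0 "FDm 0 (\<lambda>n t. 0)" by (rule walker_FDm[OF deriv_seqs(1)])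
  show "isometry (metric_S \<iota>) uminus"
    unfolding metric_S_FDm by (rule isometry_uminus) (simp add: FDm_def cf_def)
qed

text \<open>The decisive derivative of the one-variable part is 0, the constant
  \<open>fact (p + 3)\<close>, or \<open>exp\<close>. The first two are invariant under
  translations; the last is rescaled, which \<open>a = exp (- s / 2)\<close> compensates.\<close>

lemma homogeneous_H:
  assumes "1 \<le> j" "j \<le> p + 2"
  shows "homogeneous (metric_H p \<iota> j)"
proof -
  consider "j \<le> p" | "j = p + 1" | "j = p + 2" using assms by linarith
  then show ?thesis
  proof cases
    case 1
    show ?thesis
      unfolding metric_H_FDm(1)[OF 1] by (rule homogeneous_FDm[OF deriv_seqs(1)]) (use 1 in \<open>auto intro: exI[of _ 1]\<close>)
  next
    case 2
    show ?thesis
      unfolding 2 metric_H_FDm(2) by (rule homogeneous_FDm[OF deriv_seqs(2)]) (auto simp: pw_simps intro: exI[of _ 1])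
  next
    case 3
    have "(exp (- s / 2))\<^sup>2 * exp (t + s) = exp t" for s t :: real
      by (simp add: power2_eq_square flip: exp_add)
    then show ?thesis
      unfolding 3 metric_H_FDm(3)
      by (intro homogeneous_FDm[OF deriv_seqs(3)] order_refl exI[of _ "exp (- s / 2)" for s]) auto
  qed
qed

lemma alpha_sq_z0:
  "alpha_sq p \<iota> \<psi> P = (deriv ^^ (p + 5)) \<psi> (z0 P) * (deriv ^^ (p + 3)) \<psi> (z0 P) / ((deriv ^^ (p + 4)) \<psi> (z0 P))\<^sup>2"
  by (simp add: alpha_sq_def Let_def z0_def zc_def)

text \<open>At these orders \<open>F\<close> differentiates like a function of \<open>z0\<close>
  alone, so the value is a scalar times a vector that depends only on \<open>C\<close>.\<close>

lemma Rop_FDm: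
  assumes "length us \<ge> m + 1"
  shows "nf.Rop (FDm m X) us P A B C = (X (length us + 2) (z0 P) * prod_list (map z0 us) * (nf.xf B * z0 A - nf.xf A * z0 B))
     *\<^sub>R (nf.xf C *\<^sub>R nf.sharp z0 - z0 C *\<^sub>R E0)"
proof -
  have 1: "FDm m X (us @ [A, w]) P = X (length us + 2) (z0 P) * prod_list (map z0 us) * z0 A * z0 w" for A w
    using FDm_high[of m "us @ [A, w]" X P] assms by simp
  have 2: "nf.sharp (\<lambda>w. c * z0 w) = c *\<^sub>R nf.sharp z0" for c
    by (simp add: nf.sharp_def scaleR_sum_right)
  show ?thesis
    unfolding nf.Rop_def 1 2 by (simp add: algebra_simps)
qed

lemma sharp_z0_nonzero: "nf.sharp z0 \<noteq> 0"
proof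
  assume "nf.sharp z0 = 0"
  moreover have "nf.eta (nf.sharp z0) (point 0 (axis (\<iota> 0) 1) 0 0 0 0) = 1"
    by (simp add: nf.eta_sharp[OF linear_coords(1)] z0_def axis_def)
  ultimately show False by simp
qed

text \<open>All that remains of \<open>\<Phi>\<close> after evaluation on \<open>?A\<close> and
  \<open>?B\<close> is the scalar \<open>\<mu>\<close> and the vectors \<open>V\<close> and
  \<open>W\<close>, the same for all three orders. Eliminating \<open>\<mu>\<close> and the ratio of
  \<open>V\<close> to \<open>W\<close> from the three equations leaves
  \<open>alpha_sq\<close>.\<close>

lemma affine_model_iso_alpha:
  assumes \<psi>: "smooth \<psi>" and pos: "\<And>t. (deriv ^^ (p + 3)) \<psi> t > 0" "\<And>t. (deriv ^^ (p + 4)) \<psi> t > 0"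
    and iso: "affine_model_iso (p + 3) (metric_N p \<iota> \<psi>) P (metric_N p \<iota> \<psi>) Q"
  shows "alpha_sq p \<iota> \<psi> P = alpha_sq p \<iota> \<psi> Q"
proof -
  let ?X = "\<lambda>n. (deriv ^^ n) \<psi>"
  interpret walker swap E0 K0 "FDm p ?X"
    by (rule walker_FDm[OF deriv_seqs(4)[OF \<psi>]])
  obtain \<Phi> where \<Phi>: "linear \<Phi>" "bij \<Phi>" and R: "\<And>i vs. i \<le> p + 3 \<Longrightarrow> length vs = 3 + i \<Longrightarrow>
      nabla_curv_op (nf.met (FDm p ?X)) i Q (map \<Phi> vs) = \<Phi> (nabla_curv_op (nf.met (FDm p ?X)) i P vs)"
    using iso unfolding affine_model_iso_def metric_N_FDm by blast
  \<comment> \<open>The coordinate vectors of \<open>z_0\<close> and of \<open>x\<close>.\<close>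
  let ?A = "point 0 (axis (\<iota> 0) 1) 0 0 0 0" and ?B = "point 1 0 0 0 0 (0 :: real ^ 'i)"
  define \<mu> where "\<mu> = z0 (\<Phi> ?A)"
  define W where "W = \<Phi> (nf.sharp z0)"
  define V where "V = (nf.xf (\<Phi> ?B) * z0 (\<Phi> ?A) - nf.xf (\<Phi> ?A) * z0 (\<Phi> ?B))
     *\<^sub>R (nf.xf (\<Phi> ?B) *\<^sub>R nf.sharp z0 - z0 (\<Phi> ?B) *\<^sub>R E0)"
  have W: "W \<noteq> 0"
    unfolding W_def using sharp_z0_nonzero bij_is_inj[OF \<Phi>(2)] linear_injective_0[OF \<Phi>(1)] by blast
  have ab: "z0 ?A = 1" "z0 ?B = 0" "nf.xf ?A = 0" "nf.xf ?B = 1"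
    by (simp_all add: z0_def xf_coord axis_def)
  have eq: "(?X (i + 2) (z0 Q) * \<mu> ^ i) *\<^sub>R V = ?X (i + 2) (z0 P) *\<^sub>R W" if "p + 1 \<le> i" "i \<le> p + 3" for i
  proof -
    let ?us = "replicate i ?A"
    have l: "length ?us = i" "length (map \<Phi> ?us) = i" by simp_all
    have "nf.Rop (FDm p ?X) (map \<Phi> ?us) Q (\<Phi> ?A) (\<Phi> ?B) (\<Phi> ?B) = \<Phi> (nf.Rop (FDm p ?X) ?us P ?A ?B ?B)"
      using R[OF that(2), of "?us @ [?A, ?B, ?B]"] nabla_curv_op_met[OF l(1)] nabla_curv_op_met[OF l(2)] by simp
    moreover have "nf.Rop (FDm p ?X) (map \<Phi> ?us) Q (\<Phi> ?A) (\<Phi> ?B) (\<Phi> ?B) = (?X (i + 2) (z0 Q) * \<mu> ^ i) *\<^sub>R V"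
      using that by (subst Rop_FDm) (simp_all add: V_def \<mu>_def mult.assoc)
    moreover have "nf.Rop (FDm p ?X) ?us P ?A ?B ?B = ?X (i + 2) (z0 P) *\<^sub>R nf.sharp z0"
      using that by (subst Rop_FDm) (simp_all add: ab)
    ultimately show ?thesis by (simp add: W_def linear_scale[OF \<Phi>(1)])
  qed
  define c where "c j = ?X (p + j) (z0 P)" for j
  define d where "d j = ?X (p + j) (z0 Q)" for j
  have cd: "c 3 > 0" "d 3 > 0" "c 4 > 0" "d 4 > 0" unfolding c_def d_def by (rule pos)+
  have e3: "(d 3 * \<mu> ^ (p + 1)) *\<^sub>R V = c 3 *\<^sub>R W"
    and e4: "(d 4 * \<mu> ^ (p + 2)) *\<^sub>R V = c 4 *\<^sub>R W"
    and e5: "(d 5 * \<mu> ^ (p + 3)) *\<^sub>R V = c 5 *\<^sub>R W"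
    using eq[of "p + 1"] eq[of "p + 2"] eq[of "p + 3"] by (simp_all add: c_def d_def eval_nat_numeral)
  have "(d 3 * \<mu> ^ (p + 1)) *\<^sub>R V \<noteq> 0" unfolding e3 using cd W by simp
  then have \<mu>: "\<mu> \<noteq> 0" by auto
  have V: "V = (c 3 / (d 3 * \<mu> ^ (p + 1))) *\<^sub>R W"
  proof -
    have "V = (1 / (d 3 * \<mu> ^ (p + 1))) *\<^sub>R ((d 3 * \<mu> ^ (p + 1)) *\<^sub>R V)" using \<mu> cd by simp
    then show ?thesis unfolding e3 by simp
  qed
  have "d 4 * \<mu> ^ (p + 2) * (c 3 / (d 3 * \<mu> ^ (p + 1))) = c 4"
    using e4 W unfolding V by simp
  then have 4: "c 4 = d 4 * \<mu> * c 3 / d 3" using \<mu> by (simp add: field_simps)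
  have "d 5 * \<mu> ^ (p + 3) * (c 3 / (d 3 * \<mu> ^ (p + 1))) = c 5"
    using e5 W unfolding V by simp
  moreover have "\<mu> ^ (p + 3) = \<mu>\<^sup>2 * \<mu> ^ (p + 1)" by (simp add: power2_eq_square eval_nat_numeral)
  ultimately have 5: "c 5 = d 5 * \<mu>\<^sup>2 * c 3 / d 3" using \<mu> by (simp add: field_simps)
  have "c 5 * c 3 / (c 4)\<^sup>2 = d 5 * d 3 / (d 4)\<^sup>2"
    unfolding 4 5 using \<mu> cd by (simp add: field_simps power2_eq_square)
  then show ?thesis unfolding alpha_sq_z0 c_def d_def .
qed

end

lemma exponential_of_const_ratio:
  fixes h :: "real \<Rightarrow> real"
  assumes h: "\<And>t. (h has_real_derivative h' t) (at t)" "\<And>t. (h' has_real_derivative h'' t) (at t)"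
    and pos: "\<And>t. h t > 0" "\<And>t. h' t > 0" and c: "\<And>t. h'' t * h t / (h' t)\<^sup>2 = c"
  shows "\<exists>a b. a \<noteq> 0 \<and> b \<noteq> 0 \<and> (\<forall>t. h t = a * exp (b * t))"
proof -
  have nz: "h' t \<noteq> 0" for t using pos(2)[of t] by simp
  have "((\<lambda>t. h t / h' t - (1 - c) * t) has_real_derivative 0) (at t)" for t
  proof -
    have "(h' t * h' t - h t * h'' t) / (h' t * h' t) = 1 - c"
      using nz[of t] c[of t] by (simp add: diff_divide_distrib power2_eq_square mult.commute)
    moreover have "((\<lambda>t. h t / h' t - (1 - c) * t) has_real_derivative
        (h' t * h' t - h t * h'' t) / (h' t * h' t) - (1 - c) * 1) (at t)"
      by (intro DERIV_diff DERIV_divide DERIV_cmult DERIV_ident h nz)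
    ultimately show ?thesis by simp
  qed
  then have "h t / h' t - (1 - c) * t = h 0 / h' 0 - (1 - c) * 0" for t
    by (intro DERIV_isconst_all allI)
  then have eq: "h t / h' t - (1 - c) * t = h 0 / h' 0" for t by (simp only: mult_zero_right diff_zero)
  define q0 where "q0 = h 0 / h' 0"
  have q: "h t / h' t = q0 + (1 - c) * t" for t
    using eq[of t] unfolding q0_def[symmetric] by linarith
  have q0: "q0 > 0" using pos by (simp add: q0_def)
  have c1: "c = 1"
  proof (rule ccontr)
    assume "c \<noteq> 1"
    \<comment> \<open>The zero of the non-constant affine function \<open>h / h'\<close>.\<close>
    then have "h (- q0 / (1 - c)) / h' (- q0 / (1 - c)) = 0" unfolding q by simp
    then show False using pos(1)[of "- q0 / (1 - c)"] nz by simp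
  qed
  define b where "b = 1 / q0"
  have h': "h' t = b * h t" for t
    using q[of t] nz[of t] q0 unfolding c1 b_def by (simp add: field_simps)
  have "((\<lambda>t. h t * exp (- b * t)) has_real_derivative 0) (at t)" for t
  proof -
    have "((\<lambda>t. exp (- b * t)) has_real_derivative - b * exp (- b * t)) (at t)"
      by (auto intro!: derivative_eq_intros)
    from DERIV_mult[OF h(1) this] show ?thesis
      by (rule DERIV_cong) (simp only: h', simp)
  qed
  then have e: "h t * exp (- b * t) = h 0 * exp (- b * 0)" for t
    by (intro DERIV_isconst_all allI)
  have h_eq: "h t = h 0 * exp (b * t)" for t
  proof -
    have "h t = h t * exp (- b * t) * exp (b * t)" by (simp add: exp_minus)
    then show ?thesis unfolding e[of t] by simp
  qed
  have "h 0 \<noteq> 0" "b \<noteq> 0" using pos(1)[of 0] q0 by (simp_all add: b_def)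
  then show ?thesis using h_eq by blast
qed

theorem theorem1p10:
  fixes p :: nat and \<iota> :: "nat \<Rightarrow> 'i::finite" and \<psi> :: "real \<Rightarrow> real"
  assumes "p \<ge> 1"
    and "bij_betw \<iota> {0..p} (UNIV :: 'i set)"
    and "smooth \<psi>"
    and "\<And>t. (deriv ^^ (p + 3)) \<psi> t > 0"
    and "\<And>t. (deriv ^^ (p + 4)) \<psi> t > 0"
  shows "(indecomposable (metric_S \<iota>) \<and> symmetric_space (metric_S \<iota>) \<and>
          modeled_on 0 (metric_N p \<iota> \<psi>) (metric_S \<iota>)) \<and>
         (\<forall>j\<in>{1..p + 2}. modeled_on j (metric_N p \<iota> \<psi>) (metric_H p \<iota> j)) \<and>
         curvature_homogeneous (p + 2) (metric_N p \<iota> \<psi>) \<and>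
         ((homogeneous (metric_N p \<iota> \<psi>) \<longleftrightarrow>
           affine_curvature_homogeneous (p + 3) (metric_N p \<iota> \<psi>)) \<and>
          (affine_curvature_homogeneous (p + 3) (metric_N p \<iota> \<psi>) \<longleftrightarrow>
           (\<exists>c. \<forall>P. alpha_sq p \<iota> \<psi> P = c)) \<and>
          ((\<exists>c. \<forall>P. alpha_sq p \<iota> \<psi> P = c) \<longleftrightarrow>
           (\<exists>a b. a \<noteq> 0 \<and> b \<noteq> 0 \<and> (\<forall>t. (deriv ^^ (p + 3)) \<psi> t = a * exp (b * t)))))"
proof -
  interpret coords \<iota> p by unfold_locales (rule assms(2))
  let ?X = "\<lambda>n. (deriv ^^ n) \<psi>"
  note X = deriv_seqs(4)[OF assms(3)]
  let ?N = "metric_N p \<iota> \<psi>"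
  have S: "modeled_on 0 ?N (metric_S \<iota>)"
    unfolding modeled_on_def
  proof (intro conjI homogeneous_S allI)
    \<comment> \<open>The scalar equations would concern orders from 3 to 2, so there are none, and
      any scalings will do.\<close>
    show "model_iso 0 ?N P (metric_S \<iota>) Q" for P Q
      unfolding metric_S_FDm metric_N_FDm
      by (rule model_iso_FDm[where k = 0 and a = 1 and r = 1]) (simp_all add: X deriv_seqs)
  qed
  have H: "modeled_on j ?N (metric_H p \<iota> j)" if j: "1 \<le> j" "j \<le> p + 2" for j
    unfolding modeled_on_def
  proof (intro conjI homogeneous_H j allI)
    fix P Q
    consider "j \<le> p" | "j = p + 1" | "j = p + 2" using j by linarith
    then show "model_iso j ?N P (metric_H p \<iota> j) Q"
    proof cases
      case 1
      \<comment> \<open>\<open>?N\<close> has \<open>p\<close> mixed terms and the model only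
        \<open>j\<close>; with \<open>k = j\<close> the matching ends at order \<open>j + 2\<close>,
        before the difference counts.\<close>
      show ?thesis
        unfolding metric_H_FDm(1)[OF 1] metric_N_FDm
        by (rule model_iso_FDm[where k = j and a = 1 and r = 1]) (use 1 in \<open>simp_all add: X deriv_seqs\<close>)
    next
      case 2
      \<comment> \<open>Only order \<open>p + 3\<close> costs an equation. There the model has the
        constant derivative \<open>fact (p + 3)\<close>, and \<open>a\<close> alone settles
        it.\<close>
      define a where "a = sqrt (?X (p + 3) (z0 P) / fact (p + 3))"
      have a: "a > 0" "a\<^sup>2 = ?X (p + 3) (z0 P) / fact (p + 3)"
        using assms(4)[of "z0 P"] by (simp_all only: a_def real_sqrt_gt_zero real_sqrt_pow2 divide_pos_pos fact_gt_zero less_imp_le)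
      show ?thesis
        unfolding 2 metric_H_FDm(2) metric_N_FDm
      proof (rule model_iso_FDm[where k = p and a = a and r = 1, OF X deriv_seqs(2)])
        fix i assume "p + 3 \<le> i" "i \<le> p + 1 + 2"
        then have i: "i = p + 3" by simp
        show "p = p \<and> p = p \<and> a\<^sup>2 * 1 ^ i * pw (p + 3) i (z0 Q) = ?X i (z0 P)"
          unfolding i a(2) pw_simps(3) by simp
      qed (use a(1) in simp_all)
    next
      case 3
      show ?thesis
        unfolding 3 metric_H_FDm(3) metric_N_FDm
        by (rule model_iso_FDm_top[OF X deriv_seqs(3) assms(4,5)]) simp_all
    qed
  qed
  have C: "curvature_homogeneous (p + 2) ?N"
    unfolding curvature_homogeneous_def metric_N_FDm
    by (intro allI model_iso_FDm_top X assms(4,5))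
  have ab: "affine_curvature_homogeneous (p + 3) ?N" if "homogeneous ?N"
    using walker.homogeneous_imp_affine_curvature_homogeneous[OF walker_FDm[OF X]] that
    unfolding metric_N_FDm by blast
  have bc: "\<exists>c. \<forall>P. alpha_sq p \<iota> \<psi> P = c" if "affine_curvature_homogeneous (p + 3) ?N"
    using affine_model_iso_alpha[OF assms(3-5)] that unfolding affine_curvature_homogeneous_def by blast
  have cd: "\<exists>a b. a \<noteq> 0 \<and> b \<noteq> 0 \<and> (\<forall>t. ?X (p + 3) t = a * exp (b * t))"
    if "\<exists>c. \<forall>P. alpha_sq p \<iota> \<psi> P = c"
  proof -
    from that obtain c where "\<forall>P. alpha_sq p \<iota> \<psi> P = c" ..
    then have c: "alpha_sq p \<iota> \<psi> P = c" for P by (rule spec)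
    have r: "?X (p + 5) t * ?X (p + 3) t / (?X (p + 4) t)\<^sup>2 = c" for t
      using c[of "point 0 (axis (\<iota> 0) t) 0 0 0 0"] unfolding alpha_sq_z0 z0_def point_simps(3) axis_nth .
    have n: "p + 4 = Suc (p + 3)" "p + 5 = Suc (p + 4)" by simp_all
    have d: "(?X (p + 3) has_real_derivative ?X (p + 4) t) (at t)" "(?X (p + 4) has_real_derivative ?X (p + 5) t) (at t)" for t
      unfolding n by (rule smooth_higher_deriv(2)[OF assms(3)])+
    show ?thesis
      by (rule exponential_of_const_ratio[OF d assms(4,5) r])
  qed
  \<comment> \<open>This closes the cycle (a), (b), (c), (d), (a): an exponential is rescaled by
    translations, as \<open>homogeneous_FDm\<close> requires.\<close>
  have dc: "\<exists>c. \<forall>P. alpha_sq p \<iota> \<psi> P = c" and da: "homogeneous ?N"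
    if d: "\<exists>a b. a \<noteq> 0 \<and> b \<noteq> 0 \<and> (\<forall>t. ?X (p + 3) t = a * exp (b * t))"
  proof -
    obtain a b where e: "\<And>t. ?X (p + 3) t = a * exp (b * t)" using d by blast
    have hom: "homogeneous (nf.met (FDm p ?X))"
    proof (rule homogeneous_FDm[OF X order_refl])
      fix s
      have "(exp (- (b * s) / 2))\<^sup>2 * ?X (p + 3) (t + s) = ?X (p + 3) t" for t
      proof -
        have "(exp (- (b * s) / 2))\<^sup>2 * exp (b * (t + s)) = exp (- (b * s) / 2 + (- (b * s) / 2 + b * (t + s)))"
          by (simp only: power2_eq_square exp_add mult.assoc)
        also have "- (b * s) / 2 + (- (b * s) / 2 + b * (t + s)) = b * t" by (simp add: algebra_simps)
        finally show ?thesis unfolding e by (simp only: mult.left_commute)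
      qed
      then show "\<exists>a. a \<noteq> 0 \<and> (\<forall>t. a\<^sup>2 * ?X (p + 3) (t + s) = ?X (p + 3) t)"
        by (intro exI[of _ "exp (- (b * s) / 2)"]) simp
    qed
    then show h: "homogeneous ?N" unfolding metric_N_FDm .
    show "\<exists>c. \<forall>P. alpha_sq p \<iota> \<psi> P = c" by (rule bc[OF ab[OF h]])
  qed
  show ?thesis
  proof (intro conjI ballI)
    show "modeled_on j ?N (metric_H p \<iota> j)" if "j \<in> {1..p + 2}" for j
      using H that unfolding atLeastAtMost_iff by blast
    show "homogeneous ?N \<longleftrightarrow> affine_curvature_homogeneous (p + 3) ?N" using ab bc cd da by blast
    show "affine_curvature_homogeneous (p + 3) ?N \<longleftrightarrow> (\<exists>c. \<forall>P. alpha_sq p \<iota> \<psi> P = c)" using ab bc cd da by blast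
    show "(\<exists>c. \<forall>P. alpha_sq p \<iota> \<psi> P = c) \<longleftrightarrow>
        (\<exists>a b. a \<noteq> 0 \<and> b \<noteq> 0 \<and> (\<forall>t. ?X (p + 3) t = a * exp (b * t)))" using cd dc by blast
  qed (rule indecomposable_S symmetric_S S C)+
qed

end
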